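(* Let $T>0$, $H\in(1/2,1)$, $\kappa,\theta\in\mathbb{R}$ with $\kappa\theta>0$, $\sigma>0$, $r_0>0$, $X_0=\sqrt{r_0}$, and let $\{B(t)\}_{t\in[0,T]}$ be a fractional Brownian motion with Hurst parameter $H$. Let $\xi\in(0,1)$ and $p\ge 2$, and assume that $$\kappa\theta \exp\left(\frac{\kappa s}{2}\right) \ge (3p+1)\int_{0}^{s} \frac{\sigma^2}{2} \exp\left(\frac{\kappa \tau}{2}\right) \phi(\tau,s)\,d\tau, \qquad \forall\, 0\le s\le T,$$ where $\phi(\tau,s)=H(2H-1)|s-\tau|^{2H-2}$. Let $r(\cdot)$ be the exact solution of the Cox--Ingersoll--Ross equation $$dr(t)=\kappa(\theta-r(t))dt+\sigma\sqrt{r(t)}\,dB(t),\quad t\in(0,T],\qquad r(0)=r_0.$$ For a step size $h=T/N$, $N\in\{1,2,\dots\}$, put $t_n=nh$, $\Delta B_{n+1}=B(t_{n+1})-B(t_n)$, and for $n=0,\dots,N-1$ $$X_{n+1}=\frac{X_n+\frac12\sigma\Delta B_{n+1}+\sqrt{\left(X_n+\frac12\sigma \Delta B_{n+1}\right)^2+\kappa h\theta (2+\kappa h)}}{2+\kappa h},$$ $$X^h(t)=X_n+\frac{t-t_n}{h}(X_{n+1}-X_n)\ \text{ for } t\in(t_n,t_{n+1}],\qquad X^h(0)=X_0,$$ and $r^h(t):=(X^h(t))^2$. Then for any such $h$ with $h\in(0,1)$ and $h\max\{0,-\kappa/2\}<1-\xi$, it holds that $$\left(\mathbb{E}\left[\sup_{1\le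 n\le N}|r(t_n)-r^h(t_n)|^{\frac{p}{2}}\right]\right)^{\frac2p}\le C(T,H,p,X_0,\kappa,\theta,\sigma,\xi)\,h$$ and $$\left(\mathbb{E}\left[\sup_{0\le t\le T}|r(t)-r^h(t)|^{\frac{p}{2}}\right]\right)^{\frac2p}\le C(T,H,p,X_0,\kappa,\theta,\sigma,\xi)\,h^H\sqrt{\log \frac{T}{h}}.$$
   Context: A fractional Brownian motion with Hurst parameter $H$ on a probability space $(\Omega,\mathcal{F},\mathbb{P})$ is a centered Gaussian process with continuous sample paths and covariance $\mathbb{E}[B(t)B(s)]=\frac12(t^{2H}+s^{2H}-|t-s|^{2H})$. The equation for $r$ is understood as a pathwise Riemann--Stieltjes integral equation, for which the ordinary chain rule holds. Its solution is $r=X^2$, where $X=\sqrt{r}$ (Lamperti transformation) is the unique process with continuous, strictly positive paths satisfying almost surely, for all $t\in[0,T]$, $X(t)=X_0+\int_0^t\frac12\kappa(\theta/X(s)-X(s))ds+\frac12\sigma B(t)$. The formula for $X_{n+1}$ is the unique positive solution of the backward Euler relation $X_{n+1}=X_n+\frac12\kappa\left(\frac{\theta}{X_{n+1}}-X_{n+1}\right)h+\frac12\sigma\Delta B_{n+1}$, which exists whenever $h\max\{0,-\kappa/2\}<1$. The notation $C(\cdot)$ denotes a constant depending only on the listed parameters (in particular not on $h$ or $N$), possibly different in the two estimates; $\log$ is the natural logarithm.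
   Formalization: The second estimate is claimed only for N ≥ 2: for N = 1 (so h = T < 1) its right side is 0 since log(T/h) = 0, which would force r = r^h almost surely on [0,T], and this is false; the first estimate is claimed for all N ≥ 1. *)

theory Defs
  imports "HOL-Probability.Probability"
begin

text \<open>Constants are Gaussian with variance zero; they are treated separately because they have no
  density.\<close>

definition gaussian_rv :: "'w measure \<Rightarrow> ('w \<Rightarrow> real) \<Rightarrow> bool" where
  "gaussian_rv M Y \<longleftrightarrow> Y \<in> borel_measurable M \<and>
     ((\<exists>\<mu>. AE \<omega> in M. Y \<omega> = \<mu>) \<or>
      (\<exists>\<mu> s. s > 0 \<and> distributed M lborel Y (normal_density \<mu> s)))"

definition gaussian_process :: "'w measure \<Rightarrow> 'i set \<Rightarrow> ('i \<Rightarrow> 'w \<Rightarrow> real) \<Rightarrow> bool" where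
  "gaussian_process M I Y \<longleftrightarrow>
     (\<forall>S a. finite S \<and> S \<subseteq> I \<longrightarrow> gaussian_rv M (\<lambda>\<omega>. \<Sum>t\<in>S. a t * Y t \<omega>))"

definition fractional_brownian_motion ::
    "'w measure \<Rightarrow> real \<Rightarrow> real \<Rightarrow> (real \<Rightarrow> 'w \<Rightarrow> real) \<Rightarrow> bool" where
  "fractional_brownian_motion M T H B \<longleftrightarrow>
     prob_space M \<and>
     gaussian_process M {0..T} B \<and>
     (\<forall>\<omega>\<in>space M. continuous_on {0..T} (\<lambda>t. B t \<omega>)) \<and>
     (\<forall>t\<in>{0..T}. prob_space.expectation M (B t) = 0) \<and>
     (\<forall>t\<in>{0..T}. \<forall>s\<in>{0..T}. prob_space.expectation M (\<lambda>\<omega>. B t \<omega> * B s \<omega>) =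
        1 / 2 * (t powr (2 * H) + s powr (2 * H) - \<bar>t - s\<bar> powr (2 * H)))"

text \<open>The Riemann--Stieltjes integral of \<open>f\<close> with respect to \<open>g\<close> over \<open>{a..b}\<close>: convergence of the
  tagged sums as the mesh tends to zero. The gauge has constant radius \<open>\<delta>\<close>; a gauge whose radius may
  depend on the tag would give the Henstock version instead.\<close>

definition has_rs_integral ::
    "(real \<Rightarrow> real) \<Rightarrow> (real \<Rightarrow> real) \<Rightarrow> real \<Rightarrow> real \<Rightarrow> real \<Rightarrow> bool" where
  "has_rs_integral f g a b I \<longleftrightarrow>
     (\<forall>\<epsilon>>0. \<exists>\<delta>>0. \<forall>D. D tagged_division_of {a..b} \<and> (\<lambda>x. ball x \<delta>) fine D \<longrightarrow>
        \<bar>(\<Sum>(x, K)\<in>D. f x * (g (Sup K) - g (Inf K))) - I\<bar> < \<epsilon>)"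

text \<open>Exact solution of
  \<open>dr(t) = \<kappa> (\<theta> - r(t)) dt + \<sigma> sqrt(r(t)) dB(t)\<close>, \<open>r(0) = r0\<close>,
  read as a pathwise Riemann--Stieltjes equation. Solutions are sought among processes with
  continuous, strictly positive paths.\<close>

definition cir_solution ::
    "'w measure \<Rightarrow> real \<Rightarrow> real \<Rightarrow> real \<Rightarrow> real \<Rightarrow> real \<Rightarrow> (real \<Rightarrow> 'w \<Rightarrow> real) \<Rightarrow>
     (real \<Rightarrow> 'w \<Rightarrow> real) \<Rightarrow> bool" where
  "cir_solution M T \<kappa> \<theta> \<sigma> r0 B r \<longleftrightarrow>
     (\<forall>t\<in>{0..T}. r t \<in> borel_measurable M) \<and>
     (\<forall>\<omega>\<in>space M. continuous_on {0..T} (\<lambda>t. r t \<omega>) \<and> (\<forall>t\<in>{0..T}. r t \<omega> > 0)) \<and>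
     (AE \<omega> in M. \<forall>t\<in>{0..T}. \<exists>I.
        has_rs_integral (\<lambda>s. \<sigma> * sqrt (r s \<omega>)) (\<lambda>s. B s \<omega>) 0 t I \<and>
        r t \<omega> = r0 + integral {0..t} (\<lambda>s. \<kappa> * (\<theta> - r s \<omega>)) + I)"

definition fbm_kernel :: "real \<Rightarrow> real \<Rightarrow> real \<Rightarrow> real" where
  "fbm_kernel H \<tau> s = H * (2 * H - 1) * \<bar>s - \<tau>\<bar> powr (2 * H - 2)"

text \<open>The backward Euler iterates \<open>X\<^sub>n\<close> along a single path \<open>b\<close> of the driving noise, with initial
  value \<open>x0\<close> and step size \<open>h\<close>.\<close>

primrec euler_iterate ::
    "real \<Rightarrow> real \<Rightarrow> real \<Rightarrow> real \<Rightarrow> real \<Rightarrow> (real \<Rightarrow> real) \<Rightarrow> nat \<Rightarrow> real" where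
  "euler_iterate \<kappa> \<theta> \<sigma> x0 h b 0 = x0"
| "euler_iterate \<kappa> \<theta> \<sigma> x0 h b (Suc n) =
     (let y = euler_iterate \<kappa> \<theta> \<sigma> x0 h b n + 1 / 2 * \<sigma> * (b (real (Suc n) * h) - b (real n * h))
      in (y + sqrt (y\<^sup>2 + \<kappa> * h * \<theta> * (2 + \<kappa> * h))) / (2 + \<kappa> * h))"

text \<open>The piecewise linear interpolant \<open>X\<^sup>h\<close>; for \<open>t > 0\<close> the index \<open>\<lceil>t / h\<rceil> - 1\<close> is the \<open>n\<close> with
  \<open>t \<in> {n * h<..(n + 1) * h}\<close>.\<close>

definition euler_interpolant ::
    "real \<Rightarrow> real \<Rightarrow> real \<Rightarrow> real \<Rightarrow> real \<Rightarrow> (real \<Rightarrow> real) \<Rightarrow> real \<Rightarrow> real" where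
  "euler_interpolant \<kappa> \<theta> \<sigma> x0 h b t =
     (if t \<le> 0 then x0
      else let n = nat (\<lceil>t / h\<rceil> - 1); X = euler_iterate \<kappa> \<theta> \<sigma> x0 h b
           in X n + (t - real n * h) / h * (X (Suc n) - X n))"

definition cir_approx ::
    "real \<Rightarrow> real \<Rightarrow> real \<Rightarrow> real \<Rightarrow> real \<Rightarrow> (real \<Rightarrow> 'w \<Rightarrow> real) \<Rightarrow> real \<Rightarrow> 'w \<Rightarrow> real" where
  "cir_approx \<kappa> \<theta> \<sigma> r0 h B t \<omega> =
     (euler_interpolant \<kappa> \<theta> \<sigma> (sqrt r0) h (\<lambda>s. B s \<omega>) t)\<^sup>2"

end

theory Submission
  imports Defs
begin

text \<open>The argument is pathwise. The chain rule turns a solution \<open>r\<close> into \<open>X = sqrt r\<close>, which solves an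
  equation with additive noise. If \<open>K \<ge> 1\<close> is an \<open>a\<close>-Hoelder constant of the noise with
  \<open>1 / 2 < a < H\<close>, then \<open>X\<close> and \<open>1 / X\<close> are bounded by a power of \<open>K\<close>: near zero the drift
  \<open>\<kappa> \<theta> / (2 X)\<close> beats noise of Hoelder exponent above \<open>1 / 2\<close>.

  The drift of \<open>X\<close> is one-sided Lipschitz, so the backward Euler error is controlled by the partial sums
  of the local errors. Up to order \<open>h\<close> these partial sums are \<open>\<Sum>n. g n * Y n\<close>, where \<open>g n\<close> is the slope of the
  drift along \<open>X\<close> and \<open>Y n\<close> is the integral of \<open>B s - B (t (n + 1))\<close> over a step. Sums of the \<open>Y n\<close> over
  \<open>k\<close> steps are of size \<open>h * (k * h) powr H\<close>, because increments of \<open>B\<close> are positively correlated, and a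
  discrete Young estimate on dyadic blocks then makes the weighted sums \<open>O(h)\<close>. Between grid points the
  error is dominated by the modulus of continuity of \<open>B\<close>.

  All random constants are polynomials in \<open>2 + ln \<Theta>\<close>, where \<open>\<Theta>\<close> is a weighted sum of terms
  \<open>exp (G\<^sup>2 / (4 * s\<^sup>2))\<close> over countably many centered Gaussian variables \<open>G\<close> of standard deviation at most \<open>s\<close>,
  and \<open>\<Theta>\<close> has bounded expectation. Hence all moments are finite, and uniformly so in the step size.\<close>

section \<open>Riemann--Stieltjes integrals and the Lamperti transformation\<close>

text \<open>A single local error is only of order \<open>h powr (1 + a)\<close>, so adding absolute
  values over \<open>N\<close> steps would give the rate \<open>h powr a\<close>. Rate
  \<open>h\<close> requires cancellation between steps, which is why the error recursion is arranged
  to see local errors only through their partial sums.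

  The requirement \<open>a > 1 / 2\<close> enters three times: in the quadratic Taylor remainder,
  where \<open>h powr (2 * a) \<le> h\<close>; in the discrete Young estimate, where
  \<open>(2 powr a)\<^sup>2 > 2\<close>; and in the lower bound for \<open>X\<close>. The gap
  \<open>H - a\<close> pays for the factors \<open>2 * real i + 3\<close> that a union bound costs
  on dyadic level \<open>i\<close>.

  The variable \<open>\<Theta>\<close> may change with the number of steps; only the bound on its
  expectation may not. The logarithm of the second estimate has one source: the increments inside
  the steps form a family that already has \<open>N\<close> members on its coarsest level. Block
  sums, counted from the largest block downwards, have only \<open>2 ^ i\<close> members on level
  \<open>i\<close> and cause no such loss.\<close>

definition rs_sum :: "(real \<Rightarrow> real) \<Rightarrow> (real \<Rightarrow> real) \<Rightarrow> (real \<times> real set) set \<Rightarrow> real" where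
  "rs_sum f g D = (\<Sum>(x, K)\<in>D. f x * (g (Sup K) - g (Inf K)))"

lemma has_rs_integral_iff:
  "has_rs_integral f g a b I \<longleftrightarrow>
     (\<forall>e>0. \<exists>d>0. \<forall>D. D tagged_division_of {a..b} \<and> (\<lambda>x. ball x d) fine D \<longrightarrow> \<bar>rs_sum f g D - I\<bar> < e)"
  unfolding has_rs_integral_def rs_sum_def ..

lemma has_rs_integralD:
  assumes "has_rs_integral f g a b I" "e > 0"
  obtains d where "d > 0" "\<And>D. D tagged_division_of {a..b} \<Longrightarrow> (\<lambda>x. ball x d) fine D \<Longrightarrow>
      \<bar>rs_sum f g D - I\<bar> < e"
  using assms unfolding has_rs_integral_iff by metis

lemma has_rs_integral_fine_division:
  assumes "has_rs_integral f g a b I" "a \<le> b" "e > 0" "d > 0"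
  shows "\<exists>D. D tagged_division_of {a..b} \<and> (\<lambda>x. ball x d) fine D \<and> \<bar>rs_sum f g D - I\<bar> < e"
proof -
  obtain d1 where d1: "d1 > 0" "\<And>D. D tagged_division_of {a..b} \<Longrightarrow> (\<lambda>x. ball x d1) fine D \<Longrightarrow>
      \<bar>rs_sum f g D - I\<bar> < e"
    using has_rs_integralD[OF assms(1,3)] by metis
  have "gauge (\<lambda>x::real. ball x (min d d1))"
    using d1 assms by (intro gauge_ball_dependent) auto
  then obtain D where D: "D tagged_division_of {a..b}" "(\<lambda>x. ball x (min d d1)) fine D"
    using fine_division_exists_real by blast
  have "(\<lambda>x. ball x d) fine D" "(\<lambda>x. ball x d1) fine D"
    using D(2) unfolding fine_def by (fastforce simp: subset_iff)+
  then show ?thesis using D(1) d1(2)[OF D(1)] by (intro exI[of _ D]) simp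
qed

lemma tagged_division_Un_interval:
  assumes "D1 tagged_division_of {a..c}" "D2 tagged_division_of {c..b}" "a \<le> c" "c \<le> (b::real)"
  shows "D1 \<union> D2 tagged_division_of {a..b}"
proof -
  have "interior {a..c} \<inter> interior {c..b} = {}" by auto
  moreover have "{a..c} \<union> {c..b} = {a..b}" using assms by auto
  ultimately show ?thesis using tagged_division_Un[OF assms(1,2)] by simp
qed

text \<open>Divisions are sets, so a cell common to both would be counted once in the union. Such a
  cell can only be the point \<open>{c}\<close>, and its contribution is zero.\<close>

lemma rs_sum_Un:
  assumes "D1 tagged_division_of {a..c}" "D2 tagged_division_of {c..b}"
  shows "rs_sum f g (D1 \<union> D2) = rs_sum f g D1 + rs_sum f g D2"
proof -
  have "f x * (g (Sup K) - g (Inf K)) = 0" if "(x, K) \<in> D1 \<inter> D2" for x K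
  proof -
    have "x \<in> K" "K \<subseteq> {a..c}" "K \<subseteq> {c..b}"
      using that tagged_division_ofD(2,3)[OF assms(1)] tagged_division_ofD(3)[OF assms(2)] by blast+
    then have "K = {c}" by fastforce
    then show ?thesis by simp
  qed
  then show ?thesis
    using assms unfolding rs_sum_def by (intro sum.union_inter_neutral) auto
qed

text \<open>All cells of \<open>{a..a}\<close> are single points, so every Riemann sum vanishes.
  This is what later pins down the initial value of the solution.\<close>

lemma has_rs_integral_refl:
  assumes "has_rs_integral f g a a I"
  shows "I = 0"
proof -
  have "\<bar>I\<bar> < e" if e: "e > 0" for e
  proof -
    obtain D where D: "D tagged_division_of {a..a}" "\<bar>rs_sum f g D - I\<bar> < e"
      using has_rs_integral_fine_division[OF assms order_refl e, of 1] by auto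
    have "f x * (g (Sup K) - g (Inf K)) = 0" if "(x, K) \<in> D" for x K
    proof -
      have "x \<in> K" "K \<subseteq> {a..a}"
        using that tagged_division_ofD(2,3)[OF D(1)] by auto
      then have "K = {a}" by fastforce
      then show ?thesis by simp
    qed
    then have "rs_sum f g D = 0" unfolding rs_sum_def by (intro sum.neutral) auto
    then show ?thesis using D by simp
  qed
  then show ?thesis by (metis abs_le_zero_iff linorder_not_less order_less_irrefl)
qed

text \<open>A fine division of \<open>{u..v}\<close> is prolonged to the left by one fixed good
  division of \<open>{a..u}\<close>; comparison with the known values \<open>Iv\<close> and
  \<open>Iu\<close> costs \<open>e / 2\<close> each.\<close>

lemma has_rs_integral_diff:
  assumes "has_rs_integral f g a u Iu" "has_rs_integral f g a v Iv" "a \<le> u" "u \<le> v"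
  shows "has_rs_integral f g u v (Iv - Iu)"
  unfolding has_rs_integral_iff
proof (intro allI impI)
  fix e :: real assume e: "e > 0"
  then obtain d where d: "d > 0" "\<And>D. D tagged_division_of {a..v} \<Longrightarrow> (\<lambda>x. ball x d) fine D \<Longrightarrow>
      \<bar>rs_sum f g D - Iv\<bar> < e / 2"
    using has_rs_integralD[OF assms(2) half_gt_zero[OF e]] by metis
  obtain D0 where D0: "D0 tagged_division_of {a..u}" "(\<lambda>x. ball x d) fine D0"
      "\<bar>rs_sum f g D0 - Iu\<bar> < e / 2"
    using has_rs_integral_fine_division[OF assms(1,3), of "e / 2" d] e d by auto
  have "\<bar>rs_sum f g D - (Iv - Iu)\<bar> < e"
    if D: "D tagged_division_of {u..v}" "(\<lambda>x. ball x d) fine D" for D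
  proof -
    have "\<bar>rs_sum f g (D0 \<union> D) - Iv\<bar> < e / 2"
      using assms D0 D by (intro d tagged_division_Un_interval fine_Un)
    then show ?thesis using D0(3) rs_sum_Un[OF D0(1) D(1), of f g] by linarith
  qed
  then show "\<exists>d>0. \<forall>D. D tagged_division_of {u..v} \<and> (\<lambda>x. ball x d) fine D \<longrightarrow>
      \<bar>rs_sum f g D - (Iv - Iu)\<bar> < e"
    using d(1) by (intro exI[of _ d]) simp
qed

text \<open>Each block contributes its single tagged cell or, outside \<open>J\<close>, a Riemann
  sum within \<open>e\<close> of the increment of \<open>F\<close>. The freedom in \<open>J\<close>
  makes it possible to isolate a chosen part of the deviations between tagged cells and increments
  of \<open>F\<close>.\<close>

lemma rs_sum_replace_blocks:
  fixes t x F :: "nat \<Rightarrow> real"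
  assumes "d > 0" "e > 0"
    and "\<And>i. i < n \<Longrightarrow> t i \<le> t (Suc i)"
    and "\<And>i. i < n \<Longrightarrow> has_rs_integral f g (t i) (t (Suc i)) (F (Suc i) - F i)"
    and "\<And>i. i < n \<Longrightarrow> x i \<in> {t i..t (Suc i)} \<and> {t i..t (Suc i)} \<subseteq> ball (x i) d"
  shows "t 0 \<le> t n \<and> (\<exists>D. D tagged_division_of {t 0..t n} \<and> (\<lambda>x. ball x d) fine D \<and>
    \<bar>rs_sum f g D - (\<Sum>i<n. if i \<in> J then f (x i) * (g (t (Suc i)) - g (t i)) else F (Suc i) - F i)\<bar>
      \<le> real n * e)"
  using assms(3-5)
proof (induction n)
  case 0
  \<comment> \<open>The empty set does not divide the one-point interval \<open>{t 0..t 0}\<close>,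
    so the induction starts from a degenerate cell.\<close>
  have "{(t 0, {t 0})} tagged_division_of {t 0..t 0}"
    using tagged_division_of_self_real[of "t 0" "t 0" "t 0"] by simp
  moreover have "(\<lambda>x. ball x d) fine {(t 0, {t 0})}" using assms(1) by (auto simp: fine_def)
  ultimately show ?case by (intro conjI exI[of _ "{(t 0, {t 0})}"]) (auto simp: rs_sum_def)
next
  case (Suc n)
  then obtain D where D: "t 0 \<le> t n" "D tagged_division_of {t 0..t n}" "(\<lambda>x. ball x d) fine D"
    "\<bar>rs_sum f g D - (\<Sum>i<n. if i \<in> J then f (x i) * (g (t (Suc i)) - g (t i)) else F (Suc i) - F i)\<bar>
      \<le> real n * e"
    by (metis (lifting) less_SucI)
  have le: "t n \<le> t (Suc n)" and rs: "has_rs_integral f g (t n) (t (Suc n)) (F (Suc n) - F n)"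
    and x: "x n \<in> {t n..t (Suc n)}" "{t n..t (Suc n)} \<subseteq> ball (x n) d"
    using Suc.prems by auto
  obtain E where E: "E tagged_division_of {t n..t (Suc n)}" "(\<lambda>x. ball x d) fine E"
    "\<bar>rs_sum f g E - (if n \<in> J then f (x n) * (g (t (Suc n)) - g (t n)) else F (Suc n) - F n)\<bar> \<le> e"
  proof (cases "n \<in> J")
    case True
    have "{(x n, {t n..t (Suc n)})} tagged_division_of {t n..t (Suc n)}"
      using tagged_division_of_self_real[OF x(1)] .
    moreover have "(\<lambda>x. ball x d) fine {(x n, {t n..t (Suc n)})}"
      using x by (auto simp: fine_def)
    ultimately show ?thesis using True le assms(2) by (intro that[of "{(x n, {t n..t (Suc n)})}"]) (auto simp: rs_sum_def)
  next
    case False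
    obtain E where "E tagged_division_of {t n..t (Suc n)}" "(\<lambda>x. ball x d) fine E"
      "\<bar>rs_sum f g E - (F (Suc n) - F n)\<bar> < e"
      using has_rs_integral_fine_division[OF rs le assms(2,1)] by auto
    then show ?thesis using False by (intro that[of E]) simp_all
  qed
  have "D \<union> E tagged_division_of {t 0..t (Suc n)}"
    using D E le by (intro tagged_division_Un_interval)
  moreover have "(\<lambda>x. ball x d) fine (D \<union> E)" using D E by (intro fine_Un)
  moreover have "rs_sum f g (D \<union> E) = rs_sum f g D + rs_sum f g E"
    using rs_sum_Un D E by blast
  ultimately show ?case
    using D E le by (intro conjI exI[of _ "D \<union> E"]) (auto simp: algebra_simps)
qed

text \<open>The Saks--Henstock argument: to bound the sum of the positive (or of the negative) deviations,
  replace the remaining blocks by very good Riemann sums.\<close>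

lemma rs_deviation_sum:
  assumes F: "\<And>s. s \<in> {0..T} \<Longrightarrow> has_rs_integral f g 0 s (F s)" and "b \<in> {0..T}" and "e > 0"
  shows "\<exists>d>0. \<forall>n t x. t 0 = 0 \<and> t n = b \<and> (\<forall>i<n. t i \<le> t (Suc i) \<and> x i \<in> {t i..t (Suc i)} \<and>
      {t i..t (Suc i)} \<subseteq> ball (x i) d) \<longrightarrow>
    (\<Sum>i<n::nat. \<bar>F (t (Suc i)) - F (t i) - f (x i) * (g (t (Suc i)) - g (t i))\<bar>) \<le> e"
proof -
  obtain d where d: "d > 0" "\<And>D. D tagged_division_of {0..b} \<Longrightarrow> (\<lambda>x. ball x d) fine D \<Longrightarrow>
      \<bar>rs_sum f g D - F b\<bar> < e / 2"
    using has_rs_integralD[OF F[OF assms(2)] half_gt_zero[OF assms(3)]] by metis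
  have F0: "F 0 = 0" using F[of 0] assms(2) by (auto intro: has_rs_integral_refl)
  show ?thesis
  proof (intro exI[of _ d] conjI allI impI d(1))
    fix n :: nat and t x :: "nat \<Rightarrow> real"
    assume h: "t 0 = 0 \<and> t n = b \<and> (\<forall>i<n. t i \<le> t (Suc i) \<and> x i \<in> {t i..t (Suc i)} \<and>
      {t i..t (Suc i)} \<subseteq> ball (x i) d)"
    have mono: "t i \<le> t j" if "i \<le> j" "j \<le> n" for i j
      using that
    proof (induction j)
      case (Suc j)
      then show ?case using h[THEN conjunct2, THEN conjunct2, rule_format, of j]
        by (cases "i = Suc j") auto
    qed simp
    have in_T: "t i \<in> {0..T}" if "i \<le> n" for i
      using mono[of 0 i] mono[of i n] that h assms(2) by auto
    have sub: "has_rs_integral f g (t i) (t (Suc i)) (F (t (Suc i)) - F (t i))" if "i < n" for i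
      using in_T[of i] in_T[of "Suc i"] h that by (intro has_rs_integral_diff[OF F F]) auto
    define dev where "dev i = F (t (Suc i)) - F (t i) - f (x i) * (g (t (Suc i)) - g (t i))" for i
    \<comment> \<open>Only blocks in \<open>J\<close> deviate from \<open>F\<close>. The error
      \<open>c\<close> made on the other blocks is arbitrarily small, because \<open>d\<close> stays
      fixed while the divisions inserted there may be as good as desired.\<close>
    have part: "\<bar>\<Sum>i\<in>{..<n} \<inter> J. dev i\<bar> \<le> e / 2" for J
    proof (rule field_le_epsilon)
      fix c :: real assume c: "c > 0"
      have "c / (real n + 1) > 0" using c by simp
      have "t 0 \<le> t n \<and> (\<exists>D. D tagged_division_of {t 0..t n} \<and> (\<lambda>x. ball x d) fine D \<and>
        \<bar>rs_sum f g D - (\<Sum>i<n. if i \<in> J then f (x i) * (g (t (Suc i)) - g (t i))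
            else F (t (Suc i)) - F (t i))\<bar> \<le> real n * (c / (real n + 1)))"
        using h sub by (intro rs_sum_replace_blocks[OF d(1) \<open>c / (real n + 1) > 0\<close>]) blast+
      then obtain D where D: "D tagged_division_of {0..b}" "(\<lambda>x. ball x d) fine D"
        "\<bar>rs_sum f g D - (\<Sum>i<n. if i \<in> J then f (x i) * (g (t (Suc i)) - g (t i))
            else F (t (Suc i)) - F (t i))\<bar> \<le> real n * (c / (real n + 1))"
        using h by auto
      have "(\<Sum>i<n. if i \<in> J then f (x i) * (g (t (Suc i)) - g (t i)) else F (t (Suc i)) - F (t i))
          = (\<Sum>i<n. (F (t (Suc i)) - F (t i)) - (if i \<in> J then dev i else 0))"
        by (intro sum.cong) (auto simp: dev_def)
      also have "\<dots> = (\<Sum>i<n. F (t (Suc i)) - F (t i)) - (\<Sum>i\<in>{..<n} \<inter> J. dev i)"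
        by (simp only: sum_subtractf sum.inter_restrict finite_lessThan)
      also have "(\<Sum>i<n. F (t (Suc i)) - F (t i)) = F b"
        using h F0 sum_lessThan_telescope[of "\<lambda>i. F (t i)" n] by simp
      finally have "\<bar>rs_sum f g D - (F b - (\<Sum>i\<in>{..<n} \<inter> J. dev i))\<bar> \<le> real n * (c / (real n + 1))"
        using D(3) by simp
      moreover have "real n * (c / (real n + 1)) \<le> c" using c by (simp add: field_simps)
      ultimately show "\<bar>\<Sum>i\<in>{..<n} \<inter> J. dev i\<bar> \<le> e / 2 + c" using d(2)[OF D(1,2)] by linarith
    qed
    have "(\<Sum>i<n. \<bar>dev i\<bar>) = (\<Sum>i<n. (if dev i \<ge> 0 then dev i else 0) - (if dev i < 0 then dev i else 0))"
      by (intro sum.cong) auto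
    also have "\<dots> = (\<Sum>i\<in>{..<n} \<inter> {i. dev i \<ge> 0}. dev i) - (\<Sum>i\<in>{..<n} \<inter> {i. dev i < 0}. dev i)"
      by (simp add: sum_subtractf sum.inter_restrict)
    also have "\<dots> \<le> e" using part[of "{i. dev i \<ge> 0}"] part[of "{i. dev i < 0}"] by linarith
    finally show "(\<Sum>i<n. \<bar>F (t (Suc i)) - F (t i) - f (x i) * (g (t (Suc i)) - g (t i))\<bar>) \<le> e"
      unfolding dev_def .
  qed
qed


text \<open>Each tag \<open>x i\<close> is chosen, by the intermediate value theorem, so that
  \<open>X (x i)\<close> is the mean of the two endpoint values of \<open>X\<close>. The increment
  of \<open>X\<^sup>2\<close> over the cell is then exactly \<open>2 * X (x i)\<close> times the
  increment of \<open>X\<close>, without a second-order term. Division by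
  \<open>2 * X (x i) \<ge> 2 * m\<close> leaves the deviations of the Riemann--Stieltjes sums, which
  \<open>rs_deviation_sum\<close> controls in absolute value, and a Riemann sum error for the
  drift.\<close>

lemma sqrt_chain_rule:
  fixes X u b F :: "real \<Rightarrow> real"
  assumes contX: "continuous_on {0..T} X" and pos: "\<And>t. t \<in> {0..T} \<Longrightarrow> X t > 0"
    and contu: "continuous_on {0..T} u"
    and rs: "\<And>s. s \<in> {0..T} \<Longrightarrow> has_rs_integral (\<lambda>s. \<sigma> * X s) b 0 s (F s)"
    and eq: "\<And>s. s \<in> {0..T} \<Longrightarrow> (X s)\<^sup>2 = c + integral {0..s} u + F s"
    and t: "t \<in> {0..T}"
  shows "X t = X 0 + integral {0..t} (\<lambda>s. u s / (2 * X s)) + \<sigma> / 2 * (b t - b 0)"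
proof -
  have ne: "{0..T} \<noteq> {}" using t by auto
  obtain m where m: "m > 0" "\<And>s. s \<in> {0..T} \<Longrightarrow> m \<le> X s"
    using continuous_attains_inf[OF _ ne contX] pos by (metis compact_Icc)
  obtain U where U: "U > 0" "\<And>s. s \<in> {0..T} \<Longrightarrow> \<bar>u s\<bar> \<le> U"
  proof -
    have "bounded (u ` {0..T})" by (intro compact_imp_bounded compact_continuous_image contu) simp
    then show ?thesis using that unfolding bounded_pos by auto
  qed
  define v where "v s = 1 / (2 * X s)" for s
  have contv: "continuous_on {0..T} v"
    unfolding v_def using pos by (intro continuous_intros contX) force
  have "\<bar>X t - (X 0 + integral {0..t} (\<lambda>s. u s / (2 * X s)) + \<sigma> / 2 * (b t - b 0))\<bar> \<le> e"
    if e: "e > 0" for e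
  proof -
    obtain d1 where d1: "d1 > 0" and d1_dev: "\<And>n \<tau> x. \<tau> 0 = 0 \<Longrightarrow> \<tau> n = t \<Longrightarrow> (\<forall>i<n. \<tau> i \<le> \<tau> (Suc i) \<and>
        x i \<in> {\<tau> i..\<tau> (Suc i)} \<and> {\<tau> i..\<tau> (Suc i)} \<subseteq> ball (x i) d1) \<Longrightarrow>
      (\<Sum>i<n::nat. \<bar>F (\<tau> (Suc i)) - F (\<tau> i) - \<sigma> * X (x i) * (b (\<tau> (Suc i)) - b (\<tau> i))\<bar>) \<le> e * m"
      using rs_deviation_sum[OF rs t, of "e * m"] e m by auto
    define e2 where "e2 = e / (2 * U * (1 + T))"
    have e2: "e2 > 0" using e U t by (auto simp: e2_def)
    have "uniformly_continuous_on {0..T} v"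
      by (intro compact_uniformly_continuous contv) simp
    then obtain d2 where d2: "d2 > 0"
      "\<And>x y. x \<in> {0..T} \<Longrightarrow> y \<in> {0..T} \<Longrightarrow> \<bar>y - x\<bar> < d2 \<Longrightarrow> \<bar>v y - v x\<bar> < e2"
      using e2 unfolding uniformly_continuous_on_def dist_real_def by metis
    obtain n :: nat where n: "t / min d1 d2 < real n" using reals_Archimedean2 by blast
    moreover have "0 \<le> t / min d1 d2" using t d1 d2 by auto
    ultimately have n0: "n > 0" by (metis gr0I less_irrefl of_nat_0 order_le_less_trans)
    have mesh: "t / real n < d1" "t / real n < d2"
      using n n0 d1 d2 by (auto simp: field_simps min_def split: if_splits)
        (smt (verit) mult_le_cancel_right of_nat_0_le_iff)+
    define \<tau> where "\<tau> i = real i * t / real n" for i :: nat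
    have step: "\<tau> (Suc i) = \<tau> i + t / real n" for i by (simp add: \<tau>_def field_simps add_divide_distrib)
    have tn0: "0 \<le> t / real n" using t by auto
    have \<tau>0: "\<tau> 0 = 0" and \<tau>n: "\<tau> n = t" using n0 by (auto simp: \<tau>_def)
    have \<tau>T: "0 \<le> \<tau> i" "\<tau> i \<le> t" if "i \<le> n" for i
      using that t n0 by (auto simp: \<tau>_def field_simps intro: mult_left_mono)
    have sub: "{\<tau> i..\<tau> (Suc i)} \<subseteq> {0..T}" if "i < n" for i
      using \<tau>T[of i] \<tau>T[of "Suc i"] that t by auto
    have "\<exists>x. x \<in> {\<tau> i..\<tau> (Suc i)} \<and> X x = (X (\<tau> i) + X (\<tau> (Suc i))) / 2" if "i < n" for i
    proof -
      have le: "\<tau> i \<le> \<tau> (Suc i)" using step tn0 by simp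
      have c: "continuous_on {\<tau> i..\<tau> (Suc i)} X" using contX sub[OF that] continuous_on_subset by blast
      show ?thesis
      proof (cases "X (\<tau> i) \<le> X (\<tau> (Suc i))")
        case True
        then show ?thesis using IVT'[of X "\<tau> i" "(X (\<tau> i) + X (\<tau> (Suc i))) / 2" "\<tau> (Suc i)"] le c by auto
      next
        case False
        then show ?thesis using IVT2'[of X "\<tau> (Suc i)" "(X (\<tau> i) + X (\<tau> (Suc i))) / 2" "\<tau> i"] le c by auto
      qed
    qed
    then obtain x where x: "\<And>i. i < n \<Longrightarrow> x i \<in> {\<tau> i..\<tau> (Suc i)}"
      "\<And>i. i < n \<Longrightarrow> X (x i) = (X (\<tau> i) + X (\<tau> (Suc i))) / 2" by metis
    define dev where "dev i = F (\<tau> (Suc i)) - F (\<tau> i) - \<sigma> * X (x i) * (b (\<tau> (Suc i)) - b (\<tau> i))" for i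
    have "(\<Sum>i<n. \<bar>dev i\<bar>) \<le> e * m"
      unfolding dev_def
    proof (rule d1_dev[OF \<tau>0 \<tau>n], intro allI impI conjI)
      fix i assume i: "i < n"
      show "\<tau> i \<le> \<tau> (Suc i)" using step tn0 by simp
      show "x i \<in> {\<tau> i..\<tau> (Suc i)}" using x i by blast
      then show "{\<tau> i..\<tau> (Suc i)} \<subseteq> ball (x i) d1"
        using step[of i] mesh by (auto simp: dist_real_def)
    qed
    have iu: "u integrable_on {p..q}" "(\<lambda>s. u s * v s) integrable_on {p..q}" if "{p..q} \<subseteq> {0..T}" for p q
      using that contu contv
      by (auto intro!: integrable_continuous_real continuous_intros elim: continuous_on_subset)
    define A where "A i = integral {\<tau> i..\<tau> (Suc i)} u * v (x i) - integral {\<tau> i..\<tau> (Suc i)} (\<lambda>s. u s * v s)" for i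
    have A: "\<bar>A i\<bar> \<le> U * e2 * (t / real n)" if i: "i < n" for i
    proof -
      have "A i = integral {\<tau> i..\<tau> (Suc i)} (\<lambda>s. u s * (v (x i) - v s))"
        unfolding A_def using iu[OF sub[OF i]]
        by (simp add: right_diff_distrib integral_diff integrable_on_mult_left flip: integral_mult_left)
      moreover have "norm (integral {\<tau> i..\<tau> (Suc i)} (\<lambda>s. u s * (v (x i) - v s))) \<le> U * e2 * (\<tau> (Suc i) - \<tau> i)"
      proof (rule integral_bound)
        show "\<tau> i \<le> \<tau> (Suc i)" using step tn0 by simp
        show "continuous_on {\<tau> i..\<tau> (Suc i)} (\<lambda>s. u s * (v (x i) - v s))"
          using sub[OF i] contu contv by (auto intro!: continuous_intros elim: continuous_on_subset)
        fix s assume s: "s \<in> {\<tau> i..\<tau> (Suc i)}"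
        have "\<bar>v (x i) - v s\<bar> < e2"
          using s sub[OF i] x(1)[OF i] step[of i] mesh by (intro d2) auto
        then show "norm (u s * (v (x i) - v s)) \<le> U * e2"
          unfolding real_norm_def abs_mult using U s sub[OF i] e2 by (intro mult_mono) auto
      qed
      ultimately show ?thesis using step[of i] by simp
    qed
    have F: "F s = (X s)\<^sup>2 - c - integral {0..s} u" if "s \<in> {0..T}" for s
      using eq[OF that] by simp
    have incr: "X (\<tau> (Suc i)) - X (\<tau> i) = integral {\<tau> i..\<tau> (Suc i)} (\<lambda>s. u s * v s) + A i + dev i * v (x i)
       + \<sigma> / 2 * (b (\<tau> (Suc i)) - b (\<tau> i))" if i: "i < n" for i
    proof -
      have pX: "X (x i) > 0" using pos x(1)[OF i] sub[OF i] by auto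
      have "integral {0..\<tau> i} u + integral {\<tau> i..\<tau> (Suc i)} u = integral {0..\<tau> (Suc i)} u"
        using \<tau>T[of i] \<tau>T[of "Suc i"] i t step[of i] tn0 by (intro Henstock_Kurzweil_Integration.integral_combine iu) auto
      moreover have "F (\<tau> (Suc i)) - F (\<tau> i) = (X (\<tau> (Suc i)) - X (\<tau> i)) * (2 * X (x i))
          - (integral {0..\<tau> (Suc i)} u - integral {0..\<tau> i} u)"
        using \<tau>T[of i] \<tau>T[of "Suc i"] i t x(2)[OF i] by (simp add: F power2_eq_square algebra_simps)
      ultimately have "(X (\<tau> (Suc i)) - X (\<tau> i)) * (2 * X (x i)) =
          integral {\<tau> i..\<tau> (Suc i)} u + dev i + \<sigma> * X (x i) * (b (\<tau> (Suc i)) - b (\<tau> i))"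
        unfolding dev_def by linarith
      then have "X (\<tau> (Suc i)) - X (\<tau> i) = 
          (integral {\<tau> i..\<tau> (Suc i)} u + dev i + \<sigma> * X (x i) * (b (\<tau> (Suc i)) - b (\<tau> i))) * v (x i)"
        using pX unfolding v_def by (simp add: field_simps)
      also have "\<dots> = integral {\<tau> i..\<tau> (Suc i)} u * v (x i) + dev i * v (x i) + \<sigma> / 2 * (b (\<tau> (Suc i)) - b (\<tau> i))"
        using pX unfolding v_def by (simp add: field_simps)
      finally show ?thesis unfolding A_def by simp
    qed
    have comb: "(\<Sum>i<k. integral {\<tau> i..\<tau> (Suc i)} (\<lambda>s. u s * v s)) = integral {0..\<tau> k} (\<lambda>s. u s * v s)" if "k \<le> n" for k
      using that
    proof (induction k)
      case (Suc k)
      have "integral {0..\<tau> k} (\<lambda>s. u s * v s) + integral {\<tau> k..\<tau> (Suc k)} (\<lambda>s. u s * v s) = integral {0..\<tau> (Suc k)} (\<lambda>s. u s * v s)"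
        using \<tau>T[of k] \<tau>T[of "Suc k"] Suc.prems t step[of k] tn0
        by (intro Henstock_Kurzweil_Integration.integral_combine iu) auto
      then show ?case using Suc by simp
    qed (simp add: \<tau>0)
    have "X t - X 0 = (\<Sum>i<n. X (\<tau> (Suc i)) - X (\<tau> i))"
      by (simp only: sum_lessThan_telescope[of "\<lambda>i. X (\<tau> i)"] \<tau>0 \<tau>n)
    also have "\<dots> = (\<Sum>i<n. integral {\<tau> i..\<tau> (Suc i)} (\<lambda>s. u s * v s) + A i + dev i * v (x i)
       + \<sigma> / 2 * (b (\<tau> (Suc i)) - b (\<tau> i)))"
      using incr by (intro sum.cong) auto
    also have "\<dots> = integral {0..t} (\<lambda>s. u s * v s) + (\<Sum>i<n. A i) + (\<Sum>i<n. dev i * v (x i)) + \<sigma> / 2 * (b t - b 0)"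
      by (simp only: sum.distrib comb[OF order_refl] \<tau>n \<tau>0 sum_distrib_left[symmetric]
          sum_lessThan_telescope[of "\<lambda>i. b (\<tau> i)"])
    finally have main: "X t - (X 0 + integral {0..t} (\<lambda>s. u s * v s) + \<sigma> / 2 * (b t - b 0)) =
      (\<Sum>i<n. A i) + (\<Sum>i<n. dev i * v (x i))" by simp
    have "\<bar>\<Sum>i<n. A i\<bar> \<le> (\<Sum>i<n. U * e2 * (t / real n))"
      using A by (intro order.trans[OF sum_abs] sum_mono) auto
    also have "\<dots> = U * e2 * t" using n0 by simp
    also have "U * e2 * t = e / 2 * (t / (1 + T))" unfolding e2_def using U by simp
    also have "\<dots> \<le> e / 2 * 1" using t e by (intro mult_left_mono) auto
    also have "\<dots> = e / 2" by simp
    finally have B1: "\<bar>\<Sum>i<n. A i\<bar> \<le> e / 2" .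
    have "\<bar>\<Sum>i<n. dev i * v (x i)\<bar> \<le> (\<Sum>i<n. \<bar>dev i\<bar> * (1 / (2 * m)))"
    proof (intro order.trans[OF sum_abs] sum_mono)
      fix i assume "i \<in> {..<n}"
      then have "x i \<in> {0..T}" using x(1)[of i] sub[of i] by auto
      then have "X (x i) \<ge> m" by (rule m)
      then have "\<bar>v (x i)\<bar> \<le> 1 / (2 * m)" unfolding v_def using m(1) by (auto simp: field_simps)
      then show "\<bar>dev i * v (x i)\<bar> \<le> \<bar>dev i\<bar> * (1 / (2 * m))"
        unfolding abs_mult by (intro mult_left_mono) auto
    qed
    also have "\<dots> = (\<Sum>i<n. \<bar>dev i\<bar>) * (1 / (2 * m))" by (rule sum_distrib_right[symmetric])
    also have "\<dots> \<le> e * m * (1 / (2 * m))"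
      using \<open>(\<Sum>i<n. \<bar>dev i\<bar>) \<le> e * m\<close> m by (intro mult_right_mono) auto
    also have "\<dots> = e / 2" using m by simp
    finally have B2: "\<bar>\<Sum>i<n. dev i * v (x i)\<bar> \<le> e / 2" .
    show ?thesis using main B1 B2 unfolding v_def by simp
  qed
  \<comment> \<open>The bound holds for every positive \<open>e\<close>; with half the distance
    itself as \<open>e\<close>, the distance must be zero.\<close>
  from this[of "\<bar>X t - (X 0 + integral {0..t} (\<lambda>s. u s / (2 * X s)) + \<sigma> / 2 * (b t - b 0))\<bar> / 2"]
  show ?thesis by (smt (verit) field_sum_of_halves)
qed

section \<open>The backward Euler recursion\<close>

definition lamperti_drift :: "real \<Rightarrow> real \<Rightarrow> real \<Rightarrow> real" where
  "lamperti_drift \<kappa> \<theta> x = 1 / 2 * \<kappa> * (\<theta> / x - x)"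

text \<open>Multiplying the implicit relation by \<open>2 * x\<close> gives the quadratic \<open>(2
  + \<kappa> * h) * x\<^sup>2 - 2 * y * x - \<kappa> * h * \<theta> = 0\<close>. Its product of
  roots is negative, and the formula is the positive root.\<close>

lemma backward_euler_root:
  assumes "\<kappa> * \<theta> > 0" "h > 0" "2 + \<kappa> * h > 0"
    and x: "x = (y + sqrt (y\<^sup>2 + \<kappa> * h * \<theta> * (2 + \<kappa> * h))) / (2 + \<kappa> * h)"
  shows "x > 0" "x = y + lamperti_drift \<kappa> \<theta> x * h"
proof -
  define S where "S = sqrt (y\<^sup>2 + \<kappa> * h * \<theta> * (2 + \<kappa> * h))"
  have P: "\<kappa> * h * \<theta> * (2 + \<kappa> * h) > 0"
    using assms by (metis mult.commute mult.left_commute mult_pos_pos)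
  have S2: "S\<^sup>2 = y\<^sup>2 + \<kappa> * h * \<theta> * (2 + \<kappa> * h)"
    unfolding S_def using P by (intro real_sqrt_pow2) (simp add: add_nonneg_pos less_imp_le)
  have "\<bar>y\<bar> < S" unfolding S_def using P by (intro real_less_rsqrt) simp
  then show pos: "x > 0" unfolding x S_def[symmetric] using assms(3) by (intro divide_pos_pos) auto
  have xS: "x * (2 + \<kappa> * h) - y = S" using assms(3) unfolding x S_def by simp
  have "(2 + \<kappa> * h) * ((2 + \<kappa> * h) * x\<^sup>2 - 2 * y * x - \<kappa> * h * \<theta>) = (x * (2 + \<kappa> * h) - y)\<^sup>2 - y\<^sup>2 - \<kappa> * h * \<theta> * (2 + \<kappa> * h)"
    by (simp add: power2_eq_square algebra_simps)
  also have "\<dots> = 0" unfolding xS S2 by simp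
  finally have "(2 + \<kappa> * h) * x\<^sup>2 - 2 * y * x - \<kappa> * h * \<theta> = 0" using assms(3) by simp
  then show "x = y + lamperti_drift \<kappa> \<theta> x * h"
    unfolding lamperti_drift_def using pos by (simp add: field_simps power2_eq_square)
qed

lemma euler_iterate_Suc:
  assumes "\<kappa> * \<theta> > 0" "h > 0" "2 + \<kappa> * h > 0"
  shows "euler_iterate \<kappa> \<theta> \<sigma> x0 h b (Suc n) > 0"
    "euler_iterate \<kappa> \<theta> \<sigma> x0 h b (Suc n) = euler_iterate \<kappa> \<theta> \<sigma> x0 h b n
       + lamperti_drift \<kappa> \<theta> (euler_iterate \<kappa> \<theta> \<sigma> x0 h b (Suc n)) * h
       + \<sigma> / 2 * (b (real (Suc n) * h) - b (real n * h))"
  using backward_euler_root[OF assms, OF refl, of "euler_iterate \<kappa> \<theta> \<sigma> x0 h b n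
      + 1 / 2 * \<sigma> * (b (real (Suc n) * h) - b (real n * h))"]
  by (auto simp: Let_def algebra_simps)

lemma lamperti_drift_diff:
  assumes "x > 0" "z > 0"
  shows "lamperti_drift \<kappa> \<theta> x - lamperti_drift \<kappa> \<theta> z = - (\<kappa> * \<theta> / (x * z) + \<kappa>) / 2 * (x - z)"
  using assms unfolding lamperti_drift_def by (simp add: field_simps)

text \<open>Subtracting the accumulated consistency error \<open>\<rho>\<close> from the global error leaves a recursion in
  which \<open>\<rho>\<close> enters only multiplied by the (one-sidedly bounded) slope of the drift, so that no
  summation of consistency errors takes place.\<close>

lemma backward_euler_error:
  fixes X Z D \<rho> :: "nat \<Rightarrow> real"
  assumes "\<kappa> * \<theta> > 0" "h > 0" "0 < \<xi>" and hm: "h * max 0 (- \<kappa> / 2) < 1 - \<xi>"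
    and X: "\<And>n. n < N \<Longrightarrow> X (Suc n) = X n + lamperti_drift \<kappa> \<theta> (X (Suc n)) * h + D n + (\<rho> (Suc n) - \<rho> n)"
    and Z: "\<And>n. n < N \<Longrightarrow> Z (Suc n) = Z n + lamperti_drift \<kappa> \<theta> (Z (Suc n)) * h + D n"
    and init: "X 0 = Z 0" "\<rho> 0 = 0" and pos: "\<And>n. n \<le> N \<Longrightarrow> X n > 0" "\<And>n. n \<le> N \<Longrightarrow> Z n > 0"
    and \<rho>: "\<And>n. n \<le> N \<Longrightarrow> \<bar>\<rho> n\<bar> \<le> R" and n: "n \<le> N"
  shows "\<bar>X n - Z n\<bar> \<le> 2 * R * exp (real n * h * max 0 (- \<kappa> / 2) / \<xi>)"
proof -
  define m where "m = max 0 (- \<kappa> / 2)"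
  define q where "q = 1 / (1 - h * m)"
  have m: "m \<ge> 0" "- \<kappa> / 2 \<le> m" "h * m < 1 - \<xi>" using hm by (auto simp: m_def)
  have hm1: "0 \<le> h * m" "h * m < 1" using m assms(2,3) by auto
  have q1: "q \<ge> 1" unfolding q_def using hm1 by (simp add: field_simps)
  have R: "R \<ge> 0" using \<rho>[of 0] by simp
  define d where "d n = X n - Z n - \<rho> n" for n
  \<comment> \<open>The extra \<open>R\<close> absorbs the forcing term
    \<open>h * a * \<rho> (Suc n)\<close>: for \<open>a > 0\<close> the recursion for
    \<open>\<bar>d n\<bar> + R\<close> becomes homogeneous, with growth factor at most
    \<open>q\<close>.\<close>
  have "\<bar>d n\<bar> + R \<le> 2 * R * q ^ n" if "n \<le> N" for n
    using that
  proof (induction n)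
    case 0
    then show ?case using init R by (simp add: d_def)
  next
    case (Suc n)
    define a where "a = - (\<kappa> * \<theta> / (X (Suc n) * Z (Suc n)) + \<kappa>) / 2"
    have pp: "X (Suc n) * Z (Suc n) > 0" using pos Suc.prems by simp
    have am: "a \<le> m" using m(2) divide_pos_pos[OF assms(1) pp] unfolding a_def by argo
    have "lamperti_drift \<kappa> \<theta> (X (Suc n)) - lamperti_drift \<kappa> \<theta> (Z (Suc n)) = a * (X (Suc n) - Z (Suc n))"
      unfolding a_def using pos Suc.prems by (intro lamperti_drift_diff) auto
    moreover have "X (Suc n) - Z (Suc n) = X n - Z n
        + (lamperti_drift \<kappa> \<theta> (X (Suc n)) - lamperti_drift \<kappa> \<theta> (Z (Suc n))) * h + (\<rho> (Suc n) - \<rho> n)"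
      using X[of n] Z[of n] Suc.prems by (simp add: left_diff_distrib)
    ultimately have "X (Suc n) - Z (Suc n) = X n - Z n + a * (X (Suc n) - Z (Suc n)) * h + (\<rho> (Suc n) - \<rho> n)"
      by simp
    then have rec: "(1 - h * a) * d (Suc n) = d n + h * a * \<rho> (Suc n)"
      unfolding d_def by (simp add: algebra_simps)
    have ham: "h * a \<le> h * m" using am assms(2) by simp
    have p1: "1 - h * a > 0" using ham hm1 by linarith
    have IH: "\<bar>d n\<bar> + R \<le> 2 * R * q ^ n" using Suc by simp
    have \<rho>S: "\<bar>\<rho> (Suc n)\<bar> \<le> R" using \<rho> Suc.prems by blast
    have abs_rec: "(1 - h * a) * \<bar>d (Suc n)\<bar> \<le> \<bar>d n\<bar> + \<bar>h * a\<bar> * R"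
    proof -
      have "(1 - h * a) * \<bar>d (Suc n)\<bar> = \<bar>d n + h * a * \<rho> (Suc n)\<bar>"
        using p1 by (simp add: abs_mult flip: rec)
      also have "\<dots> \<le> \<bar>d n\<bar> + \<bar>h * a\<bar> * \<bar>\<rho> (Suc n)\<bar>"
        by (metis abs_triangle_ineq abs_mult)
      finally show ?thesis using mult_left_mono[OF \<rho>S, of "\<bar>h * a\<bar>"] by linarith
    qed
    have qmono: "R * q ^ n \<le> R * q ^ Suc n" using q1 R by (intro mult_left_mono power_increasing) auto
    show ?case
    \<comment> \<open>For \<open>a \<le> 0\<close> the slope may be arbitrarily large in modulus,
      but then \<open>d (Suc n)\<close> is bounded by a convex combination of \<open>E\<close> and
      \<open>R\<close>, and \<open>R \<le> E\<close>. Hence there is no growth in this case.\<close>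
    proof (cases "a \<le> 0")
      case True
      define E where "E = 2 * R * q ^ n - R"
      have "R * 1 \<le> R * q ^ n" using q1 R by (intro mult_left_mono one_le_power) auto
      then have E: "R \<le> E" unfolding E_def by simp
      have ha: "h * a \<le> 0" using True assms(2) by (simp add: mult_nonneg_nonpos)
      have "(1 - h * a) * \<bar>d (Suc n)\<bar> \<le> E + (- (h * a)) * E"
        using abs_rec IH mult_left_mono[OF E, of "- (h * a)"] ha by (auto simp: E_def abs_of_nonpos)
      then have "(1 - h * a) * \<bar>d (Suc n)\<bar> \<le> (1 - h * a) * E" by (simp add: algebra_simps)
      then have "\<bar>d (Suc n)\<bar> \<le> E" using p1 by simp
      then show ?thesis using qmono unfolding E_def by simp
    next
      case False
      then have "h * a > 0" using assms(2) by simp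
      then have "(1 - h * a) * (\<bar>d (Suc n)\<bar> + R) \<le> 2 * R * q ^ n"
        using abs_rec IH by (simp add: algebra_simps)
      then have "\<bar>d (Suc n)\<bar> + R \<le> 2 * R * q ^ n / (1 - h * a)" using p1 by (simp add: field_simps)
      also have "\<dots> \<le> 2 * R * q ^ n / (1 - h * m)"
        using ham hm1 R q1 p1 by (intro divide_left_mono) auto
      finally show ?thesis unfolding q_def by (simp add: power_divide mult.commute)
    qed
  qed
  from this[OF n] have "\<bar>X n - Z n\<bar> \<le> 2 * R * q ^ n"
    using \<rho>[OF n] unfolding d_def by linarith
  also have "q ^ n \<le> exp (h * m / \<xi>) ^ n"
  proof (rule power_mono)
    \<comment> \<open>This is where \<open>\<xi>\<close> enters: it bounds \<open>1 - h * m\<close>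
      from below and so makes the growth factor exponential in \<open>h\<close>.\<close>
    have "q = 1 + h * m / (1 - h * m)" unfolding q_def using hm1 by (simp add: field_simps)
    also have "\<dots> \<le> exp (h * m / (1 - h * m))" by (rule exp_ge_add_one_self)
    also have "\<dots> \<le> exp (h * m / \<xi>)" using m hm1 assms(3) by (auto intro!: divide_left_mono)
    finally show "q \<le> exp (h * m / \<xi>)" .
  qed (use q1 in auto)
  finally show ?thesis
    using R unfolding m_def[symmetric] exp_of_nat_mult[symmetric] by (simp add: mult_left_mono mult.assoc)
qed

text \<open>The increment is taken from the right end of the step, where the implicit scheme freezes
  the drift.\<close>

definition block_noise :: "(real \<Rightarrow> real) \<Rightarrow> real \<Rightarrow> nat \<Rightarrow> real" where
  "block_noise b h n = integral {real n * h..real n * h + h} (\<lambda>s. b s - b (real n * h + h))"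

text \<open>The \<open>N\<close> steps are padded to a power of two, so that all blocks are full
  dyadic blocks; indices from \<open>N\<close> on contribute zero.\<close>

definition block_sum :: "(real \<Rightarrow> real) \<Rightarrow> real \<Rightarrow> nat \<Rightarrow> nat \<Rightarrow> nat \<Rightarrow> real" where
  "block_sum b h N l j = (\<Sum>n\<in>{j * 2 ^ l..<(j + 1) * 2 ^ l}. if n < N then block_noise b h n else 0)"

section \<open>Discrete Young sums and dyadic chaining\<close>

text \<open>A discrete Young estimate on dyadic blocks: \<open>x l\<close> plays the role of \<open>(2^l * h) powr a\<close>, hence
  \<open>\<beta> = 2 powr a\<close>, and \<open>\<beta>\<^sup>2 > 2\<close> means \<open>a > 1 / 2\<close>.\<close>

lemma dyadic_young_block:
  fixes g Y x :: "nat \<Rightarrow> real"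
  assumes "\<beta>\<^sup>2 > 2" and x: "\<And>l. x (Suc l) = \<beta> * x l" "\<And>l. x l \<ge> 0" and "Lg \<ge> 0" "Lv \<ge> 0"
    and V: "\<And>l j. (j + 1) * 2 ^ l \<le> 2 ^ m \<Longrightarrow> \<bar>\<Sum>n\<in>{j * 2 ^ l..<(j + 1) * 2 ^ l}. Y n\<bar> \<le> Lv * x l"
    and g: "\<And>l j. (j + 2) * 2 ^ l \<le> 2 ^ m \<Longrightarrow> \<bar>g ((j + 1) * 2 ^ l) - g (j * 2 ^ l)\<bar> \<le> Lg * x l"
    and "(j + 1) * 2 ^ l \<le> (2::nat) ^ m"
  shows "\<bar>(\<Sum>n\<in>{j * 2 ^ l..<(j + 1) * 2 ^ l}. g n * Y n) - g (j * 2 ^ l) * (\<Sum>n\<in>{j * 2 ^ l..<(j + 1) * 2 ^ l}. Y n)\<bar>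
    \<le> Lg * Lv / (\<beta>\<^sup>2 - 2) * (x l)\<^sup>2"
  using assms(8)
proof (induction l arbitrary: j)
  case 0
  then show ?case using assms(1,4,5) by simp
next
  case (Suc l)
  define C where "C = Lg * Lv / (\<beta>\<^sup>2 - 2)"
  define S where "S j = (\<Sum>n\<in>{j * 2 ^ l..<(j + 1) * 2 ^ l}. g n * Y n)" for j
  define W where "W j = (\<Sum>n\<in>{j * 2 ^ l..<(j + 1) * 2 ^ l}. Y n)" for j
  have split: "(\<Sum>n\<in>{j * 2 ^ Suc l..<(j + 1) * 2 ^ Suc l}. f n) =
     (\<Sum>n\<in>{(2 * j) * 2 ^ l..<(2 * j + 1) * 2 ^ l}. f n) + (\<Sum>n\<in>{(2 * j + 1) * 2 ^ l..<(2 * j + 1 + 1) * 2 ^ l}. f n)"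
    for f :: "nat \<Rightarrow> real"
  proof -
    have "sum f {(2 * j) * 2 ^ l..<(2 * j + 1) * 2 ^ l} + sum f {(2 * j + 1) * 2 ^ l..<(2 * j + 1 + 1) * 2 ^ l} = 
       sum f {(2 * j) * 2 ^ l..<(2 * j + 1 + 1) * 2 ^ l}"
      by (intro sum.atLeastLessThan_concat mult_right_mono) auto
    then show ?thesis by (simp add: mult.commute mult.left_commute algebra_simps)
  qed
  have le: "(2 * j + 1 + 1) * 2 ^ l \<le> (2::nat) ^ m" using Suc.prems by (simp add: algebra_simps)
  have le': "(2 * j + 1) * 2 ^ l \<le> (2::nat) ^ m"
    by (rule order.trans[OF _ le]) (intro mult_right_mono, auto)
  have IH1: "\<bar>S (2 * j) - g ((2 * j) * 2 ^ l) * W (2 * j)\<bar> \<le> C * (x l)\<^sup>2"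
    using Suc.IH[of "2 * j", OF le'] unfolding S_def W_def C_def .
  have IH2: "\<bar>S (2 * j + 1) - g ((2 * j + 1) * 2 ^ l) * W (2 * j + 1)\<bar> \<le> C * (x l)\<^sup>2"
    using Suc.IH[of "2 * j + 1", OF le] unfolding S_def W_def C_def .
  have "\<bar>g ((2 * j + 1) * 2 ^ l) - g ((2 * j) * 2 ^ l)\<bar> * \<bar>W (2 * j + 1)\<bar> \<le> (Lg * x l) * (Lv * x l)"
    \<comment> \<open>The induction hypothesis centres the right half at its own left end. Moving
      that centre to the left end of the whole block costs one increment of \<open>g\<close> times
      one block sum of \<open>Y\<close>.\<close>
    using g[of "2 * j" l] V[of "2 * j + 1" l] le x(2) assms(4,5)
    unfolding W_def by (intro mult_mono) auto
  then have cross: "\<bar>(g ((2 * j + 1) * 2 ^ l) - g ((2 * j) * 2 ^ l)) * W (2 * j + 1)\<bar> \<le> Lg * Lv * (x l)\<^sup>2"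
    by (simp add: abs_mult power2_eq_square mult_ac)
  have g0: "g (j * 2 ^ Suc l) = g ((2 * j) * 2 ^ l)" by (simp add: mult_ac)
  have "(S (2 * j) + S (2 * j + 1)) - g ((2 * j) * 2 ^ l) * (W (2 * j) + W (2 * j + 1)) =
      (S (2 * j) - g ((2 * j) * 2 ^ l) * W (2 * j)) + (S (2 * j + 1) - g ((2 * j + 1) * 2 ^ l) * W (2 * j + 1))
      + (g ((2 * j + 1) * 2 ^ l) - g ((2 * j) * 2 ^ l)) * W (2 * j + 1)"
    by (simp add: algebra_simps)
  then have "\<bar>(S (2 * j) + S (2 * j + 1)) - g ((2 * j) * 2 ^ l) * (W (2 * j) + W (2 * j + 1))\<bar>
      \<le> 2 * (C * (x l)\<^sup>2) + Lg * Lv * (x l)\<^sup>2"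
    using IH1 IH2 cross by linarith
  also have "\<dots> = (2 * C + Lg * Lv) * (x l)\<^sup>2" by (simp add: algebra_simps)
  \<comment> \<open>The constant is the fixed point of this recursion: two halves and one cross term
    must be paid by the gain \<open>\<beta>\<^sup>2\<close> per level. Here
    \<open>\<beta>\<^sup>2 > 2\<close> is indispensable.\<close>
  also have "2 * C + Lg * Lv = C * \<beta>\<^sup>2" unfolding C_def using assms(1) by (simp add: field_simps)
  finally show ?case unfolding split g0 x(1) power_mult_distrib S_def W_def C_def by (simp add: mult_ac)
qed

text \<open>A prefix is cut into full dyadic blocks along the binary digits of \<open>k\<close>, at
  most one block per level. The block costs \<open>A * x l\<close> form a geometric series in
  \<open>l\<close>, whence the factor \<open>\<beta> / (\<beta> - 1)\<close>. Since \<open>g\<close>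
  is sampled only at left ends of blocks, its increments are required only where the next block
  still fits into \<open>2 ^ m\<close>.\<close>

lemma dyadic_young_prefix:
  fixes g Y x :: "nat \<Rightarrow> real"
  assumes "\<beta>\<^sup>2 > 2" "\<beta> > 1" and x: "\<And>l. x (Suc l) = \<beta> * x l" "\<And>l. x l \<ge> 0" and "Lg \<ge> 0" "Lv \<ge> 0"
    and V: "\<And>l j. (j + 1) * 2 ^ l \<le> 2 ^ m \<Longrightarrow> \<bar>\<Sum>n\<in>{j * 2 ^ l..<(j + 1) * 2 ^ l}. Y n\<bar> \<le> Lv * x l"
    and g: "\<And>l j. (j + 2) * 2 ^ l \<le> 2 ^ m \<Longrightarrow> \<bar>g ((j + 1) * 2 ^ l) - g (j * 2 ^ l)\<bar> \<le> Lg * x l"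
    and G: "\<And>n. \<bar>g n\<bar> \<le> G" and k: "k \<le> 2 ^ m"
  shows "\<bar>\<Sum>n<k. g n * Y n\<bar> \<le> (Lg * Lv / (\<beta>\<^sup>2 - 2) * x m + G * Lv) * \<beta> / (\<beta> - 1) * x m"
proof -
  define A where "A = Lg * Lv / (\<beta>\<^sup>2 - 2) * x m + G * Lv"
  define D where "D = A * \<beta> / (\<beta> - 1)"
  have G0: "G \<ge> 0" using G[of 0] by linarith
  have A0: "A \<ge> 0" unfolding A_def using assms(1,5,6) x(2)[of m] G0 by simp
  have D: "A \<le> D" "D \<ge> 0"
    using assms(2) A0 unfolding D_def by (auto simp: field_simps)
  have AD: "A + D \<le> D * \<beta>"
  proof -
    have "D * (\<beta> - 1) = A * \<beta>" unfolding D_def using assms(2) by simp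
    then have "D * \<beta> - D = A * \<beta>" by (simp add: algebra_simps)
    then show ?thesis using A0 assms(2) mult_left_mono[of 1 \<beta> A] by simp
  qed
  have xmono: "x l \<le> x m" if "l \<le> m" for l
    using that
  proof (induction rule: dec_induct)
    case (step n)
    then show ?case using x(1)[of n] x(2)[of n] assms(2) mult_right_mono[of 1 \<beta> "x n"] by simp
  qed simp
  have block: "\<bar>\<Sum>n\<in>{j * 2 ^ l..<(j + 1) * 2 ^ l}. g n * Y n\<bar> \<le> A * x l"
    if jl: "(j + 1) * 2 ^ l \<le> (2::nat) ^ m" for j l
  proof -
    have "(2::nat) ^ l \<le> (j + 1) * 2 ^ l" by simp
    then have "(2::nat) ^ l \<le> 2 ^ m" using jl by linarith
    then have lm: "l \<le> m" by simp
    have *: "\<bar>(\<Sum>n\<in>{j * 2 ^ l..<(j + 1) * 2 ^ l}. g n * Y n) - g (j * 2 ^ l) * (\<Sum>n\<in>{j * 2 ^ l..<(j + 1) * 2 ^ l}. Y n)\<bar>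
      \<le> Lg * Lv / (\<beta>\<^sup>2 - 2) * (x l)\<^sup>2"
      by (rule dyadic_young_block[OF assms(1) x assms(5,6) V g jl]) 
    have **: "\<bar>g (j * 2 ^ l) * (\<Sum>n\<in>{j * 2 ^ l..<(j + 1) * 2 ^ l}. Y n)\<bar> \<le> G * (Lv * x l)"
      unfolding abs_mult using G V[OF jl] G0 by (intro mult_mono) auto
    have "Lg * Lv / (\<beta>\<^sup>2 - 2) * (x l)\<^sup>2 \<le> Lg * Lv / (\<beta>\<^sup>2 - 2) * (x m * x l)"
      using xmono[OF lm] x(2) assms(1,5,6)
      by (intro mult_left_mono) (auto simp: power2_eq_square[of "x l"] intro: mult_right_mono)
    then show ?thesis using * ** unfolding A_def by (simp add: algebra_simps)
  qed
  have "\<bar>\<Sum>n\<in>{j * 2 ^ l..<j * 2 ^ l + k}. g n * Y n\<bar> \<le> D * x l"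
    if "(j + 1) * 2 ^ l \<le> (2::nat) ^ m" "k \<le> 2 ^ l" for j l k
    using that
  proof (induction l arbitrary: j k)
    case 0
    then consider "k = 0" | "k = 1" by force
    then show ?case
    proof cases
      case 1
      then show ?thesis using D x(2) by simp
    next
      case 2
      then show ?thesis using block[of j 0] 0 mult_right_mono[OF D(1) x(2)[of 0]] by simp
    qed
  next
    case (Suc l)
    have le: "(2 * j + 1 + 1) * 2 ^ l \<le> (2::nat) ^ m" using Suc.prems by (simp add: algebra_simps)
    have le': "(2 * j + 1) * 2 ^ l \<le> (2::nat) ^ m"
      by (rule order.trans[OF _ le]) (intro mult_right_mono, auto)
    have j2: "j * 2 ^ Suc l = 2 * j * 2 ^ l" by simp
    have xl: "D * x l \<le> D * x (Suc l)" using D(2) x(1)[of l] x(2)[of l] assms(2) mult_right_mono[of 1 \<beta> "x l"]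
      by (intro mult_left_mono) auto
    show ?case
    proof (cases "k \<le> 2 ^ l")
      case True
      then show ?thesis unfolding j2 using Suc.IH[of "2 * j" k, OF le'] xl by linarith
    next
      case False
      then obtain k' where k': "k = 2 ^ l + k'" "k' \<le> 2 ^ l"
        using Suc.prems(2) by (metis add_le_cancel_left le_Suc_ex mult_2 nat_le_linear power_Suc)
      have "(\<Sum>n\<in>{j * 2 ^ Suc l..<j * 2 ^ Suc l + k}. g n * Y n) =
        (\<Sum>n\<in>{2 * j * 2 ^ l..<(2 * j + 1) * 2 ^ l}. g n * Y n)
        + (\<Sum>n\<in>{(2 * j + 1) * 2 ^ l..<(2 * j + 1) * 2 ^ l + k'}. g n * Y n)"
        unfolding j2 k'(1) using sum.atLeastLessThan_concat[of "2 * j * 2 ^ l" "(2 * j + 1) * 2 ^ l"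
          "(2 * j + 1) * 2 ^ l + k'" "\<lambda>n. g n * Y n"] by (simp add: algebra_simps)
      moreover have "\<bar>\<Sum>n\<in>{2 * j * 2 ^ l..<(2 * j + 1) * 2 ^ l}. g n * Y n\<bar> \<le> A * x l"
        using block[OF le'] .
      moreover have "\<bar>\<Sum>n\<in>{(2 * j + 1) * 2 ^ l..<(2 * j + 1) * 2 ^ l + k'}. g n * Y n\<bar> \<le> D * x l"
        using Suc.IH[OF le k'(2)] .
      moreover have "A * x l + D * x l \<le> D * x (Suc l)"
        unfolding x(1) using mult_right_mono[OF AD x(2)[of l]] by (simp add: algebra_simps)
      ultimately show ?thesis by linarith
    qed
  qed
  from this[of 0 m k] k show ?thesis unfolding D_def A_def by (simp add: atLeast0LessThan)
qed

lemma powr_power_swap: "x \<ge> 0 \<Longrightarrow> (x powr a) ^ n = (x ^ n) powr (a :: real)"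
  by (induction n) (auto simp: powr_mult)

text \<open>Kolmogorov chaining: \<open>a i\<close> rounds \<open>s\<close> down to level
  \<open>i\<close>, and passing to the next level either keeps the point or moves it by one cell.
  Telescoping gives a geometric tail, and continuity identifies the limit with
  \<open>\<phi> s\<close>.\<close>

lemma dyadic_chain:
  fixes \<phi> :: "real \<Rightarrow> real"
  assumes cont: "continuous_on {0..1} \<phi>" and q: "0 < q" "q < 1" and "K \<ge> 0"
    and incr: "\<And>i j. j < 2 ^ i \<Longrightarrow> \<bar>\<phi> (real (Suc j) / 2 ^ i) - \<phi> (real j / 2 ^ i)\<bar> \<le> K * q ^ i"
    and s: "s \<in> {0..1}"
  shows "\<bar>\<phi> s - \<phi> (real (nat \<lfloor>2 ^ l * s\<rfloor>) / 2 ^ l)\<bar> \<le> K * q ^ Suc l / (1 - q)"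
proof -
  define J where "J i = nat \<lfloor>2 ^ i * s\<rfloor>" for i
  define a where "a i = real (J i) / 2 ^ i" for i
  have J: "real (J i) \<le> 2 ^ i * s" "2 ^ i * s < real (J i) + 1" for i
  proof -
    have "0 \<le> 2 ^ i * s" using s by simp
    then show "real (J i) \<le> 2 ^ i * s" "2 ^ i * s < real (J i) + 1" unfolding J_def by linarith+
  qed
  have step: "\<bar>\<phi> (a (Suc i)) - \<phi> (a i)\<bar> \<le> K * q ^ Suc i" for i
  proof -
    have 1: "real (J (Suc i)) < real (2 * J i + 2)" using J[of i] J[of "Suc i"] by simp
    have 2: "real (2 * J i) < real (J (Suc i) + 1)" using J[of i] J[of "Suc i"] by simp
    from 1 2 have "J (Suc i) < 2 * J i + 2" "2 * J i < J (Suc i) + 1"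
      by (simp_all only: of_nat_less_iff)
    then consider "J (Suc i) = 2 * J i" | "J (Suc i) = Suc (2 * J i)" by linarith
    then show ?thesis
    proof cases
      case 1
      then have "a (Suc i) = a i" by (simp add: a_def)
      then show ?thesis using q assms(4) by simp
    next
      case 2
      have "real (J (Suc i)) \<le> 2 ^ Suc i" using J(1)[of "Suc i"] s
        by (smt (verit) atLeastAtMost_iff mult_left_le zero_le_power)
      then have "J (Suc i) \<le> 2 ^ Suc i" by (metis of_nat_le_iff of_nat_numeral of_nat_power)
      then have "2 * J i < 2 ^ Suc i" using 2 by linarith
      from incr[OF this] show ?thesis unfolding a_def 2 by simp
    qed
  qed
  have tele: "\<bar>\<phi> (a (l + i)) - \<phi> (a l)\<bar> \<le> K * q ^ Suc l * (1 - q ^ i) / (1 - q)" for i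
  proof (induction i)
    case (Suc i)
    have "\<bar>\<phi> (a (l + Suc i)) - \<phi> (a l)\<bar> \<le> K * q ^ Suc (l + i) + K * q ^ Suc l * (1 - q ^ i) / (1 - q)"
      using Suc step[of "l + i"] by simp
    also have "\<dots> = K * q ^ Suc l * (1 - q ^ Suc i) / (1 - q)"
      using q by (simp add: field_simps power_add)
    finally show ?case .
  qed simp
  have tele': "\<bar>\<phi> (a (l + i)) - \<phi> (a l)\<bar> \<le> K * q ^ Suc l / (1 - q)" for i
  proof -
    have "K * q ^ Suc l * (1 - q ^ i) / (1 - q) \<le> K * q ^ Suc l * 1 / (1 - q)"
      using q assms(4) by (intro divide_right_mono mult_left_mono) auto
    then show ?thesis using tele[of i] by simp
  qed
  have a01: "a i \<in> {0..1}" and as: "\<bar>a i - s\<bar> \<le> (1 / 2) ^ i" for i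
  proof -
    have "a i \<le> s" "s \<le> a i + (1 / 2) ^ i"
      using J[of i] unfolding a_def by (auto simp: field_simps)
    moreover have "a i \<ge> 0" by (simp add: a_def)
    ultimately show "a i \<in> {0..1}" "\<bar>a i - s\<bar> \<le> (1 / 2) ^ i" using s by auto
  qed
  have "(\<lambda>i. a i - s) \<longlonglongrightarrow> 0"
  proof (rule Lim_null_comparison)
    show "\<forall>\<^sub>F i in sequentially. norm (a i - s) \<le> (1 / 2) ^ i" using as by (intro always_eventually) simp
    show "(\<lambda>i. (1 / 2 :: real) ^ i) \<longlonglongrightarrow> 0" by (rule LIMSEQ_power_zero) simp
  qed
  then have "a \<longlonglongrightarrow> s" by (simp add: LIM_zero_iff)
  then have "(\<lambda>i. a (l + i)) \<longlonglongrightarrow> s" using LIMSEQ_ignore_initial_segment[of a s l] by (simp add: add.commute)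
  then have "(\<lambda>i. \<phi> (a (l + i))) \<longlonglongrightarrow> \<phi> s"
    by (rule continuous_on_tendsto_compose[OF cont _ s]) (use a01 in \<open>intro always_eventually allI\<close>)
  then have "(\<lambda>i. \<bar>\<phi> (a (l + i)) - \<phi> (a l)\<bar>) \<longlonglongrightarrow> \<bar>\<phi> s - \<phi> (a l)\<bar>" by (intro tendsto_intros)
  then have "\<bar>\<phi> s - \<phi> (a l)\<bar> \<le> K * q ^ Suc l / (1 - q)"
    by (rule LIMSEQ_le_const2) (use tele' in blast)
  then show ?thesis unfolding a_def J_def .
qed

text \<open>Chaining from level zero starts at \<open>0\<close>, except for \<open>s = 1\<close>,
  where it starts at \<open>1\<close>; the extra summand \<open>K\<close> is the single increment of
  level zero.\<close>

lemma dyadic_chain_bound: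
  fixes \<phi> :: "real \<Rightarrow> real"
  assumes cont: "continuous_on {0..1} \<phi>" and q: "0 < q" "q < 1" and "K \<ge> 0"
    and incr: "\<And>i j. j < 2 ^ i \<Longrightarrow> \<bar>\<phi> (real (Suc j) / 2 ^ i) - \<phi> (real j / 2 ^ i)\<bar> \<le> K * q ^ i"
    and s: "s \<in> {0..1}"
  shows "\<bar>\<phi> s - \<phi> 0\<bar> \<le> K / (1 - q)"
proof -
  have "\<bar>\<phi> (real (nat \<lfloor>s\<rfloor>)) - \<phi> 0\<bar> \<le> K"
  proof (cases "s = 1")
    case True
    then show ?thesis using incr[of 0 0] by simp
  next
    case False
    then have "\<lfloor>s\<rfloor> = 0" using s by (simp add: floor_eq_iff)
    then show ?thesis using assms(4) by simp
  qed
  moreover have "\<bar>\<phi> s - \<phi> (real (nat \<lfloor>s\<rfloor>))\<bar> \<le> K * q / (1 - q)"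
    using dyadic_chain[OF cont q assms(4) incr s, of 0] by simp
  moreover have "K + K * q / (1 - q) = K / (1 - q)" using q by (simp add: field_simps)
  ultimately show ?thesis by linarith
qed

text \<open>At the level \<open>l\<close> with
  \<open>(1 / 2) ^ Suc l < t - s \<le> (1 / 2) ^ l\<close> the rounded points of \<open>s\<close>
  and \<open>t\<close> coincide or are adjacent, so one cell and two tails suffice. They add up to
  at most \<open>2 * K / (1 - q) * q ^ l\<close>; the second factor 2 comes from
  \<open>q ^ l \<le> (2 * (t - s)) powr a\<close>.\<close>

lemma dyadic_chain_holder:
  fixes \<phi> :: "real \<Rightarrow> real"
  assumes cont: "continuous_on {0..1} \<phi>" and a: "0 < a" "a \<le> 1" and "K \<ge> 0"
    and incr: "\<And>i j. j < 2 ^ i \<Longrightarrow> \<bar>\<phi> (real (Suc j) / 2 ^ i) - \<phi> (real j / 2 ^ i)\<bar> \<le> K * (2 powr (- a)) ^ i"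
    and st: "s \<in> {0..1}" "t \<in> {0..1}"
  shows "\<bar>\<phi> s - \<phi> t\<bar> \<le> 4 * K / (1 - 2 powr (- a)) * \<bar>s - t\<bar> powr a"
proof -
  define q where "q = (2::real) powr (- a)"
  have q: "0 < q" "q < 1" using a by (auto simp: q_def powr_minus divide_simps)
  have *: "\<bar>\<phi> s - \<phi> t\<bar> \<le> 4 * K / (1 - q) * (t - s) powr a" if st: "0 \<le> s" "s < t" "t \<le> 1" for s t
  proof -
    have "\<exists>l. (1 / 2) ^ Suc l < t - s"
    proof -
      obtain l where "(1 / 2) ^ l < t - s" using real_arch_pow_inv[of "t - s" "1 / 2"] st by auto
      moreover have "(1 / 2 :: real) ^ Suc l \<le> (1 / 2) ^ l" by simp
      ultimately show ?thesis by (metis order_le_less_trans)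
    qed
    then obtain l where l: "(1 / 2) ^ Suc l < t - s" "\<And>k. k < l \<Longrightarrow> \<not> (1 / 2) ^ Suc k < t - s"
      using exists_least_iff[of "\<lambda>l. (1 / 2) ^ Suc l < t - s"] by metis
    have l2: "t - s \<le> (1 / 2) ^ l"
      using l(2)[of "l - 1"] st by (cases l) auto
    define j where "j = nat \<lfloor>2 ^ l * s\<rfloor>"
    define k where "k = nat \<lfloor>2 ^ l * t\<rfloor>"
    have "2 ^ l * t \<le> 2 ^ l * s + 1" using l2 by (simp add: field_simps)
    moreover have "2 ^ l * s \<le> 2 ^ l * t" "0 \<le> 2 ^ l * s" using st by auto
    ultimately have "j \<le> k" "k \<le> j + 1" "real k \<le> 2 ^ l * t" unfolding j_def k_def by linarith+
    moreover have "2 ^ l * t \<le> 2 ^ l" using st by simp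
    ultimately have "k = j \<or> k = Suc j \<and> j < 2 ^ l"
    proof -
      assume "j \<le> k" "k \<le> j + 1" and k: "real k \<le> 2 ^ l * t" "2 ^ l * t \<le> 2 ^ l"
      have "real k \<le> real (2 ^ l)" using order.trans[OF k] by simp
      then have "k \<le> 2 ^ l" by (rule of_nat_le_iff[THEN iffD1])
      then show ?thesis using \<open>j \<le> k\<close> \<open>k \<le> j + 1\<close> by linarith
    qed
    then have 1: "\<bar>\<phi> (real k / 2 ^ l) - \<phi> (real j / 2 ^ l)\<bar> \<le> K * q ^ l"
      using incr[of j l] assms(4) q unfolding q_def by auto
    have 2: "\<bar>\<phi> s - \<phi> (real j / 2 ^ l)\<bar> \<le> K * q ^ Suc l / (1 - q)"
      "\<bar>\<phi> t - \<phi> (real k / 2 ^ l)\<bar> \<le> K * q ^ Suc l / (1 - q)"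
      unfolding j_def k_def using st by (intro dyadic_chain[OF cont q assms(4)] incr[folded q_def]; simp)+
    have "\<bar>\<phi> s - \<phi> t\<bar> \<le> K * q ^ l + 2 * (K * q ^ Suc l / (1 - q))"
      using 1 2 by linarith
    also have "\<dots> = K * (1 + q) / (1 - q) * q ^ l" using q by (simp add: field_simps)
    also have "\<dots> \<le> K * 2 / (1 - q) * q ^ l"
      using q assms(4) by (intro mult_right_mono divide_right_mono mult_left_mono) auto
    also have "\<dots> \<le> K * 2 / (1 - q) * (2 * (t - s) powr a)"
    proof -
      have "q ^ l = ((1 / 2) ^ l) powr a"
        unfolding q_def by (simp add: powr_minus_divide powr_divide flip: powr_power_swap)
      also have "\<dots> \<le> (2 * (t - s)) powr a" using l(1) a by (intro powr_mono2) auto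
      also have "\<dots> = 2 powr a * (t - s) powr a" by (rule powr_mult)
      also have "\<dots> \<le> 2 * (t - s) powr a" using a powr_mono[of a 1 2] by (intro mult_right_mono) auto
      finally have "q ^ l \<le> 2 * (t - s) powr a" .
      then show ?thesis using q assms(4) by (intro mult_left_mono) auto
    qed
    finally show ?thesis by (simp add: mult_ac)
  qed
  show ?thesis
    using *[of s t] *[of t s] st unfolding q_def[symmetric]
    by (cases s t rule: linorder_cases) (auto simp: abs_minus_commute)
qed

section \<open>Paths of the transformed equation\<close>

text \<open>The level set is compact, so it has a last point \<open>s\<close>. A later value above
  \<open>c\<close> would force a further crossing on the way down to
  \<open>\<phi> t\<close>.\<close>

lemma last_crossing:
  fixes \<phi> :: "real \<Rightarrow> real"
  assumes "continuous_on {r..t} \<phi>" "r \<le> t" "\<phi> t \<le> c" "c \<le> \<phi> r"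
  shows "\<exists>s\<in>{r..t}. \<phi> s = c \<and> (\<forall>u\<in>{s..t}. \<phi> u \<le> c)"
proof -
  define S where "S = {s \<in> {r..t}. \<phi> s = c}"
  have "S \<noteq> {}" using IVT2'[of \<phi> t c r] assms by (auto simp: S_def)
  moreover have "compact S"
  proof -
    have "closed S" unfolding S_def by (intro continuous_closed_preimage_constant assms(1)) simp
    moreover have "bounded S" by (rule bounded_subset[OF bounded_closed_interval[of r t]]) (auto simp: S_def)
    ultimately show ?thesis by (simp add: compact_eq_bounded_closed)
  qed
  ultimately obtain s where s: "s \<in> S" "\<And>u. u \<in> S \<Longrightarrow> u \<le> s"
    using compact_attains_sup[of S] by metis
  have "\<phi> u \<le> c" if u: "u \<in> {s..t}" for u
  proof (rule ccontr)
    assume "\<not> \<phi> u \<le> c"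
    then have uc: "c < \<phi> u" by simp
    have "continuous_on {u..t} \<phi>" using assms(1) s u by (auto simp: S_def elim: continuous_on_subset)
    then obtain v where "v \<in> {u..t}" "\<phi> v = c"
      using IVT2'[of \<phi> t c u] u uc assms(3) by auto
    then have "v \<le> s" using s u by (auto simp: S_def)
    then have "u = s" using \<open>v \<in> {u..t}\<close> u by simp
    then show False using uc s by (simp add: S_def)
  qed
  then show ?thesis using s by (auto simp: S_def)
qed

text \<open>The deterministic setting: one path of the noise and the corresponding solution.
  Normalising \<open>K \<ge> 1\<close> allows different powers of \<open>K\<close> to be dominated
  by the largest one.\<close>

locale lamperti_path =
  fixes \<kappa> \<theta> \<sigma> x0 T a K :: real and b X :: "real \<Rightarrow> real"
  assumes param: "\<kappa> * \<theta> > 0" "\<sigma> > 0" "x0 > 0" "T > 0" "1 / 2 < a" "a < 1" "K \<ge> 1"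
    and contX: "continuous_on {0..T} X" and posX: "\<And>t. t \<in> {0..T} \<Longrightarrow> X t > 0"
    and eqX: "\<And>t. t \<in> {0..T} \<Longrightarrow>
      X t = x0 + integral {0..t} (\<lambda>s. lamperti_drift \<kappa> \<theta> (X s)) + \<sigma> / 2 * (b t - b 0)"
    and holder: "\<And>s t. s \<in> {0..T} \<Longrightarrow> t \<in> {0..T} \<Longrightarrow> \<bar>b t - b s\<bar> \<le> K * \<bar>t - s\<bar> powr a"
begin

lemma cont_drift: "S \<subseteq> {0..T} \<Longrightarrow> continuous_on S (\<lambda>s. lamperti_drift \<kappa> \<theta> (X s))"
proof (rule continuous_on_subset)
  have "X s \<noteq> 0" if "s \<in> {0..T}" for s using posX[OF that] by simp
  then show "continuous_on {0..T} (\<lambda>s. lamperti_drift \<kappa> \<theta> (X s))"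
    unfolding lamperti_drift_def by (intro continuous_intros contX) auto
qed

lemma int_drift: "{p..q} \<subseteq> {0..T} \<Longrightarrow> (\<lambda>s. lamperti_drift \<kappa> \<theta> (X s)) integrable_on {p..q}"
  by (intro integrable_continuous_real cont_drift)

lemma X0: "X 0 = x0"
  using eqX[of 0] param by simp

lemma X_increment:
  assumes "0 \<le> s" "s \<le> t" "t \<le> T"
  shows "X t - X s = integral {s..t} (\<lambda>s. lamperti_drift \<kappa> \<theta> (X s)) + \<sigma> / 2 * (b t - b s)"
proof -
  have "integral {0..s} (\<lambda>s. lamperti_drift \<kappa> \<theta> (X s)) + integral {s..t} (\<lambda>s. lamperti_drift \<kappa> \<theta> (X s))
      = integral {0..t} (\<lambda>s. lamperti_drift \<kappa> \<theta> (X s))"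
    using assms by (intro Henstock_Kurzweil_Integration.integral_combine int_drift) auto
  moreover have "\<sigma> / 2 * (b t - b s) = \<sigma> / 2 * (b t - b 0) - \<sigma> / 2 * (b s - b 0)"
    by (simp add: field_simps)
  moreover have "s \<in> {0..T}" "t \<in> {0..T}" using assms by auto
  ultimately show ?thesis using eqX[of s] eqX[of t] by linarith
qed

lemma noise_bound:
  assumes "0 \<le> s" "s \<le> t" "t \<le> T"
  shows "\<bar>\<sigma> / 2 * (b t - b s)\<bar> \<le> \<sigma> / 2 * K * (t - s) powr a"
  using holder[of s t] assms param by (simp add: abs_mult mult.assoc)

text \<open>A path that comes close to zero is pushed back by the singular drift; between the last time at
  level \<open>2 * X t\<close> and time \<open>t\<close> only the noise can overcome this push.\<close>

lemma X_lower:
  assumes t: "t \<in> {0..T}"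
  shows "1 / X t \<le> max (1 / min (x0 / 2) (sqrt (\<bar>\<theta>\<bar> / 8)))
     ((\<sigma> * K / (2 * (\<kappa> * \<theta> / 8) powr a)) powr (1 / (2 * a - 1)))"
proof (cases "X t < min (x0 / 2) (sqrt (\<bar>\<theta>\<bar> / 8))")
  case False
  have "min (x0 / 2) (sqrt (\<bar>\<theta>\<bar> / 8)) > 0" using param by auto
  then have "1 / X t \<le> 1 / min (x0 / 2) (sqrt (\<bar>\<theta>\<bar> / 8))" using False
    by (intro divide_left_mono mult_pos_pos posX t) auto
  then show ?thesis by simp
next
  case True
  \<comment> \<open>The 8 leaves room for two losses. While \<open>X u \<le> 2 * y\<close>, the
    singular part satisfies \<open>\<kappa> * \<theta> / X u \<ge> 4 * c / y\<close>, the linear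
    part is at most \<open>2 * c / y\<close>, and the drift is half the difference.\<close>
  define y c where "y = X t" and "c = \<kappa> * \<theta> / 8"
  have y: "y > 0" "2 * y \<le> x0" "y < sqrt (\<bar>\<theta>\<bar> / 8)" using True posX[OF t] by (auto simp: y_def)
  have c: "c > 0" using param by (simp add: c_def)
  have "y\<^sup>2 \<le> (sqrt (\<bar>\<theta>\<bar> / 8))\<^sup>2" using y by (intro power_mono) auto
  then have y2: "8 * y\<^sup>2 \<le> \<bar>\<theta>\<bar>" by simp
  have "\<exists>s\<in>{0..t}. X s = 2 * y \<and> (\<forall>u\<in>{s..t}. X u \<le> 2 * y)"
    using t y X0 contX by (intro last_crossing) (auto simp: y_def elim: continuous_on_subset)
  then obtain s where s: "s \<in> {0..t}" "X s = 2 * y" "\<And>u. u \<in> {s..t} \<Longrightarrow> X u \<le> 2 * y" by auto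
  have drift: "c / y \<le> lamperti_drift \<kappa> \<theta> (X u)" if u: "u \<in> {s..t}" for u
  proof -
    have Xu: "0 < X u" "X u \<le> 2 * y" using posX[of u] s u t by auto
    have "\<bar>\<kappa>\<bar> * (8 * y\<^sup>2) \<le> \<bar>\<kappa>\<bar> * \<bar>\<theta>\<bar>" by (intro mult_left_mono y2) auto
    also have "\<dots> = 8 * c" using param unfolding c_def by (simp flip: abs_mult)
    finally have "\<bar>\<kappa>\<bar> * y \<le> c / y" using y by (simp add: field_simps power2_eq_square)
    moreover have "\<kappa> * X u \<le> \<bar>\<kappa>\<bar> * (2 * y)" using Xu by (intro mult_mono) auto
    moreover have "4 * c / y \<le> \<kappa> * \<theta> / X u"
    proof -
      have "\<kappa> * \<theta> / (2 * y) \<le> \<kappa> * \<theta> / X u" using Xu y param by (intro divide_left_mono) auto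
      then show ?thesis unfolding c_def by simp
    qed
    ultimately show ?thesis unfolding lamperti_drift_def by (simp add: right_diff_distrib)
  qed
  define \<tau> where "\<tau> = t - s"
  have \<tau>0: "\<tau> \<ge> 0" using s by (simp add: \<tau>_def)
  have sub: "{s..t} \<subseteq> {0..T}" using s t by auto
  have "integral {s..t} (\<lambda>u. c / y) \<le> integral {s..t} (\<lambda>s. lamperti_drift \<kappa> \<theta> (X s))"
    using drift by (intro integral_le int_drift[OF sub]) auto
  then have int: "c / y * \<tau> \<le> integral {s..t} (\<lambda>s. lamperti_drift \<kappa> \<theta> (X s))"
    using \<tau>0 by (simp add: \<tau>_def mult.commute)
  have "X t - X s = - y" using s by (simp add: y_def)
  then have key: "y + c / y * \<tau> \<le> \<sigma> / 2 * K * \<tau> powr a"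
  proof -
    have st: "0 \<le> s" "s \<le> t" "t \<le> T" using s(1) t by auto
    show ?thesis
      using X_increment[OF st] noise_bound[OF st] int \<open>X t - X s = - y\<close> unfolding \<tau>_def by linarith
  qed
  have \<tau>: "\<tau> > 0"
  proof (rule ccontr)
    assume "\<not> \<tau> > 0"
    then have "\<tau> = 0" using \<tau>0 by simp
    then show False using key y by simp
  qed
  \<comment> \<open>\<open>M\<close> dominates both summands, hence also their weighted geometric
    mean. The weight \<open>a\<close> matches the factor \<open>\<tau> powr a\<close> of the noise
    bound, so the unknown duration \<open>\<tau>\<close> cancels. What remains bounds
    \<open>y powr (1 - 2 * a)\<close>, a negative power of \<open>y\<close> because
    \<open>2 * a > 1\<close>.\<close>
  define M where "M = y + c / y * \<tau>"
  have M: "y \<le> M" "c / y * \<tau> \<le> M" "M > 0" using y c \<tau> by (auto simp: M_def add_pos_nonneg)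
  have "y powr (1 - a) * (c / y * \<tau>) powr a \<le> M powr (1 - a) * M powr a"
    using M y c \<tau> param by (intro mult_mono powr_mono2) auto
  also have "\<dots> = M" using M by (simp flip: powr_add)
  also have "y powr (1 - a) * (c / y * \<tau>) powr a = y powr (1 - 2 * a) * c powr a * \<tau> powr a"
  proof -
    have "(c / y * \<tau>) powr a = c powr a * y powr (- a) * \<tau> powr a"
      using y c \<tau> by (simp add: powr_mult powr_divide powr_minus divide_simps)
    moreover have "y powr (1 - a) * y powr (- a) = y powr (1 - 2 * a)" by (simp flip: powr_add)
    ultimately show ?thesis by (simp add: algebra_simps)
  qed
  finally have "y powr (1 - 2 * a) * c powr a * \<tau> powr a \<le> \<sigma> / 2 * K * \<tau> powr a"
    using key unfolding M_def by linarith
  then have "y powr (1 - 2 * a) * c powr a \<le> \<sigma> / 2 * K" using \<tau> by simp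
  then have "y powr (1 - 2 * a) \<le> \<sigma> * K / (2 * c powr a)" using c by (simp add: field_simps)
  then have "(y powr (1 - 2 * a)) powr (1 / (2 * a - 1)) \<le> (\<sigma> * K / (2 * c powr a)) powr (1 / (2 * a - 1))"
    using param by (intro powr_mono2) auto
  also have "(y powr (1 - 2 * a)) powr (1 / (2 * a - 1)) = 1 / y"
  proof -
    have "(1 - 2 * a) * (1 / (2 * a - 1)) = -1" using param by (simp add: field_simps)
    then show ?thesis using y by (simp add: powr_powr powr_minus_divide del: times_divide_eq_right)
  qed
  finally show ?thesis unfolding y_def c_def by simp
qed

text \<open>The linear growth of the drift is absorbed by looking at the maximum of
  \<open>exp (- \<bar>\<kappa>\<bar> * t) * X t\<close> instead of that of \<open>X\<close>.\<close>

lemma X_upper: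
  assumes u: "u \<in> {0..T}"
  shows "X u \<le> 2 * exp (\<bar>\<kappa>\<bar> * T) * (1 + x0 + \<kappa> * \<theta> / 2 * T + \<sigma> / 2 * K * T powr a)"
proof -
  define m where "m = \<bar>\<kappa>\<bar> / 2"
  define A where "A = 1 + x0 + \<kappa> * \<theta> / 2 * T + \<sigma> / 2 * K * T powr a"
  have m: "m > 0" using param unfolding m_def by (metis abs_of_pos half_gt_zero mult_zero_left zero_less_abs_iff less_irrefl)
  have A1: "1 + x0 \<le> A" using param unfolding A_def by simp
  obtain t where t: "t \<in> {0..T}" and max: "\<And>u. u \<in> {0..T} \<Longrightarrow> exp (- 2 * m * u) * X u \<le> exp (- 2 * m * t) * X t"
  proof -
    have "continuous_on {0..T} (\<lambda>u. exp (- 2 * m * u) * X u)" by (intro continuous_intros contX)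
    then show ?thesis
      using continuous_attains_sup[of "{0..T}" "\<lambda>u. exp (- 2 * m * u) * X u"] u that by (metis compact_Icc empty_iff)
  qed
  have max': "X u \<le> exp (2 * m * (u - t)) * X t" if "u \<in> {0..T}" for u
  proof -
    have "exp (2 * m * u) * (exp (- 2 * m * u) * X u) \<le> exp (2 * m * u) * (exp (- 2 * m * t) * X t)"
      using max[OF that] by (intro mult_left_mono) auto
    then show ?thesis by (simp add: exp_minus right_diff_distrib exp_diff field_simps)
  qed
  have Xt: "X t \<le> 2 * A"
  proof (cases "X t \<le> 1 + x0")
    case True
    then show ?thesis using A1 param by linarith
  next
    case False
    \<comment> \<open>After the last time at level \<open>1 + x0\<close> the path stays above 1, so
      the singular part of the drift is at most \<open>\<kappa> * \<theta>\<close>.\<close>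
    have "\<exists>s\<in>{0..t}. - X s = - (1 + x0) \<and> (\<forall>u\<in>{s..t}. - X u \<le> - (1 + x0))"
      using t X0 contX False
      by (intro last_crossing) (auto intro!: continuous_intros elim: continuous_on_subset)
    then obtain s where s: "s \<in> {0..t}" "X s = 1 + x0" "\<And>u. u \<in> {s..t} \<Longrightarrow> 1 + x0 \<le> X u"
      by (metis neg_le_iff_le neg_equal_iff_equal)
    have sub: "{s..t} \<subseteq> {0..T}" using s t by auto
    have drift: "lamperti_drift \<kappa> \<theta> (X u) \<le> \<kappa> * \<theta> / 2 + m * exp (2 * m * (u - t)) * X t" if u: "u \<in> {s..t}" for u
    proof -
      have "1 \<le> X u" using s(3)[OF u] param by simp
      then have "\<kappa> * \<theta> / X u \<le> \<kappa> * \<theta> / 1" using param by (intro divide_left_mono) auto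
      moreover have "- \<kappa> * X u \<le> \<bar>\<kappa>\<bar> * X u" using \<open>1 \<le> X u\<close> by (intro mult_right_mono) auto
      moreover have "m * X u \<le> m * (exp (2 * m * (u - t)) * X t)"
        using m max'[of u] u sub by (intro mult_left_mono) auto
      ultimately show ?thesis unfolding lamperti_drift_def m_def by (simp add: right_diff_distrib mult.assoc)
    qed
    \<comment> \<open>The exponential term integrates to at most \<open>X t / 2\<close>, which is
      absorbed into the left-hand side; this explains the factor 2 in \<open>2 * A\<close>.\<close>
    have "((\<lambda>u. \<kappa> * \<theta> / 2 + m * exp (2 * m * (u - t)) * X t) has_integral
       (\<kappa> * \<theta> / 2 * t + exp (2 * m * (t - t)) / 2 * X t) - (\<kappa> * \<theta> / 2 * s + exp (2 * m * (s - t)) / 2 * X t)) {s..t}"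
      using s by (intro fundamental_theorem_of_calculus)
        (auto intro!: derivative_eq_intros simp: has_real_derivative_iff_has_vector_derivative[symmetric])
    then have "integral {s..t} (\<lambda>s. lamperti_drift \<kappa> \<theta> (X s)) \<le>
       (\<kappa> * \<theta> / 2 * t + exp (2 * m * (t - t)) / 2 * X t) - (\<kappa> * \<theta> / 2 * s + exp (2 * m * (s - t)) / 2 * X t)"
      using drift int_drift[OF sub] by (intro has_integral_le[OF integrable_integral]) auto
    also have "\<dots> \<le> \<kappa> * \<theta> / 2 * (t - s) + X t / 2"
      using posX[OF t] by (simp add: right_diff_distrib)
    also have "\<dots> \<le> \<kappa> * \<theta> / 2 * T + X t / 2"
      using param s t by (intro add_right_mono mult_left_mono) auto
    finally have int: "integral {s..t} (\<lambda>s. lamperti_drift \<kappa> \<theta> (X s)) \<le> \<kappa> * \<theta> / 2 * T + X t / 2" .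
    have "\<sigma> / 2 * K * (t - s) powr a \<le> \<sigma> / 2 * K * T powr a"
      using s t param by (intro mult_left_mono powr_mono2) auto
    moreover have st: "0 \<le> s" "s \<le> t" "t \<le> T" using s(1) t by auto
    ultimately show ?thesis
      using X_increment[OF st] noise_bound[OF st] int s(2) unfolding A_def by argo
  qed
  have "X u \<le> exp (2 * m * (u - t)) * X t" by (rule max'[OF u])
  also have "\<dots> \<le> exp (\<bar>\<kappa>\<bar> * T) * (2 * A)"
  proof (intro mult_mono Xt)
    have "2 * m * (u - t) \<le> \<bar>\<kappa>\<bar> * T" unfolding m_def using u t by (auto intro!: mult_left_mono)
    then show "exp (2 * m * (u - t)) \<le> exp (\<bar>\<kappa>\<bar> * T)" by simp
  qed (use posX[OF t] in auto)
  finally show ?thesis unfolding A_def[symmetric] by (simp add: mult_ac)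
qed

end

section \<open>Taylor expansion of the drift and error of the scheme along a bounded path\<close>

definition drift_slope :: "real \<Rightarrow> real \<Rightarrow> real \<Rightarrow> real" where
  "drift_slope \<kappa> \<theta> x = - (\<kappa> * \<theta> / x\<^sup>2 + \<kappa>) / 2"

text \<open>\<open>drift_slope\<close> is the derivative of \<open>lamperti_drift\<close>. The
  remainder of this rational function is exact, so only \<open>1 / x\<close> and
  \<open>1 / z\<close> have to be bounded, and no intermediate point appears.\<close>

lemma lamperti_drift_taylor:
  assumes "x > 0" "z > 0"
  shows "lamperti_drift \<kappa> \<theta> x - lamperti_drift \<kappa> \<theta> z - drift_slope \<kappa> \<theta> z * (x - z)
    = \<kappa> * \<theta> / 2 * (x - z)\<^sup>2 / (x * z\<^sup>2)"
proof -
  define u w where "u = 1 / x" and "w = 1 / z"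
  have "x * u = 1" "z * w = 1" using assms by (auto simp: u_def w_def)
  then have "u - w + (x - z) * w\<^sup>2 = (x - z)\<^sup>2 * (u * w\<^sup>2)" by algebra
  then have *: "\<kappa> * \<theta> / 2 * (u - w + (x - z) * w\<^sup>2) = \<kappa> * \<theta> / 2 * ((x - z)\<^sup>2 * (u * w\<^sup>2))" by simp
  have "lamperti_drift \<kappa> \<theta> x - lamperti_drift \<kappa> \<theta> z - drift_slope \<kappa> \<theta> z * (x - z)
      = \<kappa> * \<theta> / 2 * (u - w + (x - z) * w\<^sup>2)"
  proof -
    have "lamperti_drift \<kappa> \<theta> x = (\<kappa> * \<theta> * u - \<kappa> * x) / 2" "lamperti_drift \<kappa> \<theta> z = (\<kappa> * \<theta> * w - \<kappa> * z) / 2"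
      "drift_slope \<kappa> \<theta> z = - (\<kappa> * \<theta> * w\<^sup>2 + \<kappa>) / 2"
      by (auto simp: lamperti_drift_def drift_slope_def u_def w_def power_divide algebra_simps)
    then show ?thesis by (simp only:) (simp add: field_simps)
  qed
  also note *
  finally show ?thesis unfolding u_def w_def by (simp add: power_divide)
qed

lemma drift_slope_diff:
  assumes "x > 0" "z > 0"
  shows "drift_slope \<kappa> \<theta> x - drift_slope \<kappa> \<theta> z = \<kappa> * \<theta> / 2 * (x - z) * (1 / (x * z\<^sup>2) + 1 / (x\<^sup>2 * z))"
proof -
  define u w where "u = 1 / x" and "w = 1 / z"
  have "x * u = 1" "z * w = 1" using assms by (auto simp: u_def w_def)
  then have "w\<^sup>2 - u\<^sup>2 = (x - z) * (u * w\<^sup>2 + u\<^sup>2 * w)" by algebra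
  then have *: "\<kappa> * \<theta> / 2 * (w\<^sup>2 - u\<^sup>2) = \<kappa> * \<theta> / 2 * ((x - z) * (u * w\<^sup>2 + u\<^sup>2 * w))" by simp
  have "drift_slope \<kappa> \<theta> x - drift_slope \<kappa> \<theta> z = \<kappa> * \<theta> / 2 * (w\<^sup>2 - u\<^sup>2)"
  proof -
    have "drift_slope \<kappa> \<theta> x = - (\<kappa> * \<theta> * u\<^sup>2 + \<kappa>) / 2" "drift_slope \<kappa> \<theta> z = - (\<kappa> * \<theta> * w\<^sup>2 + \<kappa>) / 2"
      by (auto simp: drift_slope_def u_def w_def power_divide)
    then show ?thesis by (simp only:) (simp add: field_simps)
  qed
  also note *
  finally show ?thesis unfolding u_def w_def by (simp add: power_divide)
qed

text \<open>One number \<open>K\<close> now bounds the Hoelder constant of the noise,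
  \<open>X\<close> and \<open>1 / X\<close>, so that all estimates become monomials in
  \<open>K\<close>. It is obtained by enlarging the \<open>K\<close> of
  \<open>lamperti_path\<close>, see \<open>lamperti_path_bounds\<close>.\<close>

locale bounded_lamperti_path = lamperti_path +
  assumes X_le: "\<And>t. t \<in> {0..T} \<Longrightarrow> X t \<le> K" and inv_X_le: "\<And>t. t \<in> {0..T} \<Longrightarrow> 1 / X t \<le> K"
begin

definition drift_const :: real where "drift_const = (\<kappa> * \<theta> + \<bar>\<kappa>\<bar>) / 2"

definition holder_const :: real where "holder_const = drift_const * T powr (1 - a) + \<sigma> / 2"

lemma consts_nonneg: "drift_const \<ge> 0" "holder_const \<ge> 0"
  using param by (auto simp: drift_const_def holder_const_def)

lemma drift_bound:
  assumes "t \<in> {0..T}"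
  shows "\<bar>lamperti_drift \<kappa> \<theta> (X t)\<bar> \<le> drift_const * K"
proof -
  have "\<kappa> * \<theta> * (1 / X t) \<le> \<kappa> * \<theta> * K" "\<bar>\<kappa>\<bar> * X t \<le> \<bar>\<kappa>\<bar> * K"
    using X_le[OF assms] inv_X_le[OF assms] param by (auto intro: mult_left_mono simp del: times_divide_eq_right)
  moreover have "\<kappa> * \<theta> / X t \<ge> 0" using param posX[OF assms] by simp
  moreover have "\<bar>\<kappa> * X t\<bar> = \<bar>\<kappa>\<bar> * X t" using posX[OF assms] by (simp add: abs_mult)
  moreover have "lamperti_drift \<kappa> \<theta> (X t) = (\<kappa> * \<theta> / X t - \<kappa> * X t) / 2"
    by (simp add: lamperti_drift_def algebra_simps)
  moreover have "drift_const * K = (\<kappa> * \<theta> * K + \<bar>\<kappa>\<bar> * K) / 2"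
    by (simp add: drift_const_def algebra_simps)
  ultimately show ?thesis by simp
qed

lemma drift_integral_bound:
  assumes "0 \<le> s" "s \<le> t" "t \<le> T"
  shows "\<bar>integral {s..t} (\<lambda>s. lamperti_drift \<kappa> \<theta> (X s))\<bar> \<le> drift_const * K * (t - s)"
  using integral_bound[OF assms(2) cont_drift, of "drift_const * K"] drift_bound assms by auto

lemma X_holder_ordered:
  assumes "0 \<le> s" "s \<le> t" "t \<le> T"
  shows "\<bar>X t - X s\<bar> \<le> holder_const * K * (t - s) powr a"
proof -
  have "t - s = (t - s) powr (1 - a) * (t - s) powr a"
    using assms by (cases "t = s") (auto simp flip: powr_add)
  also have "\<dots> \<le> T powr (1 - a) * (t - s) powr a"
    using assms param by (intro mult_right_mono powr_mono2) auto
  finally have "drift_const * K * (t - s) \<le> drift_const * K * (T powr (1 - a) * (t - s) powr a)"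
    using consts_nonneg param by (intro mult_left_mono) auto
  then show ?thesis
  proof -
    have "holder_const * K * (t - s) powr a = drift_const * K * (T powr (1 - a) * (t - s) powr a) + \<sigma> / 2 * K * (t - s) powr a"
      unfolding holder_const_def by (simp add: algebra_simps)
    then show ?thesis
      using X_increment[OF assms] drift_integral_bound[OF assms] noise_bound[OF assms]
        \<open>drift_const * K * (t - s) \<le> drift_const * K * (T powr (1 - a) * (t - s) powr a)\<close> by linarith
  qed
qed

lemma X_holder:
  assumes "s \<in> {0..T}" "t \<in> {0..T}"
  shows "\<bar>X t - X s\<bar> \<le> holder_const * K * \<bar>t - s\<bar> powr a"
  using X_holder_ordered[of s t] X_holder_ordered[of t s] assms
  by (cases "s \<le> t") (auto simp: abs_minus_commute)

lemma slope_bound: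
  assumes "t \<in> {0..T}"
  shows "\<bar>drift_slope \<kappa> \<theta> (X t)\<bar> \<le> drift_const * K\<^sup>2"
proof -
  have "(1 / X t)\<^sup>2 \<le> K\<^sup>2" using inv_X_le[OF assms] posX[OF assms] by (intro power_mono) auto
  then have 1: "\<kappa> * \<theta> * (1 / (X t)\<^sup>2) \<le> \<kappa> * \<theta> * K\<^sup>2"
    using param by (intro mult_left_mono) (auto simp: power_divide)
  have "1 \<le> K\<^sup>2" using param by simp
  then have 2: "\<bar>\<kappa>\<bar> \<le> \<bar>\<kappa>\<bar> * K\<^sup>2" by (simp add: mult_le_cancel_left1)
  have 3: "0 \<le> \<kappa> * \<theta> / (X t)\<^sup>2" using param by simp
  have "\<bar>\<kappa> * \<theta> / (X t)\<^sup>2 + \<kappa>\<bar> \<le> \<kappa> * \<theta> * K\<^sup>2 + \<bar>\<kappa>\<bar> * K\<^sup>2" using 1 2 3 by simp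
  then show ?thesis unfolding drift_slope_def drift_const_def by (simp add: algebra_simps abs_minus_commute)
qed

lemma inverse_products:
  assumes "s \<in> {0..T}" "t \<in> {0..T}"
  shows "1 / (X s * (X t)\<^sup>2) \<le> K ^ 3" "1 / ((X s)\<^sup>2 * X t) \<le> K ^ 3"
proof -
  have p: "0 \<le> 1 / X s" "0 \<le> 1 / X t" using posX[OF assms(1)] posX[OF assms(2)] by auto
  have "(1 / X s) * (1 / X t) * (1 / X t) \<le> K * K * K" "(1 / X s) * (1 / X s) * (1 / X t) \<le> K * K * K"
    using inv_X_le[OF assms(1)] inv_X_le[OF assms(2)] p param
    by (intro mult_mono mult_nonneg_nonneg; simp)+
  then show "1 / (X s * (X t)\<^sup>2) \<le> K ^ 3" "1 / ((X s)\<^sup>2 * X t) \<le> K ^ 3"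
    by (simp_all add: power2_eq_square power3_eq_cube mult_ac)
qed

lemma slope_holder:
  assumes "s \<in> {0..T}" "t \<in> {0..T}"
  shows "\<bar>drift_slope \<kappa> \<theta> (X t) - drift_slope \<kappa> \<theta> (X s)\<bar> \<le> \<kappa> * \<theta> * holder_const * K ^ 4 * \<bar>t - s\<bar> powr a"
proof -
  have p: "X s > 0" "X t > 0" using assms posX by auto
  have "\<bar>drift_slope \<kappa> \<theta> (X t) - drift_slope \<kappa> \<theta> (X s)\<bar>
     = \<kappa> * \<theta> / 2 * \<bar>X t - X s\<bar> * (1 / (X t * (X s)\<^sup>2) + 1 / ((X t)\<^sup>2 * X s))"
    unfolding drift_slope_diff[OF p(2,1)] abs_mult using param p by simp
  also have "\<dots> \<le> \<kappa> * \<theta> / 2 * (holder_const * K * \<bar>t - s\<bar> powr a) * (K ^ 3 + K ^ 3)"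
    using X_holder[OF assms] inverse_products[OF assms(2,1)] param p consts_nonneg
    by (intro mult_mono add_mono) auto
  also have "\<dots> = \<kappa> * \<theta> * holder_const * K ^ 4 * \<bar>t - s\<bar> powr a"
    by (simp add: power_numeral_reduce algebra_simps)
  finally show ?thesis .
qed

lemma cont_noise: "continuous_on {0..T} b"
proof (rule continuous_on_eq)
  show "continuous_on {0..T} (\<lambda>s. b 0 + (2 / \<sigma>) * (X s - x0 - integral {0..s} (\<lambda>s. lamperti_drift \<kappa> \<theta> (X s))))"
    by (intro continuous_intros contX indefinite_integral_continuous_1 int_drift order_refl)
  show "b 0 + (2 / \<sigma>) * (X s - x0 - integral {0..s} (\<lambda>s. lamperti_drift \<kappa> \<theta> (X s))) = b s" if "s \<in> {0..T}" for s
    using eqX[OF that] param by (simp add: field_simps)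
qed

text \<open>Linearise the drift at the right end. The increment \<open>X s - X v\<close> consists of
  a drift part of order \<open>h\<close> and a noise part; the quadratic remainder is of order
  \<open>h powr (2 * a)\<close>, hence at most of order \<open>h\<close>. After integration only the
  noise part exceeds order \<open>h\<^sup>2\<close>, and it is the term subtracted here. The power
  \<open>K ^ 5\<close> comes from the remainder: \<open>K\<^sup>2\<close> from the squared increment
  and \<open>K ^ 3\<close> from the inverse products.\<close>

lemma local_error_expansion:
  assumes "0 \<le> u" "u + h \<le> T" "0 < h" "h \<le> 1"
  shows "\<bar>integral {u..u + h} (\<lambda>s. lamperti_drift \<kappa> \<theta> (X s) - lamperti_drift \<kappa> \<theta> (X (u + h)))
     - \<sigma> / 2 * (drift_slope \<kappa> \<theta> (X (u + h)) * integral {u..u + h} (\<lambda>s. b s - b (u + h)))\<bar>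
    \<le> (drift_const\<^sup>2 + \<kappa> * \<theta> / 2 * holder_const\<^sup>2) * K ^ 5 * h\<^sup>2"
proof -
  define v where "v = u + h"
  define z where "z = X v"
  have uv: "u \<le> v" "{u..v} \<subseteq> {0..T}" "v \<in> {0..T}" using assms by (auto simp: v_def)
  have z: "z > 0" using posX uv by (simp add: z_def)
  define C where "C = (drift_const\<^sup>2 + \<kappa> * \<theta> / 2 * holder_const\<^sup>2) * K ^ 5 * h"
  define F where "F s = lamperti_drift \<kappa> \<theta> (X s) - lamperti_drift \<kappa> \<theta> z
      - \<sigma> / 2 * (drift_slope \<kappa> \<theta> z * (b s - b v))" for s
  have contb: "continuous_on {u..v} b" by (rule continuous_on_subset[OF cont_noise uv(2)])
  have ib: "(\<lambda>s. b s - b v) integrable_on {u..v}"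
    by (intro integrable_continuous_real continuous_intros contb)
  have idr: "(\<lambda>s. lamperti_drift \<kappa> \<theta> (X s) - lamperti_drift \<kappa> \<theta> z) integrable_on {u..v}"
    by (intro integrable_diff int_drift uv integrable_const_ivl)
  have F: "\<bar>F s\<bar> \<le> C" if s: "s \<in> {u..v}" for s
  proof -
    have sT: "s \<in> {0..T}" "0 \<le> s" "s \<le> v" "v \<le> T" using s uv by auto
    have Xs: "X s > 0" using posX sT by simp
    define D where "D = integral {s..v} (\<lambda>s. lamperti_drift \<kappa> \<theta> (X s))"
    have D: "\<bar>D\<bar> \<le> drift_const * K * h"
    proof -
      have "drift_const * K * (v - s) \<le> drift_const * K * h"
        using s consts_nonneg param by (intro mult_left_mono) (auto simp: v_def)
      then show ?thesis using drift_integral_bound[OF sT(2-4)] unfolding D_def by linarith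
    qed
    have incr: "X s - z = - D - \<sigma> / 2 * (b v - b s)"
      using X_increment[OF sT(2-4)] by (simp add: D_def z_def)
    have "F s = - drift_slope \<kappa> \<theta> z * D + \<kappa> * \<theta> / 2 * (X s - z)\<^sup>2 / (X s * z\<^sup>2)"
    proof -
      have "F s = (lamperti_drift \<kappa> \<theta> (X s) - lamperti_drift \<kappa> \<theta> z - drift_slope \<kappa> \<theta> z * (X s - z))
         + drift_slope \<kappa> \<theta> z * ((X s - z) - \<sigma> / 2 * (b s - b v))"
        unfolding F_def by (simp add: field_simps)
      also have "(X s - z) - \<sigma> / 2 * (b s - b v) = - D" unfolding incr by (simp add: field_simps)
      finally show ?thesis unfolding lamperti_drift_taylor[OF Xs z] by simp
    qed
    moreover have "\<bar>- drift_slope \<kappa> \<theta> z * D\<bar> \<le> drift_const * K\<^sup>2 * (drift_const * K * h)"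
      unfolding abs_mult using slope_bound[OF uv(3)] D consts_nonneg by (intro mult_mono) (auto simp: z_def)
    moreover have "drift_const * K\<^sup>2 * (drift_const * K * h) \<le> drift_const\<^sup>2 * K ^ 5 * h"
    proof -
      have "K ^ 3 \<le> K ^ 5" using param by (intro power_increasing) auto
      then have "drift_const\<^sup>2 * K ^ 3 * h \<le> drift_const\<^sup>2 * K ^ 5 * h"
        using assms by (intro mult_right_mono mult_left_mono) auto
      then show ?thesis by (simp add: power2_eq_square power3_eq_cube mult_ac)
    qed
    moreover have "\<bar>\<kappa> * \<theta> / 2 * (X s - z)\<^sup>2 / (X s * z\<^sup>2)\<bar> \<le> \<kappa> * \<theta> / 2 * holder_const\<^sup>2 * K ^ 5 * h"
    proof -
      have "\<bar>X s - z\<bar> \<le> holder_const * K * h powr a"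
      proof -
        have "holder_const * K * \<bar>v - s\<bar> powr a \<le> holder_const * K * h powr a"
          using s consts_nonneg param by (intro mult_left_mono powr_mono2) (auto simp: v_def)
        then show ?thesis using X_holder[OF sT(1) uv(3)] by (simp add: z_def abs_minus_commute)
      qed
      then have "(X s - z)\<^sup>2 \<le> (holder_const * K * h powr a)\<^sup>2" by (metis abs_le_square_iff abs_of_nonneg abs_ge_zero order.trans)
      also have "\<dots> = holder_const\<^sup>2 * K\<^sup>2 * h powr (2 * a)"
        by (simp add: power_mult_distrib powr_add[symmetric] power2_eq_square)
      also have "\<dots> \<le> holder_const\<^sup>2 * K\<^sup>2 * h powr 1"
        using assms param by (intro mult_left_mono powr_mono') auto
      finally have "(X s - z)\<^sup>2 * (1 / (X s * z\<^sup>2)) \<le> (holder_const\<^sup>2 * K\<^sup>2 * h) * K ^ 3"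
        using inverse_products(1)[OF sT(1) uv(3)] assms Xs z by (intro mult_mono) (auto simp: z_def)
      then have "\<kappa> * \<theta> / 2 * ((X s - z)\<^sup>2 * (1 / (X s * z\<^sup>2))) \<le> \<kappa> * \<theta> / 2 * ((holder_const\<^sup>2 * K\<^sup>2 * h) * K ^ 3)"
        using param by (intro mult_left_mono) auto
      moreover have "0 \<le> \<kappa> * \<theta> / 2 * (X s - z)\<^sup>2 / (X s * z\<^sup>2)" using param Xs by simp
      moreover have "\<kappa> * \<theta> / 2 * ((holder_const\<^sup>2 * K\<^sup>2 * h) * K ^ 3) = \<kappa> * \<theta> / 2 * holder_const\<^sup>2 * K ^ 5 * h"
        by (simp add: power_numeral_reduce mult_ac)
      ultimately show ?thesis by (simp only: abs_of_nonneg times_divide_eq_right mult_1_right mult.assoc)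
    qed
    moreover have "C = drift_const\<^sup>2 * K ^ 5 * h + \<kappa> * \<theta> / 2 * holder_const\<^sup>2 * K ^ 5 * h"
      by (simp add: C_def algebra_simps)
    ultimately show ?thesis by linarith
  qed
  have "integral {u..v} F = integral {u..v} (\<lambda>s. lamperti_drift \<kappa> \<theta> (X s) - lamperti_drift \<kappa> \<theta> z)
      - \<sigma> / 2 * (drift_slope \<kappa> \<theta> z * integral {u..v} (\<lambda>s. b s - b v))"
    unfolding F_def using ib idr by (subst integral_diff) (auto intro!: integrable_on_mult_right simp del: times_divide_eq_left)
  moreover have "\<bar>integral {u..v} F\<bar> \<le> C * h"
  proof -
    have "continuous_on {u..v} F" unfolding F_def
      by (intro continuous_intros cont_drift uv contb)
    then have "norm (integral {u..v} F) \<le> C * (v - u)"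
      using F uv by (intro integral_bound) auto
    then show ?thesis by (simp add: v_def)
  qed
  ultimately show ?thesis unfolding C_def z_def v_def by (simp add: power2_eq_square mult.assoc)
qed

text \<open>The constant of \<open>dyadic_young_prefix\<close> for
  \<open>\<beta> = 2 powr a\<close>, with \<open>x m\<close> replaced by its bound
  \<open>(2 * T) powr a\<close> and the powers of \<open>K\<close> taken out.\<close>

definition young_const :: real where
  "young_const = (\<kappa> * \<theta> * holder_const / ((2 powr a)\<^sup>2 - 2) * (2 * T) powr a + drift_const)
     * (2 powr a) / (2 powr a - 1) * (2 * T) powr a"

lemma two_powr_a: "(2 powr a)\<^sup>2 > 2" "2 powr a > 1"
proof -
  have "2 powr 1 < 2 powr (2 * a)" using param by (intro powr_less_mono) auto
  also have "2 powr (2 * a) = (2 powr a)\<^sup>2" by (simp add: power2_eq_square flip: powr_add)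
  finally show "(2 powr a)\<^sup>2 > 2" by simp
  show "2 powr a > 1" using param by simp
qed

lemma young_const_nonneg: "young_const \<ge> 0"
proof -
  have "\<kappa> * \<theta> * holder_const / ((2 powr a)\<^sup>2 - 2) \<ge> 0"
    using consts_nonneg param(1) two_powr_a by (intro divide_nonneg_nonneg mult_nonneg_nonneg[of "\<kappa> * \<theta>"]) linarith+
  then have "\<kappa> * \<theta> * holder_const / ((2 powr a)\<^sup>2 - 2) * (2 * T) powr a + drift_const \<ge> 0"
    using consts_nonneg by (intro add_nonneg_nonneg mult_nonneg_nonneg[of "_ / _"]) simp_all
  then show ?thesis using two_powr_a(2) unfolding young_const_def
    by (intro mult_nonneg_nonneg divide_nonneg_nonneg; simp)
qed

text \<open>The discrete Young estimate applies because the slopes along \<open>X\<close> and the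
  block sums of the noise both have exponent \<open>a > 1 / 2\<close>. The Hoelder constant of the
  slopes carries \<open>K ^ 4\<close> and the block sums carry \<open>K * h\<close>, which gives
  \<open>K ^ 5 * h\<close>.\<close>

lemma weighted_noise_sum:
  assumes N: "N \<ge> 1" "h = T / real N" "N \<le> 2 ^ m" "2 ^ m \<le> 2 * N"
    and V: "\<And>l j. (j + 1) * 2 ^ l \<le> 2 ^ m \<Longrightarrow>
       \<bar>block_sum b h N l j\<bar> \<le> K * h * (2 ^ l * h) powr a"
    and k: "k \<le> N"
  shows "\<bar>\<Sum>n<k. drift_slope \<kappa> \<theta> (X (real n * h + h)) * block_noise b h n\<bar> \<le> young_const * K ^ 5 * h"
proof -
  \<comment> \<open>The shift by one selects the right end of the step. The cut at \<open>N\<close>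
    keeps the time inside \<open>{0..T}\<close> for the padded indices, where \<open>Y\<close> is
    zero.\<close>
  define t where "t n = real (min (n + 1) N) * h" for n
  define g where "g n = drift_slope \<kappa> \<theta> (X (t n))" for n
  define Y where "Y n = (if n < N then block_noise b h n else 0)" for n
  define x where "x l = (2 ^ l * h) powr a" for l :: nat
  have h: "h > 0" "real N * h = T" using N param by auto
  have t: "t n \<in> {0..T}" for n
    using h(1) by (auto simp: t_def h(2)[symmetric])
  have tdiff: "\<bar>t n - t n'\<bar> \<le> \<bar>real n - real n'\<bar> * h" for n n'
  proof -
    have "\<bar>real (min (n + 1) N) - real (min (n' + 1) N)\<bar> \<le> \<bar>real n - real n'\<bar>" by auto
    then have "\<bar>real (min (n + 1) N) - real (min (n' + 1) N)\<bar> * h \<le> \<bar>real n - real n'\<bar> * h"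
      using h by (intro mult_right_mono) auto
    then show ?thesis unfolding t_def using h(1) by (simp only: left_diff_distrib[symmetric] abs_mult abs_of_pos)
  qed
  have "\<bar>\<Sum>n<k. g n * Y n\<bar> \<le> ((\<kappa> * \<theta> * holder_const * K ^ 4) * (K * h) / ((2 powr a)\<^sup>2 - 2) * x m
       + drift_const * K\<^sup>2 * (K * h)) * (2 powr a) / (2 powr a - 1) * x m"
  proof (rule dyadic_young_prefix[OF two_powr_a])
    show "x (Suc l) = 2 powr a * x l" "x l \<ge> 0" for l
      using h unfolding x_def by (simp_all add: mult.assoc powr_mult)
    show "\<kappa> * \<theta> * holder_const * K ^ 4 \<ge> 0" "K * h \<ge> 0" using param consts_nonneg h by auto
    show "\<bar>\<Sum>n\<in>{j * 2 ^ l..<(j + 1) * 2 ^ l}. Y n\<bar> \<le> K * h * x l" if "(j + 1) * 2 ^ l \<le> 2 ^ m" for l j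
      using V[OF that] unfolding Y_def x_def block_sum_def .
    show "\<bar>g ((j + 1) * 2 ^ l) - g (j * 2 ^ l)\<bar> \<le> \<kappa> * \<theta> * holder_const * K ^ 4 * x l" for l j
    proof -
      have "\<bar>t ((j + 1) * 2 ^ l) - t (j * 2 ^ l)\<bar> powr a \<le> x l"
        unfolding x_def using tdiff[of "(j + 1) * 2 ^ l" "j * 2 ^ l"] param
        by (intro powr_mono2) (auto simp: algebra_simps)
      then have "\<kappa> * \<theta> * holder_const * K ^ 4 * \<bar>t ((j + 1) * 2 ^ l) - t (j * 2 ^ l)\<bar> powr a \<le> \<kappa> * \<theta> * holder_const * K ^ 4 * x l"
        using param consts_nonneg by (intro mult_left_mono) auto
      then show ?thesis using slope_holder[OF t t, of "(j + 1) * 2 ^ l" "j * 2 ^ l"] unfolding g_def by linarith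
    qed
    show "\<bar>g n\<bar> \<le> drift_const * K\<^sup>2" for n unfolding g_def by (intro slope_bound t)
    show "k \<le> 2 ^ m" using k N by simp
  qed
  also have "\<dots> \<le> ((\<kappa> * \<theta> * holder_const * K ^ 4) * (K * h) / ((2 powr a)\<^sup>2 - 2) * (2 * T) powr a
       + drift_const * K ^ 4 * (K * h)) * (2 powr a) / (2 powr a - 1) * (2 * T) powr a"
  proof -
    have "real (2 ^ m) \<le> real (2 * N)" using N(4) by (simp only: of_nat_le_iff)
    then have "2 ^ m * h \<le> 2 * real N * h" using h by (intro mult_right_mono) auto
    then have "x m \<le> (2 * T) powr a"
      unfolding x_def using h param by (intro powr_mono2) auto
    moreover have "K\<^sup>2 \<le> K ^ 4" using param by (intro power_increasing) auto
    moreover have "x m \<ge> 0" by (simp add: x_def)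
    moreover have Pq: "(\<kappa> * \<theta> * holder_const * K ^ 4) * (K * h) / ((2 powr a)\<^sup>2 - 2) \<ge> 0"
      using consts_nonneg param h two_powr_a
      by (intro divide_nonneg_nonneg mult_nonneg_nonneg[of "\<kappa> * \<theta>"] mult_nonneg_nonneg[of "\<kappa> * \<theta> * holder_const"]
          mult_nonneg_nonneg[of "\<kappa> * \<theta> * holder_const * K ^ 4"]) auto
    moreover have "drift_const * K\<^sup>2 * (K * h) \<le> drift_const * K ^ 4 * (K * h)"
      using \<open>K\<^sup>2 \<le> K ^ 4\<close> param consts_nonneg h by (intro mult_right_mono mult_left_mono) auto
    ultimately have S: "(\<kappa> * \<theta> * holder_const * K ^ 4) * (K * h) / ((2 powr a)\<^sup>2 - 2) * x m + drift_const * K\<^sup>2 * (K * h)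
      \<le> (\<kappa> * \<theta> * holder_const * K ^ 4) * (K * h) / ((2 powr a)\<^sup>2 - 2) * (2 * T) powr a + drift_const * K ^ 4 * (K * h)"
      by (intro add_mono mult_left_mono)
    have S0: "0 \<le> (\<kappa> * \<theta> * holder_const * K ^ 4) * (K * h) / ((2 powr a)\<^sup>2 - 2) * (2 * T) powr a + drift_const * K ^ 4 * (K * h)"
      using Pq consts_nonneg param h by (intro add_nonneg_nonneg mult_nonneg_nonneg) auto
    show ?thesis
    proof (rule mult_mono)
      show "x m \<le> (2 * T) powr a" by fact
      show "0 \<le> x m" by (simp add: x_def)
    qed (use S S0 two_powr_a(2) in \<open>auto intro!: divide_right_mono mult_right_mono divide_nonneg_nonneg mult_nonneg_nonneg simp del: times_divide_eq_left times_divide_eq_right\<close>)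
  qed
  also have "\<dots> = young_const * K ^ 5 * h"
  proof -
    have "K ^ 5 = K ^ 4 * K" by (simp add: power_numeral_reduce)
    then show ?thesis unfolding young_const_def by (simp add: algebra_simps add_divide_distrib)
  qed
  also have "(\<Sum>n<k. g n * Y n) = (\<Sum>n<k. drift_slope \<kappa> \<theta> (X (real n * h + h)) * block_noise b h n)"
    using k by (intro sum.cong) (auto simp: g_def Y_def t_def min_def algebra_simps)
  finally show ?thesis .
qed

definition local_const :: real where
  "local_const = (drift_const\<^sup>2 + \<kappa> * \<theta> / 2 * holder_const\<^sup>2) * T + \<sigma> / 2 * young_const"

lemma local_const_nonneg: "local_const \<ge> 0"
  using param young_const_nonneg unfolding local_const_def
  by (intro mult_nonneg_nonneg add_nonneg_nonneg) auto

lemma accumulated_local_error: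
  assumes N: "N \<ge> 1" "h = T / real N" "N \<le> 2 ^ m" "2 ^ m \<le> 2 * N" "h < 1"
    and V: "\<And>l j. (j + 1) * 2 ^ l \<le> 2 ^ m \<Longrightarrow>
       \<bar>block_sum b h N l j\<bar> \<le> K * h * (2 ^ l * h) powr a"
    and k: "k \<le> N"
  shows "\<bar>\<Sum>n<k. integral {real n * h..real n * h + h}
      (\<lambda>s. lamperti_drift \<kappa> \<theta> (X s) - lamperti_drift \<kappa> \<theta> (X (real n * h + h)))\<bar> \<le> local_const * K ^ 5 * h"
    (is "\<bar>\<Sum>n<k. ?R n\<bar> \<le> _")
proof -
  define c where "c = (drift_const\<^sup>2 + \<kappa> * \<theta> / 2 * holder_const\<^sup>2) * K ^ 5"
  have c: "c \<ge> 0" using param unfolding c_def by (intro mult_nonneg_nonneg add_nonneg_nonneg) auto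
  define w where "w n = drift_slope \<kappa> \<theta> (X (real n * h + h)) * block_noise b h n" for n
  have h: "h > 0" "real N * h = T" using N param by auto
  have R: "\<bar>?R n - \<sigma> / 2 * w n\<bar> \<le> c * h\<^sup>2" if "n < k" for n
  proof -
    have "real (n + 1) * h \<le> real N * h" using that k h by (intro mult_right_mono) auto
    then have "real n * h + h \<le> T" using h by (simp add: algebra_simps)
    moreover have "0 \<le> real n * h" using h(1) by simp
    ultimately show ?thesis unfolding w_def block_noise_def c_def
      using h(1) N(5) by (intro local_error_expansion) simp_all
  qed
  have "\<bar>(\<Sum>n<k. ?R n) - \<sigma> / 2 * (\<Sum>n<k. w n)\<bar> \<le> (\<Sum>n<k. \<bar>?R n - \<sigma> / 2 * w n\<bar>)"
    unfolding sum_distrib_left sum_subtractf[symmetric] by (rule sum_abs)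
  also have "\<dots> \<le> (\<Sum>n<k. c * h\<^sup>2)" by (intro sum_mono R) auto
  also have "\<dots> = c * h * (real k * h)" by (simp add: power2_eq_square)
  also have "\<dots> \<le> c * h * (real N * h)" using c h k by (intro mult_left_mono mult_right_mono) auto
  finally have 1: "\<bar>(\<Sum>n<k. ?R n) - \<sigma> / 2 * (\<Sum>n<k. w n)\<bar> \<le> c * h * T" using h by simp
  have "\<bar>\<Sum>n<k. w n\<bar> \<le> young_const * K ^ 5 * h"
    unfolding w_def by (rule weighted_noise_sum[OF N(1-4) V k])
  then have 2: "\<bar>\<sigma> / 2 * (\<Sum>n<k. w n)\<bar> \<le> \<sigma> / 2 * (young_const * K ^ 5 * h)"
    using param by (simp add: abs_mult)
  have "local_const * K ^ 5 * h = c * h * T + \<sigma> / 2 * (young_const * K ^ 5 * h)"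
    unfolding local_const_def c_def by (simp add: algebra_simps)
  then show ?thesis using 1 2 by linarith
qed

lemma euler_iterate_pos:
  assumes "h > 0" "h * max 0 (- \<kappa> / 2) < 1"
  shows "euler_iterate \<kappa> \<theta> \<sigma> x0 h b n > 0"
proof -
  have "h * (- \<kappa> / 2) \<le> h * max 0 (- \<kappa> / 2)" using assms by (intro mult_left_mono) auto
  then have "2 + \<kappa> * h > 0" using assms by (simp add: mult.commute)
  then show ?thesis using euler_iterate_Suc(1)[of \<kappa> \<theta> h \<sigma> x0 b] param assms by (cases n) auto
qed

lemma euler_grid_error:
  assumes N: "N \<ge> 1" "h = T / real N" "N \<le> 2 ^ m" "2 ^ m \<le> 2 * N" "h < 1"
    and V: "\<And>l j. (j + 1) * 2 ^ l \<le> 2 ^ m \<Longrightarrow>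
       \<bar>block_sum b h N l j\<bar> \<le> K * h * (2 ^ l * h) powr a"
    and \<xi>: "0 < \<xi>" "h * max 0 (- \<kappa> / 2) < 1 - \<xi>" and n: "n \<le> N"
  shows "\<bar>X (real n * h) - euler_iterate \<kappa> \<theta> \<sigma> x0 h b n\<bar>
    \<le> 2 * local_const * exp (T * max 0 (- \<kappa> / 2) / \<xi>) * K ^ 5 * h"
proof -
  have h: "h > 0" "real N * h = T" using N param by auto
  have "h * (- \<kappa> / 2) \<le> h * max 0 (- \<kappa> / 2)" using h by (intro mult_left_mono) auto
  then have kh: "2 + \<kappa> * h > 0" using \<xi> by (simp add: mult.commute)
  \<comment> \<open>With these partial sums of local errors, the exact path satisfies the same
    recursion as the scheme, with the same noise, up to the increments of
    \<open>\<rho>\<close>.\<close>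
  define \<rho> where "\<rho> k = (\<Sum>n<k. integral {real n * h..real n * h + h}
      (\<lambda>s. lamperti_drift \<kappa> \<theta> (X s) - lamperti_drift \<kappa> \<theta> (X (real n * h + h))))" for k
  have tn: "real n * h \<in> {0..T}" if "n \<le> N" for n
    using that h mult_right_mono[of "real n" "real N" h] by auto
  have "\<bar>X (real n * h) - euler_iterate \<kappa> \<theta> \<sigma> x0 h b n\<bar> \<le> 2 * (local_const * K ^ 5 * h) * exp (real n * h * max 0 (- \<kappa> / 2) / \<xi>)"
  proof (rule backward_euler_error[where X = "\<lambda>n. X (real n * h)" and \<rho> = \<rho>
        and D = "\<lambda>n. \<sigma> / 2 * (b (real (Suc n) * h) - b (real n * h))", OF param(1) h(1) \<xi>])
    fix i assume i: "i < N"
    have S: "real (Suc i) * h = real i * h + h" by (simp add: algebra_simps)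
    have st: "0 \<le> real i * h" "real i * h \<le> real (Suc i) * h" "real (Suc i) * h \<le> T"
      using tn[of i] tn[of "Suc i"] i h S by auto
    have "\<rho> (Suc i) - \<rho> i = integral {real i * h..real (Suc i) * h} (\<lambda>s. lamperti_drift \<kappa> \<theta> (X s))
        - lamperti_drift \<kappa> \<theta> (X (real (Suc i) * h)) * h"
    proof -
      have "{real i * h..real i * h + h} \<subseteq> {0..T}" using st unfolding S by auto
      then have "integral {real i * h..real i * h + h} (\<lambda>s. lamperti_drift \<kappa> \<theta> (X s) - lamperti_drift \<kappa> \<theta> (X (real i * h + h)))
         = integral {real i * h..real i * h + h} (\<lambda>s. lamperti_drift \<kappa> \<theta> (X s))
          - integral {real i * h..real i * h + h} (\<lambda>s. lamperti_drift \<kappa> \<theta> (X (real i * h + h)))"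
        by (intro integral_diff int_drift integrable_const_ivl)
      then show ?thesis unfolding \<rho>_def S using h(1) by (simp add: mult.commute)
    qed
    then show "X (real (Suc i) * h) = X (real i * h) + lamperti_drift \<kappa> \<theta> (X (real (Suc i) * h)) * h
        + \<sigma> / 2 * (b (real (Suc i) * h) - b (real i * h)) + (\<rho> (Suc i) - \<rho> i)"
      using X_increment[OF st] by linarith
    show "euler_iterate \<kappa> \<theta> \<sigma> x0 h b (Suc i) = euler_iterate \<kappa> \<theta> \<sigma> x0 h b i
        + lamperti_drift \<kappa> \<theta> (euler_iterate \<kappa> \<theta> \<sigma> x0 h b (Suc i)) * h
        + \<sigma> / 2 * (b (real (Suc i) * h) - b (real i * h))"
      by (rule euler_iterate_Suc(2)[OF param(1) h(1) kh])
  next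
    show "\<bar>\<rho> i\<bar> \<le> local_const * K ^ 5 * h" if "i \<le> N" for i
      unfolding \<rho>_def by (rule accumulated_local_error[OF N V that])
    show "euler_iterate \<kappa> \<theta> \<sigma> x0 h b i > 0" for i
      using h \<xi> by (intro euler_iterate_pos) auto
  qed (use n X0 posX tn in \<open>auto simp: \<rho>_def\<close>)
  also have "\<dots> \<le> 2 * (local_const * K ^ 5 * h) * exp (T * max 0 (- \<kappa> / 2) / \<xi>)"
    using tn[OF n] \<xi> h param local_const_nonneg
    by (intro mult_left_mono) (auto intro!: divide_right_mono mult_right_mono)
  finally show ?thesis by (simp add: mult_ac)
qed

text \<open>The interpolant is a convex combination of two neighbouring iterates, so it suffices to
  compare \<open>X t\<close> with \<open>X\<close> at both ends of the step and to add the grid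
  error.\<close>

lemma euler_interpolant_error:
  assumes N: "N \<ge> 1" "h = T / real N"
    and E: "\<And>n. n \<le> N \<Longrightarrow> \<bar>X (real n * h) - euler_iterate \<kappa> \<theta> \<sigma> x0 h b n\<bar> \<le> E"
    and w: "\<And>n t. n < N \<Longrightarrow> t \<in> {real n * h..real n * h + h} \<Longrightarrow> \<bar>b t - b (real n * h)\<bar> \<le> w"
    and t: "t \<in> {0..T}"
  shows "\<bar>X t - euler_interpolant \<kappa> \<theta> \<sigma> x0 h b t\<bar> \<le> drift_const * K * h + \<sigma> * w + E"
proof -
  have h: "h > 0" "real N * h = T" using N param by auto
  have w0: "w \<ge> 0" using w[of 0 0] N h by auto
  have E0: "E \<ge> 0" using E[of 0] by auto
  show ?thesis
  proof (cases "t \<le> 0")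
    case True
    then have "t = 0" using t by simp
    then show ?thesis using X0 h consts_nonneg param w0 E0 by (simp add: euler_interpolant_def)
  next
    case False
    define n where "n = nat (\<lceil>t / h\<rceil> - 1)"
    have th: "0 < t / h" "t / h \<le> real N"
    proof -
      show "0 < t / h" using False h(1) by simp
      show "t / h \<le> real N" using t h by (simp add: pos_divide_le_eq)
    qed
    have n: "real n < t / h" "t / h \<le> real n + 1" "n < N"
      using th unfolding n_def by linarith+
    then have tn: "real n * h \<le> t" "t \<le> real n * h + h"
      using h(1) by (simp_all add: pos_less_divide_eq pos_divide_le_eq algebra_simps)
    have "real (Suc n) * h \<le> real N * h" using n(3) h by (intro mult_right_mono) auto
    then have S: "real (Suc n) * h = real n * h + h" "real n * h + h \<le> T" using h by (auto simp: algebra_simps)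
    define lam where "lam = (t - real n * h) / h"
    have l: "0 \<le> lam" "lam \<le> 1" using tn h by (auto simp: lam_def field_simps)
    define Z where "Z = euler_iterate \<kappa> \<theta> \<sigma> x0 h b"
    have ip: "euler_interpolant \<kappa> \<theta> \<sigma> x0 h b t = (1 - lam) * Z n + lam * Z (Suc n)"
      unfolding euler_interpolant_def Let_def n_def[symmetric] lam_def[symmetric] Z_def using False
      by (simp only: if_False) (simp add: algebra_simps)
    have db: "\<bar>X t' - X s\<bar> \<le> drift_const * K * h + \<bar>\<sigma> / 2 * (b t' - b s)\<bar>"
      if "0 \<le> s" "s \<le> t'" "t' \<le> T" "t' - s \<le> h" for s t'
    proof -
      have "drift_const * K * (t' - s) \<le> drift_const * K * h"
        using that consts_nonneg param by (intro mult_left_mono) auto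
      then show ?thesis using X_increment[OF that(1-3)] drift_integral_bound[OF that(1-3)] by linarith
    qed
    have \<sigma>w: "\<bar>\<sigma> / 2 * (b p - b q)\<bar> \<le> \<sigma> / 2 * B" if "\<bar>b p - b q\<bar> \<le> B" for p q B
      using that param by (simp add: abs_mult)
    have w1: "\<bar>b t - b (real n * h)\<bar> \<le> w" using w[OF n(3)] tn by auto
    \<comment> \<open>Oscillations are measured from the left grid point, so reaching the right end
      from \<open>t\<close> costs \<open>2 * w\<close>; together with the factor
      \<open>\<sigma> / 2\<close> this gives \<open>\<sigma> * w\<close>.\<close>
    have w2: "\<bar>b (real n * h + h) - b t\<bar> \<le> 2 * w" using w[OF n(3), of "real n * h + h"] w1 h by auto
    have "\<bar>X t - X (real n * h)\<bar> \<le> drift_const * K * h + \<sigma> / 2 * w"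
      using db[of "real n * h" t] tn t h \<sigma>w[OF w1] by auto
    then have e1: "\<bar>X t - X (real n * h)\<bar> \<le> drift_const * K * h + \<sigma> * w"
    proof -
      have "\<sigma> * w \<ge> 0" using w0 param by simp
      moreover assume "\<bar>X t - X (real n * h)\<bar> \<le> drift_const * K * h + \<sigma> / 2 * w"
      ultimately show ?thesis by (simp add: field_simps)
    qed
    have e2: "\<bar>X t - X (real (Suc n) * h)\<bar> \<le> drift_const * K * h + \<sigma> * w"
      using db[of t "real n * h + h"] tn t S \<sigma>w[OF w2] by auto
    have "X t - euler_interpolant \<kappa> \<theta> \<sigma> x0 h b t =
       (1 - lam) * ((X t - X (real n * h)) + (X (real n * h) - Z n))
       + lam * ((X t - X (real (Suc n) * h)) + (X (real (Suc n) * h) - Z (Suc n)))"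
      unfolding ip by (simp add: algebra_simps)
    also have "\<bar>\<dots>\<bar> \<le> (1 - lam) * (drift_const * K * h + \<sigma> * w + E) + lam * (drift_const * K * h + \<sigma> * w + E)"
    proof (intro order.trans[OF abs_triangle_ineq] add_mono)
      have "\<bar>(X t - X (real n * h)) + (X (real n * h) - Z n)\<bar> \<le> drift_const * K * h + \<sigma> * w + E"
        using e1 E[of n] n(3) unfolding Z_def by linarith
      then show "\<bar>(1 - lam) * ((X t - X (real n * h)) + (X (real n * h) - Z n))\<bar> \<le> (1 - lam) * (drift_const * K * h + \<sigma> * w + E)"
        using l by (simp add: abs_mult mult_left_mono)
      have "\<bar>(X t - X (real (Suc n) * h)) + (X (real (Suc n) * h) - Z (Suc n))\<bar> \<le> drift_const * K * h + \<sigma> * w + E"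
        using e2 E[of "Suc n"] n(3) unfolding Z_def by linarith
      then show "\<bar>lam * ((X t - X (real (Suc n) * h)) + (X (real (Suc n) * h) - Z (Suc n)))\<bar> \<le> lam * (drift_const * K * h + \<sigma> * w + E)"
        using l by (simp add: abs_mult mult_left_mono)
    qed
    also have "\<dots> = drift_const * K * h + \<sigma> * w + E" by (simp add: algebra_simps)
    finally show ?thesis .
  qed
qed

lemma square_error:
  assumes "\<bar>X t - y\<bar> \<le> e" "t \<in> {0..T}"
  shows "\<bar>(X t)\<^sup>2 - y\<^sup>2\<bar> \<le> e * (2 * K + e)"
proof -
  have "(X t)\<^sup>2 - y\<^sup>2 = (X t - y) * (X t + y)" by (simp add: power2_eq_square algebra_simps)
  moreover have "\<bar>X t + y\<bar> \<le> 2 * K + e" using assms posX[of t] X_le[of t] by linarith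
  ultimately show ?thesis using assms(1) by (auto simp: abs_mult intro!: mult_mono)
qed

end

section \<open>Gaussian estimates\<close>

text \<open>Both \<open>u + x\<close> and \<open>u + y\<close> are convex combinations of
  \<open>u\<close> and \<open>u + x + y\<close>, with complementary weights, so convexity of the
  power yields the claim by addition. For \<open>u = 0\<close>, where an argument may vanish,
  superadditivity is shown directly. With \<open>p = 2 * H\<close> this gives the positive
  correlation of disjoint increments.\<close>

lemma powr_increment_mono:
  fixes u x y p :: real
  assumes "u \<ge> 0" "x \<ge> 0" "y \<ge> 0" "p \<ge> 1"
  shows "(u + x) powr p + (u + y) powr p \<le> (u + x + y) powr p + u powr p"
proof (cases "u = 0")
  case True
  have *: "z powr p \<le> z * (x + y) powr (p - 1)" if "0 \<le> z" "z \<le> x + y" for z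
  proof (cases "z = 0")
    case False
    then have "z powr p = z * z powr (p - 1)" using that powr_add[of z 1 "p - 1"] by simp
    also have "\<dots> \<le> z * (x + y) powr (p - 1)" using that assms by (intro mult_left_mono powr_mono2) auto
    finally show ?thesis .
  qed (use assms in auto)
  have "x powr p + y powr p \<le> (x + y) * (x + y) powr (p - 1)"
    using *[of x] *[of y] assms by (simp add: algebra_simps)
  also have "\<dots> = (x + y) powr p"
    using assms powr_add[of "x + y" 1 "p - 1"] by (cases "x + y = 0") auto
  finally show ?thesis using True by simp
next
  case False
  then have u: "u > 0" using assms by simp
  show ?thesis
  proof (cases "x + y = 0")
    case True
    then have "x = 0" "y = 0" using assms by auto
    then show ?thesis by simp
  next
    case False
    define c where "c = x / (x + y)"
    have c: "0 \<le> c" "c \<le> 1" "c * (x + y) = x" using assms False by (auto simp: c_def)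
    have cvx: "((1 - t) * u + t * (u + x + y)) powr p \<le> (1 - t) * u powr p + t * (u + x + y) powr p"
      if "0 \<le> t" "t \<le> 1" for t
      using convex_onD[OF powr_convex[OF assms(4)] that, of u "u + x + y"] u assms by simp
    have ex: "(1 - c) * u + c * (u + x + y) = u + x" "(1 - (1 - c)) * u + (1 - c) * (u + x + y) = u + y"
      using c(3) by (simp_all add: algebra_simps)
    have "(u + x) powr p \<le> (1 - c) * u powr p + c * (u + x + y) powr p"
      using cvx[of c] c ex by simp
    moreover have "(u + y) powr p \<le> (1 - (1 - c)) * u powr p + (1 - c) * (u + x + y) powr p"
      using cvx[of "1 - c"] c unfolding ex(2) by simp
    ultimately show ?thesis by (simp add: algebra_simps)
  qed
qed

context prob_space
begin

lemma gaussian_rv_integrable: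
  assumes "gaussian_rv M Y"
  shows "integrable M Y" "integrable M (\<lambda>\<omega>. (Y \<omega>)\<^sup>2)"
proof -
  have meas[measurable]: "Y \<in> borel_measurable M" using assms by (simp add: gaussian_rv_def)
  consider \<mu> where "AE \<omega> in M. Y \<omega> = \<mu>" | \<mu> s where "s > 0" "distributed M lborel Y (normal_density \<mu> s)"
    using assms unfolding gaussian_rv_def by blast
  then have "integrable M Y \<and> integrable M (\<lambda>\<omega>. (Y \<omega>)\<^sup>2)"
  proof cases
    case 1
    have "integrable M Y" by (rule iffD2[OF integrable_cong_AE[of Y M "\<lambda>_. \<mu>"]]) (use 1 in auto)
    moreover have "integrable M (\<lambda>\<omega>. (Y \<omega>)\<^sup>2)"
      by (rule iffD2[OF integrable_cong_AE[of _ M "\<lambda>_. \<mu>\<^sup>2"]]) (use 1 in auto)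
    ultimately show ?thesis ..
  next
    case 2
    have "integrable M (\<lambda>\<omega>. (Y \<omega> - \<mu>) ^ k)" for k
      using integrable_normal_moment[OF 2(1), of \<mu> k]
        distributed_integrable[OF 2(2), of "\<lambda>x. (x - \<mu>) ^ k"] by simp
    from this[of 1] this[of 2] have m: "integrable M (\<lambda>\<omega>. Y \<omega> - \<mu>)" "integrable M (\<lambda>\<omega>. (Y \<omega> - \<mu>)\<^sup>2)"
      by simp_all
    have "integrable M (\<lambda>\<omega>. (Y \<omega> - \<mu>) + \<mu>)"
      by (intro Bochner_Integration.integrable_add m integrable_const)
    moreover have "integrable M (\<lambda>\<omega>. (Y \<omega> - \<mu>)\<^sup>2 + 2 * \<mu> * (Y \<omega> - \<mu>) + \<mu>\<^sup>2)"
      by (intro Bochner_Integration.integrable_add integrable_mult_right m integrable_const)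
    moreover have "(\<lambda>\<omega>. (Y \<omega> - \<mu>)\<^sup>2 + 2 * \<mu> * (Y \<omega> - \<mu>) + \<mu>\<^sup>2) = (\<lambda>\<omega>. (Y \<omega>)\<^sup>2)"
      by (simp add: power2_eq_square algebra_simps)
    ultimately show ?thesis by simp
  qed
  then show "integrable M Y" "integrable M (\<lambda>\<omega>. (Y \<omega>)\<^sup>2)" by auto
qed

text \<open>Multiplying a centered normal density of variance \<open>s\<^sup>2\<close> by
  \<open>exp (y\<^sup>2 / (4 * s\<^sup>2))\<close> gives \<open>sqrt 2\<close> times the density of
  variance \<open>2 * s\<^sup>2\<close>, so the integral is at most \<open>sqrt 2\<close>. In the
  degenerate case the zero mean forces \<open>Y\<close> to vanish almost everywhere.\<close>

lemma gaussian_exp_square: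
  assumes "gaussian_rv M Y" "expectation Y = 0" "expectation (\<lambda>\<omega>. (Y \<omega>)\<^sup>2) \<le> S\<^sup>2" "S > 0"
  shows "(\<integral>\<^sup>+\<omega>. ennreal (exp ((Y \<omega>)\<^sup>2 / (4 * S\<^sup>2))) \<partial>M) \<le> 2"
proof -
  consider \<mu> where "AE \<omega> in M. Y \<omega> = \<mu>" | \<mu> s where "s > 0" "distributed M lborel Y (normal_density \<mu> s)"
    using assms(1) unfolding gaussian_rv_def by blast
  then show ?thesis
  proof cases
    case 1
    have [measurable]: "Y \<in> borel_measurable M" using assms(1) by (simp add: gaussian_rv_def)
    have "expectation Y = expectation (\<lambda>_. \<mu>)" using 1 by (intro integral_cong_AE) auto
    then have "\<mu> = 0" using assms(2) by (simp add: prob_space)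
    then have "(\<integral>\<^sup>+\<omega>. ennreal (exp ((Y \<omega>)\<^sup>2 / (4 * S\<^sup>2))) \<partial>M) = (\<integral>\<^sup>+\<omega>. 1 \<partial>M)"
      using 1 by (intro nn_integral_cong_AE) auto
    then show ?thesis by (simp add: emeasure_space_1)
  next
    case 2
    have \<mu>: "\<mu> = 0" using normal_distributed_expectation[OF 2] assms(2) by simp
    have "s\<^sup>2 \<le> S\<^sup>2" using normal_distributed_variance[OF 2] assms(2,3) by simp
    have pt: "normal_density \<mu> s y * exp (y\<^sup>2 / (4 * S\<^sup>2)) \<le> sqrt 2 * normal_density 0 (s * sqrt 2) y" for y
    proof -
      have "y\<^sup>2 / (4 * S\<^sup>2) \<le> y\<^sup>2 / (4 * s\<^sup>2)"
        using \<open>s\<^sup>2 \<le> S\<^sup>2\<close> 2(1) assms(4) by (intro divide_left_mono) auto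
      then have "normal_density \<mu> s y * exp (y\<^sup>2 / (4 * S\<^sup>2)) \<le> normal_density \<mu> s y * exp (y\<^sup>2 / (4 * s\<^sup>2))"
        by (intro mult_left_mono) auto
      also have "\<dots> = 1 / sqrt (2 * pi * s\<^sup>2) * exp (- y\<^sup>2 / (2 * s\<^sup>2) + y\<^sup>2 / (4 * s\<^sup>2))"
        unfolding normal_density_def \<mu> by (simp add: exp_add[symmetric] del: exp_diff)
      also have "- y\<^sup>2 / (2 * s\<^sup>2) + y\<^sup>2 / (4 * s\<^sup>2) = - (y - 0)\<^sup>2 / (2 * (s * sqrt 2)\<^sup>2)"
        using 2(1) by (simp add: power_mult_distrib field_simps)
      also have "1 / sqrt (2 * pi * s\<^sup>2) = sqrt 2 * (1 / sqrt (2 * pi * (s * sqrt 2)\<^sup>2))"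
        using 2(1) by (simp add: power_mult_distrib real_sqrt_mult field_simps)
      finally show ?thesis unfolding normal_density_def by (simp only: mult.assoc)
    qed
    have "(\<integral>\<^sup>+\<omega>. ennreal (exp ((Y \<omega>)\<^sup>2 / (4 * S\<^sup>2))) \<partial>M)
        = (\<integral>\<^sup>+y. ennreal (normal_density \<mu> s y) * ennreal (exp (y\<^sup>2 / (4 * S\<^sup>2))) \<partial>lborel)"
      using distributed_nn_integral[OF 2(2), of "\<lambda>y. ennreal (exp (y\<^sup>2 / (4 * S\<^sup>2)))"] by simp
    also have "\<dots> \<le> (\<integral>\<^sup>+y. ennreal (sqrt 2) * ennreal (normal_density 0 (s * sqrt 2) y) \<partial>lborel)"
      using pt by (intro nn_integral_mono) (auto simp: ennreal_mult[symmetric] intro!: ennreal_leI)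
    also have "\<dots> = ennreal (sqrt 2) * (\<integral>\<^sup>+y. ennreal (normal_density 0 (s * sqrt 2) y) \<partial>lborel)"
      by (intro nn_integral_cmult) auto
    also have "(\<integral>\<^sup>+y. ennreal (normal_density 0 (s * sqrt 2) y) \<partial>lborel) = 1"
      using 2(1) by (subst nn_integral_eq_integral) (auto intro: integrable_normal_density)
    also have "ennreal (sqrt 2) * 1 \<le> 2"
      using real_sqrt_le_mono[of 2 4] by (simp add: ennreal_leI flip: ennreal_numeral)
    finally show ?thesis .
  qed
qed

end

text \<open>\<open>gaussian_process\<close> speaks of sums over sets of distinct times; here the
  times \<open>s j\<close> may coincide, so coefficients of equal times are collected first.\<close>

lemma gaussian_process_sum:
  assumes "gaussian_process M I B" "finite J" "\<And>j. j \<in> J \<Longrightarrow> s j \<in> I"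
  shows "gaussian_rv M (\<lambda>\<omega>. \<Sum>j\<in>J. c j * B (s j) \<omega>)"
proof -
  have "(\<Sum>j\<in>J. c j * B (s j) \<omega>) = (\<Sum>t\<in>s ` J. (\<Sum>j\<in>{j\<in>J. s j = t}. c j) * B t \<omega>)" for \<omega>
    unfolding sum.image_gen[OF assms(2), of "\<lambda>j. c j * B (s j) \<omega>" s]
    by (intro sum.cong) (auto simp: sum_distrib_right)
  moreover have "gaussian_rv M (\<lambda>\<omega>. \<Sum>t\<in>s ` J. (\<Sum>j\<in>{j\<in>J. s j = t}. c j) * B t \<omega>)"
  proof -
    have "finite (s ` J)" "s ` J \<subseteq> I" using assms(2,3) by auto
    then show ?thesis
      using assms(1)[unfolded gaussian_process_def, rule_format, of "s ` J" "\<lambda>t. \<Sum>j\<in>{j\<in>J. s j = t}. c j"] by simp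
  qed
  ultimately show ?thesis by (simp only:)
qed

locale fbm = prob_space +
  fixes T H :: real and B :: "real \<Rightarrow> 'a \<Rightarrow> real"
  assumes fBm: "fractional_brownian_motion M T H B" and T_pos: "T > 0" and H: "1 / 2 < H" "H < 1"
begin

lemma gaussian_B: "gaussian_process M {0..T} B"
  and continuous_B: "\<omega> \<in> space M \<Longrightarrow> continuous_on {0..T} (\<lambda>t. B t \<omega>)"
  and mean_B: "t \<in> {0..T} \<Longrightarrow> expectation (B t) = 0"
  and cov_B: "t \<in> {0..T} \<Longrightarrow> s \<in> {0..T} \<Longrightarrow> expectation (\<lambda>\<omega>. B t \<omega> * B s \<omega>) =
      1 / 2 * (t powr (2 * H) + s powr (2 * H) - \<bar>t - s\<bar> powr (2 * H))"
  using fBm unfolding fractional_brownian_motion_def by auto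

lemma gaussian_B_at: "t \<in> {0..T} \<Longrightarrow> gaussian_rv M (B t)"
  using gaussian_process_sum[OF gaussian_B, of "{t}" "\<lambda>x. x" "\<lambda>_. 1"] by simp

lemma measurable_B: "t \<in> {0..T} \<Longrightarrow> B t \<in> borel_measurable M"
  using gaussian_B_at by (auto simp: gaussian_rv_def)

lemma integrable_B: "t \<in> {0..T} \<Longrightarrow> integrable M (B t)"
  using gaussian_B_at gaussian_rv_integrable(1) by blast

lemma integrable_B_mult:
  assumes "t \<in> {0..T}" "s \<in> {0..T}"
  shows "integrable M (\<lambda>\<omega>. B t \<omega> * B s \<omega>)"
proof (rule Bochner_Integration.integrable_bound)
  show "integrable M (\<lambda>\<omega>. (B t \<omega>)\<^sup>2 + (B s \<omega>)\<^sup>2)"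
    using assms gaussian_B_at gaussian_rv_integrable(2) by (intro Bochner_Integration.integrable_add) auto
  show "(\<lambda>\<omega>. B t \<omega> * B s \<omega>) \<in> borel_measurable M" using assms measurable_B by simp
  have "\<bar>x * y\<bar> \<le> x\<^sup>2 + y\<^sup>2" for x y :: real
  proof -
    have "2 * \<bar>x * y\<bar> \<le> x\<^sup>2 + y\<^sup>2" using sum_squares_bound[of "\<bar>x\<bar>" "\<bar>y\<bar>"] by (simp add: abs_mult)
    then show ?thesis by linarith
  qed
  then show "AE \<omega> in M. norm (B t \<omega> * B s \<omega>) \<le> norm ((B t \<omega>)\<^sup>2 + (B s \<omega>)\<^sup>2)" by simp
qed

lemma increment_cov:
  assumes "p \<in> {0..T}" "q \<in> {0..T}" "r \<in> {0..T}" "s \<in> {0..T}"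
  shows "expectation (\<lambda>\<omega>. (B q \<omega> - B p \<omega>) * (B s \<omega> - B r \<omega>)) =
    1 / 2 * (\<bar>q - r\<bar> powr (2 * H) + \<bar>p - s\<bar> powr (2 * H) - \<bar>q - s\<bar> powr (2 * H) - \<bar>p - r\<bar> powr (2 * H))"
proof -
  have "expectation (\<lambda>\<omega>. (B q \<omega> - B p \<omega>) * (B s \<omega> - B r \<omega>)) =
    expectation (\<lambda>\<omega>. B q \<omega> * B s \<omega> - B q \<omega> * B r \<omega> - B p \<omega> * B s \<omega> + B p \<omega> * B r \<omega>)"
    by (simp add: algebra_simps)
  also have "\<dots> = expectation (\<lambda>\<omega>. B q \<omega> * B s \<omega>) - expectation (\<lambda>\<omega>. B q \<omega> * B r \<omega>)
      - expectation (\<lambda>\<omega>. B p \<omega> * B s \<omega>) + expectation (\<lambda>\<omega>. B p \<omega> * B r \<omega>)"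
    using assms integrable_B_mult by simp
  finally show ?thesis using assms by (simp add: cov_B field_simps)
qed

lemma increment_cov_nonneg:
  assumes "p \<in> {0..T}" "q \<in> {0..T}" "r \<in> {0..T}" "s \<in> {0..T}" "p \<le> q" "q \<le> r" "r \<le> s"
  shows "expectation (\<lambda>\<omega>. (B q \<omega> - B p \<omega>) * (B s \<omega> - B r \<omega>)) \<ge> 0"
proof -
  have "(r - q + (q - p)) powr (2 * H) + (r - q + (s - r)) powr (2 * H)
      \<le> (r - q + (q - p) + (s - r)) powr (2 * H) + (r - q) powr (2 * H)"
    using assms H by (intro powr_increment_mono) auto
  moreover have "\<bar>q - r\<bar> = r - q" "\<bar>p - s\<bar> = r - q + (q - p) + (s - r)" "\<bar>q - s\<bar> = r - q + (s - r)" "\<bar>p - r\<bar> = r - q + (q - p)"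
    using assms(5-7) by auto
  ultimately show ?thesis unfolding increment_cov[OF assms(1-4)] by simp
qed

text \<open>For \<open>H > 1 / 2\<close> increments over disjoint intervals are positively correlated, so weights of
  modulus at most one cannot increase the variance of a telescoping sum.\<close>

lemma weighted_increments:
  fixes t c :: "nat \<Rightarrow> real"
  assumes t: "\<And>k. k \<le> n \<Longrightarrow> t k \<in> {0..T}" and mono: "\<And>k. k < n \<Longrightarrow> t k \<le> t (Suc k)"
    and c: "\<And>k. k < n \<Longrightarrow> \<bar>c k\<bar> \<le> 1"
  defines "W \<equiv> \<lambda>\<omega>. \<Sum>k<n. c k * (B (t (Suc k)) \<omega> - B (t k) \<omega>)"
  shows "gaussian_rv M W" "expectation W = 0" "expectation (\<lambda>\<omega>. (W \<omega>)\<^sup>2) \<le> ((t n - t 0) powr H)\<^sup>2"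
proof -
  define D where "D k \<omega> = B (t (Suc k)) \<omega> - B (t k) \<omega>" for k \<omega>
  have tS: "t k \<in> {0..T}" "t (Suc k) \<in> {0..T}" if "k < n" for k
    using t[of k] t[of "Suc k"] that by auto
  \<comment> \<open>Each increment is written as two summands indexed by a boolean,
    \<open>True\<close> for the right end, so that the sum is a linear combination of values of
    \<open>B\<close>.\<close>
  have "gaussian_rv M (\<lambda>\<omega>. \<Sum>x\<in>{..<n} \<times> UNIV. (if snd x then c (fst x) else - c (fst x)) *
      B (if snd x then t (Suc (fst x)) else t (fst x)) \<omega>)"
    using tS by (intro gaussian_process_sum[OF gaussian_B]) auto
  also have "(\<lambda>\<omega>. \<Sum>x\<in>{..<n} \<times> UNIV. (if snd x then c (fst x) else - c (fst x)) *
      B (if snd x then t (Suc (fst x)) else t (fst x)) \<omega>) = (\<lambda>\<omega>. \<Sum>k<n. \<Sum>\<beta>\<in>UNIV. (if \<beta> then c k else - c k) *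
      B (if \<beta> then t (Suc k) else t k) \<omega>)"
    unfolding sum.cartesian_product by (simp add: split_def)
  also have "\<dots> = W" unfolding W_def by (simp add: UNIV_bool algebra_simps)
  finally show "gaussian_rv M W" .
  show "expectation W = 0"
    unfolding W_def using tS integrable_B mean_B
    by (subst Bochner_Integration.integral_sum) auto
  have int: "integrable M (\<lambda>\<omega>. D k \<omega> * D l \<omega>)" if "k < n" "l < n" for k l
    unfolding D_def left_diff_distrib right_diff_distrib using tS that integrable_B_mult by auto
  have tmono: "t k \<le> t l" if "k \<le> l" "l \<le> n" for k l
    using that
  proof (induction l)
    case (Suc l)
    then show ?case using mono[of l] by (cases "k = Suc l") auto
  qed simp
  have pos: "expectation (\<lambda>\<omega>. D k \<omega> * D l \<omega>) \<ge> 0" if kl: "k < n" "l < n" for k l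
  proof -
    have *: "expectation (\<lambda>\<omega>. D k \<omega> * D l \<omega>) \<ge> 0" if "k < l" "k < n" "l < n" for k l
      unfolding D_def using that tS tmono[of "Suc k" l] mono by (intro increment_cov_nonneg) auto
    show ?thesis
    proof (cases k l rule: linorder_cases)
      case equal
      then show ?thesis by simp
    next
      case greater
      then show ?thesis using *[of l k] kl by (simp add: mult.commute)
    qed (use * kl in auto)
  qed
  have sq: "(\<Sum>k<n. d k * D k \<omega>)\<^sup>2 = (\<Sum>k<n. \<Sum>l<n. d k * d l * (D k \<omega> * D l \<omega>))" for d :: "nat \<Rightarrow> real" and \<omega>
    by (simp add: power2_eq_square sum_product mult_ac)
  have E: "expectation (\<lambda>\<omega>. (\<Sum>k<n. d k * D k \<omega>)\<^sup>2) = (\<Sum>k<n. \<Sum>l<n. d k * d l * expectation (\<lambda>\<omega>. D k \<omega> * D l \<omega>))"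
    for d :: "nat \<Rightarrow> real"
    unfolding sq using int by (subst Bochner_Integration.integral_sum) (auto intro!: sum.cong Bochner_Integration.integral_sum)
  have "expectation (\<lambda>\<omega>. (W \<omega>)\<^sup>2) = (\<Sum>k<n. \<Sum>l<n. c k * c l * expectation (\<lambda>\<omega>. D k \<omega> * D l \<omega>))"
    using E[of c] unfolding W_def D_def .
  also have "\<dots> \<le> (\<Sum>k<n. \<Sum>l<n. 1 * 1 * expectation (\<lambda>\<omega>. D k \<omega> * D l \<omega>))"
  proof (intro sum_mono mult_right_mono)
    fix k l assume "k \<in> {..<n}" "l \<in> {..<n}"
    then have "\<bar>c k\<bar> * \<bar>c l\<bar> \<le> 1 * 1" using c by (intro mult_mono) auto
    then show "c k * c l \<le> 1 * 1" by (metis abs_le_D1 abs_mult)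
    show "0 \<le> expectation (\<lambda>\<omega>. D k \<omega> * D l \<omega>)" using \<open>k \<in> {..<n}\<close> \<open>l \<in> {..<n}\<close> pos by simp
  qed
  also have "\<dots> = expectation (\<lambda>\<omega>. (\<Sum>k<n. 1 * D k \<omega>)\<^sup>2)"
    using E[of "\<lambda>_. 1"] by simp
  also have "(\<lambda>\<omega>. (\<Sum>k<n. 1 * D k \<omega>)\<^sup>2) = (\<lambda>\<omega>. (B (t n) \<omega> - B (t 0) \<omega>) * (B (t n) \<omega> - B (t 0) \<omega>))"
  proof
    fix \<omega>
    show "(\<Sum>k<n. 1 * D k \<omega>)\<^sup>2 = (B (t n) \<omega> - B (t 0) \<omega>) * (B (t n) \<omega> - B (t 0) \<omega>)"
      using sum_lessThan_telescope[of "\<lambda>k. B (t k) \<omega>" n] unfolding D_def by (simp add: power2_eq_square)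
  qed
  also have "expectation \<dots> = ((t n - t 0) powr H)\<^sup>2"
    using t tmono[of 0 n] by (subst increment_cov) (auto simp: power2_eq_square powr_add[symmetric])
  finally show "expectation (\<lambda>\<omega>. (W \<omega>)\<^sup>2) \<le> ((t n - t 0) powr H)\<^sup>2" .
qed

lemma weighted_increments_exp_square:
  fixes t c :: "nat \<Rightarrow> real"
  assumes "\<And>k. k \<le> n \<Longrightarrow> t k \<in> {0..T}" "\<And>k. k < n \<Longrightarrow> t k \<le> t (Suc k)"
    "\<And>k. k < n \<Longrightarrow> \<bar>c k\<bar> \<le> 1" "t 0 < t n"
  shows "(\<integral>\<^sup>+\<omega>. ennreal (exp ((\<Sum>k<n. c k * (B (t (Suc k)) \<omega> - B (t k) \<omega>))\<^sup>2 / (4 * ((t n - t 0) powr H)\<^sup>2))) \<partial>M) \<le> 2"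
  using assms by (intro gaussian_exp_square weighted_increments) auto

end

text \<open>A weighted sum of the exponential moments controls all Gaussian variables of the family at
  once: a single summand of \<open>\<Theta>\<close> is at most \<open>\<Theta>\<close>.\<close>

lemma (in prob_space) exp_square_family_bound:
  fixes G :: "nat \<Rightarrow> nat \<Rightarrow> 'a \<Rightarrow> real" and s :: "nat \<Rightarrow> real" and n :: "nat \<Rightarrow> nat"
  assumes [measurable]: "\<And>i k. k < n i \<Longrightarrow> G i k \<in> borel_measurable M"
    and s: "\<And>i. s i > 0" and c: "c \<ge> 1" and n: "\<And>i. real (n i) \<le> c * 2 ^ i"
    and mom: "\<And>i k. k < n i \<Longrightarrow> (\<integral>\<^sup>+\<omega>. ennreal (exp ((G i k \<omega>)\<^sup>2 / (4 * (s i)\<^sup>2))) \<partial>M) \<le> 2"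
  shows "\<exists>\<Theta>\<in>borel_measurable M. (\<forall>\<omega>. \<Theta> \<omega> \<ge> (1 :: real)) \<and> (\<integral>\<^sup>+\<omega>. ennreal (\<Theta> \<omega>) \<partial>M) \<le> 3 \<and>
    (AE \<omega> in M. \<forall>i. \<forall>k<n i. \<bar>G i k \<omega>\<bar> \<le> 2 * s i * sqrt (ln (\<Theta> \<omega>) + ln c + real (i + 1) * ln 4))"
proof -
  define E where "E i k \<omega> = exp ((G i k \<omega>)\<^sup>2 / (4 * (s i)\<^sup>2))" for i k \<omega>
  \<comment> \<open>Level \<open>i\<close> has at most \<open>c * 2 ^ i\<close> members of
    expectation at most 2, so this weight makes it contribute at most
    \<open>(1 / 2) ^ Suc i\<close>, and all levels together at most 1. The terms
    \<open>ln c + real (i + 1) * ln 4\<close> of the bound are \<open>- ln (w i)\<close>.\<close>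
  define w where "w i = 1 / (c * 4 ^ (i + 1))" for i :: nat
  have w: "w i > 0" for i using c by (simp add: w_def)
  have E_meas[measurable]: "k < n i \<Longrightarrow> E i k \<in> borel_measurable M" for i k
    unfolding E_def by measurable
  define S where "S \<omega> = (\<Sum>i. \<Sum>k<n i. ennreal (w i) * ennreal (E i k \<omega>))" for \<omega>
  have inner_meas: "(\<lambda>\<omega>. \<Sum>k<n i. ennreal (w i) * ennreal (E i k \<omega>)) \<in> borel_measurable M" for i
    by (intro borel_measurable_sum borel_measurable_times_ennreal borel_measurable_const measurable_compose[OF _ measurable_ennreal] E_meas) auto
  have S_meas[measurable]: "S \<in> borel_measurable M"
    unfolding S_def by (intro borel_measurable_suminf_order inner_meas)
  have "(\<integral>\<^sup>+\<omega>. S \<omega> \<partial>M) = (\<Sum>i. \<integral>\<^sup>+\<omega>. (\<Sum>k<n i. ennreal (w i) * ennreal (E i k \<omega>)) \<partial>M)"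
    unfolding S_def by (intro nn_integral_suminf inner_meas)
  also have "\<dots> \<le> (\<Sum>i. ennreal ((1 / 2) ^ Suc i))"
  proof (rule suminf_le)
    fix i
    have "(\<integral>\<^sup>+\<omega>. (\<Sum>k<n i. ennreal (w i) * ennreal (E i k \<omega>)) \<partial>M) = (\<Sum>k<n i. \<integral>\<^sup>+\<omega>. ennreal (w i) * ennreal (E i k \<omega>) \<partial>M)"
      by (intro nn_integral_sum borel_measurable_times_ennreal borel_measurable_const measurable_compose[OF _ measurable_ennreal] E_meas) auto
    also have "\<dots> = (\<Sum>k<n i. ennreal (w i) * (\<integral>\<^sup>+\<omega>. ennreal (E i k \<omega>) \<partial>M))"
      by (intro sum.cong nn_integral_cmult measurable_compose[OF _ measurable_ennreal] E_meas) auto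
    also have "\<dots> \<le> (\<Sum>k<n i. ennreal (w i) * ennreal 2)"
      using mom by (intro sum_mono mult_left_mono) (auto simp: E_def)
    also have "\<dots> = ennreal (real (n i) * (w i * 2))"
      using w[of i] by (simp add: ennreal_mult'[symmetric] ennreal_of_nat_eq_real_of_nat del: ennreal_numeral)
    also have "\<dots> \<le> ennreal (c * 2 ^ i * (w i * 2))"
      using n[of i] w[of i] by (intro ennreal_leI mult_right_mono) auto
    also have "c * 2 ^ i * (w i * 2) = (1 / 2) ^ Suc i"
    proof -
      have "(4::real) ^ (i + 1) = 2 ^ (i + 1) * 2 ^ (i + 1)" by (simp flip: power_mult_distrib)
      then show ?thesis using c by (simp add: w_def power_one_over field_simps)
    qed
    finally show "(\<integral>\<^sup>+\<omega>. (\<Sum>k<n i. ennreal (w i) * ennreal (E i k \<omega>)) \<partial>M) \<le> ennreal ((1 / 2) ^ Suc i)" .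
  qed auto
  also have "\<dots> = ennreal 1"
    using power_half_series by (intro suminf_ennreal_eq) auto
  finally have S1: "(\<integral>\<^sup>+\<omega>. S \<omega> \<partial>M) \<le> 1" by simp
  then have fin: "AE \<omega> in M. S \<omega> \<noteq> \<infinity>"
    by (intro nn_integral_noteq_infinite) (auto simp: top_unique)
  \<comment> \<open>Adding 1 makes \<open>ln (\<Theta> \<omega>)\<close> nonnegative. Where
    \<open>S\<close> is infinite, \<open>enn2real\<close> returns 0 and the bound may fail; this
    happens only on a null set.\<close>
  define \<Theta> where "\<Theta> \<omega> = 1 + enn2real (S \<omega>)" for \<omega>
  have "\<Theta> \<in> borel_measurable M" unfolding \<Theta>_def by measurable
  moreover have \<Theta>1: "\<Theta> \<omega> \<ge> 1" for \<omega> by (simp add: \<Theta>_def)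
  moreover have "(\<integral>\<^sup>+\<omega>. ennreal (\<Theta> \<omega>) \<partial>M) \<le> 3"
  proof -
    have "ennreal (enn2real x) \<le> x" for x by (cases x) auto
    then have "(\<integral>\<^sup>+\<omega>. ennreal (\<Theta> \<omega>) \<partial>M) \<le> (\<integral>\<^sup>+\<omega>. 1 + S \<omega> \<partial>M)"
      unfolding \<Theta>_def by (intro nn_integral_mono) (auto simp: ennreal_plus intro: add_mono)
    also have "\<dots> = 1 + (\<integral>\<^sup>+\<omega>. S \<omega> \<partial>M)"
      by (subst nn_integral_add) (auto simp: emeasure_space_1)
    also have "\<dots> \<le> 1 + 1" by (intro add_left_mono S1)
    also have "\<dots> \<le> 3" by (simp flip: ennreal_numeral ennreal_1 ennreal_plus)
    finally show ?thesis .
  qed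
  moreover have "AE \<omega> in M. \<forall>i. \<forall>k<n i. \<bar>G i k \<omega>\<bar> \<le> 2 * s i * sqrt (ln (\<Theta> \<omega>) + ln c + real (i + 1) * ln 4)"
    using fin
  proof eventually_elim
    case (elim \<omega>)
    show ?case
    proof (intro allI impI)
      fix i k assume k: "k < n i"
      have "ennreal (w i) * ennreal (E i k \<omega>) \<le> (\<Sum>k<n i. ennreal (w i) * ennreal (E i k \<omega>))"
        using k by (intro member_le_sum) auto
      also have "\<dots> \<le> S \<omega>" unfolding S_def
        using sum_le_suminf[of "\<lambda>i. \<Sum>k<n i. ennreal (w i) * ennreal (E i k \<omega>)" "{i}"] by simp
      also have "S \<omega> = ennreal (enn2real (S \<omega>))" using elim by (cases "S \<omega>") auto
      finally have "w i * E i k \<omega> \<le> enn2real (S \<omega>)"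
        using w[of i] by (simp add: ennreal_mult'[symmetric] E_def)
      then have "w i * E i k \<omega> \<le> \<Theta> \<omega>" by (simp add: \<Theta>_def)
      then have "E i k \<omega> \<le> \<Theta> \<omega> * (c * 4 ^ (i + 1))" using c unfolding w_def by (simp add: field_simps)
      then have "ln (E i k \<omega>) \<le> ln (\<Theta> \<omega> * (c * 4 ^ (i + 1)))"
        using \<Theta>1[of \<omega>] c by (subst ln_le_cancel_iff) (auto simp: E_def intro!: mult_pos_pos)
      also have "\<dots> = ln (\<Theta> \<omega>) + ln c + real (i + 1) * ln 4"
        using \<Theta>1[of \<omega>] c by (simp add: ln_mult ln_realpow algebra_simps)
      finally have "(G i k \<omega>)\<^sup>2 \<le> (2 * s i)\<^sup>2 * (ln (\<Theta> \<omega>) + ln c + real (i + 1) * ln 4)"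
        unfolding E_def using s[of i] by (simp add: field_simps power_mult_distrib)
      then have "sqrt ((G i k \<omega>)\<^sup>2) \<le> sqrt ((2 * s i)\<^sup>2 * (ln (\<Theta> \<omega>) + ln c + real (i + 1) * ln 4))"
        by (rule real_sqrt_le_mono)
      then show "\<bar>G i k \<omega>\<bar> \<le> 2 * s i * sqrt (ln (\<Theta> \<omega>) + ln c + real (i + 1) * ln 4)"
        using s[of i] by (simp add: real_sqrt_mult)
    qed
  qed
  ultimately show ?thesis by (intro bexI[of _ \<Theta>] conjI) auto
qed

text \<open>The square root is retained only for \<open>ln c\<close>: with \<open>c = N\<close> it
  becomes the factor \<open>sqrt (ln (T / h))\<close> of the second estimate. Losses in
  \<open>y\<close> are harmless because all moments are finite, and those in \<open>i\<close>
  because they meet a geometric factor.\<close>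

lemma sqrt_log_bound:
  assumes "y \<ge> 0" "c \<ge> 1"
  shows "sqrt (y + ln c + real (i + 1) * ln 4) \<le> (1 + sqrt (ln c)) * ((2 + y) * (2 * real i + 3))"
proof -
  have l4: "ln 4 \<le> (2 :: real)"
  proof -
    have "ln 4 = 2 * ln (2::real)" using ln_realpow[of 2 2] by simp
    then show ?thesis using ln_le_minus_one[of "2::real"] by simp
  qed
  have q: "sqrt z \<le> z + 1" if "z \<ge> 0" for z :: real
    by (rule real_le_lsqrt) (use that in \<open>auto simp: power2_eq_square algebra_simps\<close>)
  define z where "z = y + real (i + 1) * ln 4"
  have z0: "z \<ge> 0" using assms by (simp add: z_def)
  have "real (i + 1) * ln 4 \<le> real (i + 1) * 2" using l4 by (intro mult_left_mono) auto
  then have "z + 1 \<le> y + 2 * real i + 3" by (simp add: z_def)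
  also have "\<dots> \<le> (2 + y) * (2 * real i + 3)" using assms by (simp add: algebra_simps)
  finally have zb: "sqrt z \<le> (2 + y) * (2 * real i + 3)" using q[OF z0] by linarith
  have one: "1 \<le> (2 + y) * (2 * real i + 3)"
  proof -
    have "1 * 1 \<le> (2 + y) * (2 * real i + 3)" using assms by (intro mult_mono) auto
    then show ?thesis by simp
  qed
  have "sqrt (y + ln c + real (i + 1) * ln 4) \<le> sqrt (ln c) + sqrt z"
    using sqrt_add_le_add_sqrt[of "ln c" z] assms z0 by (simp add: z_def algebra_simps)
  also have "\<dots> \<le> sqrt (ln c) * ((2 + y) * (2 * real i + 3)) + (2 + y) * (2 * real i + 3)"
    using zb mult_left_mono[OF one, of "sqrt (ln c)"] assms by simp
  finally show ?thesis by (simp add: algebra_simps)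
qed

lemma poly_geometric_bound:
  assumes "0 < q" "q < (1::real)"
  shows "\<exists>C>0. \<forall>i::nat. (2 * real i + 3) * q ^ i \<le> C"
proof -
  have "(\<lambda>i. real i * q ^ i) \<longlonglongrightarrow> 0" by (rule powser_times_n_limit_0) (use assms in auto)
  moreover have "(\<lambda>i. q ^ i) \<longlonglongrightarrow> 0" by (rule LIMSEQ_power_zero) (use assms in auto)
  ultimately have "(\<lambda>i. 2 * (real i * q ^ i) + 3 * q ^ i) \<longlonglongrightarrow> 2 * 0 + 3 * 0"
    by (intro tendsto_add tendsto_mult_left)
  then have "Bseq (\<lambda>i. 2 * (real i * q ^ i) + 3 * q ^ i)" by (intro convergent_imp_Bseq convergentI)
  then obtain C where "C > 0" "\<And>i. norm (2 * (real i * q ^ i) + 3 * q ^ i) \<le> C" by (auto elim: BseqE)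
  then have "(2 * real i + 3) * q ^ i \<le> C" for i :: nat
    using abs_le_D1[of _ C] by (simp add: algebra_simps)
  then show ?thesis using \<open>C > 0\<close> by blast
qed

context fbm
begin

text \<open>Level \<open>i\<close> has \<open>N * 2 ^ i\<close> increments of standard deviation
  \<open>(h / 2 ^ i) powr H\<close>. The lemma is used twice: with \<open>N = 1\<close>, where the
  logarithm vanishes, for the Hoelder constant on \<open>{0..T}\<close>, and with the actual
  \<open>N\<close> for the oscillation inside the steps.\<close>

lemma dyadic_increments:
  assumes N: "N \<ge> 1" "h = T / real N"
  shows "\<exists>\<Theta>\<in>borel_measurable M. (\<forall>\<omega>. \<Theta> \<omega> \<ge> (1 :: real)) \<and> (\<integral>\<^sup>+\<omega>. ennreal (\<Theta> \<omega>) \<partial>M) \<le> 3 \<and>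
    (AE \<omega> in M. \<forall>i. \<forall>k<N * 2 ^ i. \<bar>B (real (Suc k) * h / 2 ^ i) \<omega> - B (real k * h / 2 ^ i) \<omega>\<bar>
       \<le> 2 * (h / 2 ^ i) powr H * ((1 + sqrt (ln (real N))) * ((2 + ln (\<Theta> \<omega>)) * (2 * real i + 3))))"
proof -
  have h: "h > 0" "real N * h = T" using N T_pos by auto
  define G where "G i k \<omega> = B (real (Suc k) * h / 2 ^ i) \<omega> - B (real k * h / 2 ^ i) \<omega>" for i k \<omega>
  have times: "real k * h / 2 ^ i \<in> {0..T}" if "k \<le> N * 2 ^ i" for i k
  proof -
    have "real k \<le> real (N * 2 ^ i)" using that by (simp only: of_nat_le_iff)
    then have "real k * h \<le> real N * 2 ^ i * h" using h by (intro mult_right_mono) auto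
    also have "real N * 2 ^ i * h = T * 2 ^ i" unfolding h(2)[symmetric] by simp
    finally have "real k * h \<le> T * 2 ^ i" .
    then show ?thesis using h by (simp add: pos_divide_le_eq)
  qed
  have "\<exists>\<Theta>\<in>borel_measurable M. (\<forall>\<omega>. \<Theta> \<omega> \<ge> (1 :: real)) \<and> (\<integral>\<^sup>+\<omega>. ennreal (\<Theta> \<omega>) \<partial>M) \<le> 3 \<and>
    (AE \<omega> in M. \<forall>i. \<forall>k<N * 2 ^ i. \<bar>G i k \<omega>\<bar> \<le>
       2 * (h / 2 ^ i) powr H * sqrt (ln (\<Theta> \<omega>) + ln (real N) + real (i + 1) * ln 4))"
  proof (rule exp_square_family_bound)
    fix i k :: nat assume k: "k < N * 2 ^ i"
    then show "G i k \<in> borel_measurable M"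
      unfolding G_def using times[of k i] times[of "Suc k" i]
      by (intro borel_measurable_diff measurable_B) auto
    define t where "t j = real (k + j) * h / 2 ^ i" for j
    have "(\<integral>\<^sup>+\<omega>. ennreal (exp ((\<Sum>j<1. 1 * (B (t (Suc j)) \<omega> - B (t j) \<omega>))\<^sup>2 / (4 * ((t 1 - t 0) powr H)\<^sup>2))) \<partial>M) \<le> 2"
    proof (rule weighted_increments_exp_square)
      show "t j \<in> {0..T}" if "j \<le> 1" for j unfolding t_def using k that by (intro times) auto
      show "t j \<le> t (Suc j)" for j unfolding t_def using h by (intro divide_right_mono mult_right_mono) auto
      show "t 0 < t 1" unfolding t_def using h by (intro divide_strict_right_mono mult_strict_right_mono) auto
    qed simp
    moreover have "t 1 - t 0 = h / 2 ^ i" by (simp add: t_def field_simps)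
    moreover have "t 0 = real k * h / 2 ^ i" "t 1 = real (Suc k) * h / 2 ^ i" by (simp_all add: t_def)
    ultimately show "(\<integral>\<^sup>+\<omega>. ennreal (exp ((G i k \<omega>)\<^sup>2 / (4 * ((h / 2 ^ i) powr H)\<^sup>2))) \<partial>M) \<le> 2"
      unfolding G_def by simp
  qed (use h N in auto)
  then obtain \<Theta> where \<Theta>: "\<Theta> \<in> borel_measurable M" "\<And>\<omega>. \<Theta> \<omega> \<ge> (1 :: real)" "(\<integral>\<^sup>+\<omega>. ennreal (\<Theta> \<omega>) \<partial>M) \<le> 3"
    "AE \<omega> in M. \<forall>i. \<forall>k<N * 2 ^ i. \<bar>G i k \<omega>\<bar> \<le>
       2 * (h / 2 ^ i) powr H * sqrt (ln (\<Theta> \<omega>) + ln (real N) + real (i + 1) * ln 4)" by blast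
  have "AE \<omega> in M. \<forall>i. \<forall>k<N * 2 ^ i. \<bar>G i k \<omega>\<bar>
       \<le> 2 * (h / 2 ^ i) powr H * ((1 + sqrt (ln (real N))) * ((2 + ln (\<Theta> \<omega>)) * (2 * real i + 3)))"
    using \<Theta>(4)
  proof eventually_elim
    case (elim \<omega>)
    have "2 * (h / 2 ^ i) powr H * sqrt (ln (\<Theta> \<omega>) + ln (real N) + real (i + 1) * ln 4)
      \<le> 2 * (h / 2 ^ i) powr H * ((1 + sqrt (ln (real N))) * ((2 + ln (\<Theta> \<omega>)) * (2 * real i + 3)))" for i :: nat
      using \<Theta>(2)[of \<omega>] N by (intro mult_left_mono sqrt_log_bound) auto
    then show ?case using elim order.trans by blast
  qed
  then show ?thesis using \<Theta>(1-3) unfolding G_def by (intro bexI[of _ \<Theta>] conjI) auto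
qed

text \<open>The decay with exponent \<open>H\<close> is split: the share \<open>H - \<delta>\<close>
  pays for the polynomial factor, and the share \<open>\<delta>\<close> is left for the
  chaining.\<close>

lemma increments_geometric:
  assumes "\<delta> < H" and C0: "\<And>i. (2 * real i + 3) * (2 powr (- (H - \<delta>))) ^ i \<le> C0" and "h > 0" "R \<ge> 0"
    and "x \<le> 2 * (h / 2 ^ i) powr H * (R * (2 * real i + 3))"
  shows "x \<le> 2 * h powr H * R * C0 * (2 powr (- \<delta>)) ^ i"
proof -
  have "(h / 2 ^ i) powr H = h powr H * (2 powr (- (H - \<delta>))) ^ i * (2 powr (- \<delta>)) ^ i"
  proof -
    have "(2 powr (- (H - \<delta>))) ^ i * (2 powr (- \<delta>)) ^ i = (2 powr (- H)) ^ i"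
      by (simp flip: power_mult_distrib powr_add)
    also have "\<dots> = (1 / 2 ^ i) powr H"
      by (simp add: powr_minus_divide powr_divide power_divide powr_power_swap)
    finally show ?thesis using assms(3) by (simp add: powr_divide divide_inverse powr_mult mult.assoc)
  qed
  then have "2 * (h / 2 ^ i) powr H * (R * (2 * real i + 3))
      = 2 * h powr H * R * (2 powr (- \<delta>)) ^ i * ((2 * real i + 3) * (2 powr (- (H - \<delta>))) ^ i)"
    by (simp add: mult_ac)
  also have "\<dots> \<le> 2 * h powr H * R * (2 powr (- \<delta>)) ^ i * C0"
    using assms(4) by (intro mult_left_mono C0) auto
  finally show ?thesis using assms(5) by (simp add: mult_ac)
qed

lemma path_holder:
  assumes a: "1 / 2 < a" "a < H" and C0: "\<And>i. (2 * real i + 3) * (2 powr (- (H - a))) ^ i \<le> C0"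
    and \<omega>: "\<omega> \<in> space M" and R: "R \<ge> 0"
    and incr: "\<And>i k. k < 2 ^ i \<Longrightarrow> \<bar>B (real (Suc k) * T / 2 ^ i) \<omega> - B (real k * T / 2 ^ i) \<omega>\<bar>
       \<le> 2 * (T / 2 ^ i) powr H * (R * (2 * real i + 3))"
    and st: "s \<in> {0..T}" "t \<in> {0..T}"
  shows "\<bar>B s \<omega> - B t \<omega>\<bar> \<le> 8 * T powr (H - a) * C0 / (1 - 2 powr (- a)) * R * \<bar>s - t\<bar> powr a"
proof -
  define \<phi> where "\<phi> x = B (x * T) \<omega>" for x
  have C0_nonneg: "C0 \<ge> 0" using C0[of 0] by simp
  have K: "2 * T powr H * R * C0 \<ge> 0" using R C0_nonneg by simp
  have *: "\<bar>\<phi> (s / T) - \<phi> (t / T)\<bar> \<le> 4 * (2 * T powr H * R * C0) / (1 - 2 powr (- a)) * \<bar>s / T - t / T\<bar> powr a"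
  proof (rule dyadic_chain_holder)
    show "continuous_on {0..1} \<phi>" unfolding \<phi>_def
      using T_pos by (intro continuous_on_compose2[OF continuous_B[OF \<omega>]] continuous_intros)
        (auto intro: mult_left_le_one_le)
    show "\<bar>\<phi> (real (Suc j) / 2 ^ i) - \<phi> (real j / 2 ^ i)\<bar> \<le> 2 * T powr H * R * C0 * (2 powr (- a)) ^ i"
      if "j < 2 ^ i" for i j
      using increments_geometric[OF a(2) C0 T_pos R incr[OF that]] by (simp add: \<phi>_def)
  qed (use a H K st T_pos in auto)
  have "\<bar>s / T - t / T\<bar> powr a = \<bar>s - t\<bar> powr a / T powr a"
    using T_pos by (simp add: powr_divide flip: diff_divide_distrib)
  moreover have "T powr H = T powr (H - a) * T powr a" by (simp flip: powr_add)
  ultimately have "T powr H * \<bar>s / T - t / T\<bar> powr a = T powr (H - a) * \<bar>s - t\<bar> powr a"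
    using T_pos by simp
  moreover have "4 * (2 * T powr H * R * C0) / (1 - 2 powr (- a)) * \<bar>s / T - t / T\<bar> powr a
    = 8 * C0 / (1 - 2 powr (- a)) * R * (T powr H * \<bar>s / T - t / T\<bar> powr a)" by simp
  ultimately have eq: "4 * (2 * T powr H * R * C0) / (1 - 2 powr (- a)) * \<bar>s / T - t / T\<bar> powr a
    = 8 * T powr (H - a) * C0 / (1 - 2 powr (- a)) * R * \<bar>s - t\<bar> powr a" by simp
  have "\<phi> (s / T) = B s \<omega>" "\<phi> (t / T) = B t \<omega>" using T_pos by (auto simp: \<phi>_def)
  then show ?thesis using * unfolding eq by simp
qed

text \<open>Chaining is carried out inside a single step, so the full rate \<open>h powr H\<close>
  stands in front. The exponent \<open>H / 2\<close> governs only convergence over the finer levels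
  and affects the constant alone.\<close>

lemma path_modulus:
  assumes N: "N \<ge> 1" "h = T / real N"
    and C0: "\<And>i. (2 * real i + 3) * (2 powr (- (H - H / 2))) ^ i \<le> C0"
    and \<omega>: "\<omega> \<in> space M" and R: "R \<ge> 0"
    and incr: "\<And>i k. k < N * 2 ^ i \<Longrightarrow> \<bar>B (real (Suc k) * h / 2 ^ i) \<omega> - B (real k * h / 2 ^ i) \<omega>\<bar>
       \<le> 2 * (h / 2 ^ i) powr H * (R * (2 * real i + 3))"
    and n: "n < N" and t: "t \<in> {real n * h..real n * h + h}"
  shows "\<bar>B t \<omega> - B (real n * h) \<omega>\<bar> \<le> 2 * C0 / (1 - 2 powr (- (H / 2))) * R * h powr H"
proof -
  have h: "h > 0" "real N * h = T" using N T_pos by auto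
  define \<phi> where "\<phi> x = B (real n * h + x * h) \<omega>" for x
  have C0_nonneg: "C0 \<ge> 0" using C0[of 0] by simp
  have "real (Suc n) * h \<le> real N * h" using n h by (intro mult_right_mono) auto
  then have nT: "real n * h + h \<le> T" using h by (simp add: algebra_simps)
  have "2 powr (- (H / 2)) < (1 :: real)" using H by (simp add: powr_minus divide_simps)
  have "\<bar>\<phi> ((t - real n * h) / h) - \<phi> 0\<bar> \<le> (2 * h powr H * R * C0) / (1 - 2 powr (- (H / 2)))"
  proof (rule dyadic_chain_bound)
    show "continuous_on {0..1} \<phi>" unfolding \<phi>_def
    proof (intro continuous_on_compose2[OF continuous_B[OF \<omega>]] continuous_intros)
      show "(\<lambda>x. real n * h + x * h) ` {0..1} \<subseteq> {0..T}"
      proof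
        fix y assume "y \<in> (\<lambda>x. real n * h + x * h) ` {0..1}"
        then obtain x where "x \<in> {0..1}" and x: "y = real n * h + x * h" by (elim imageE)
        then have "0 \<le> x" "x \<le> 1" by auto
        note x = x this
        have "x * h \<le> 1 * h" using x h by (intro mult_right_mono) auto
        then have "y \<le> T" using x(1) nT by linarith
        moreover have "0 \<le> y" using x h(1) by simp
        ultimately show "y \<in> {0..T}" by simp
      qed
    qed
    show "\<bar>\<phi> (real (Suc j) / 2 ^ i) - \<phi> (real j / 2 ^ i)\<bar> \<le> 2 * h powr H * R * C0 * (2 powr (- (H / 2))) ^ i"
      if j: "j < 2 ^ i" for i j
    proof -
      have "n * 2 ^ i + j < Suc n * 2 ^ i" using j by simp
      also have "\<dots> \<le> N * 2 ^ i" using n by (intro mult_right_mono) auto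
      finally have k: "n * 2 ^ i + j < N * 2 ^ i" .
      have e: "real n * h + real l / 2 ^ i * h = real (n * 2 ^ i + l) * h / 2 ^ i" for l
        by (simp add: field_simps)
      have "H / 2 < H" using H by simp
      from increments_geometric[OF this C0 h(1) R incr[OF k]] show ?thesis
        unfolding \<phi>_def e by simp
    qed
    show "0 \<le> 2 * h powr H * R * C0" using R C0_nonneg by simp
  qed (use t h \<open>2 powr (- (H / 2)) < (1 :: real)\<close> in \<open>auto simp: field_simps\<close>)
  moreover have "\<phi> ((t - real n * h) / h) = B t \<omega>" "\<phi> 0 = B (real n * h) \<omega>" using h by (auto simp: \<phi>_def)
  ultimately show ?thesis by (simp add: mult_ac)
qed

end

section \<open>Gaussian bounds for sums of integrated noise\<close>

lemma riemann_left_sum: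
  fixes f :: "real \<Rightarrow> real"
  assumes cont: "continuous_on {u..u + h} f" and h: "h > 0"
  shows "(\<lambda>M. h / real (Suc M) * (\<Sum>i<Suc M. f (u + real i * h / real (Suc M)))) \<longlonglongrightarrow> integral {u..u + h} f"
proof (rule LIMSEQ_I)
  fix e :: real assume e: "e > 0"
  have "uniformly_continuous_on {u..u + h} f" by (intro compact_uniformly_continuous cont) simp
  moreover have "e / (2 * h) > 0" using e h by simp
  ultimately obtain d where d: "d > 0"
    "\<And>x y. x \<in> {u..u + h} \<Longrightarrow> y \<in> {u..u + h} \<Longrightarrow> \<bar>y - x\<bar> < d \<Longrightarrow> \<bar>f y - f x\<bar> < e / (2 * h)"
    unfolding uniformly_continuous_on_def dist_real_def by metis
  obtain M0 :: nat where M0: "h / d < real M0" using reals_Archimedean2 by blast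
  show "\<exists>M0. \<forall>M\<ge>M0. norm (h / real (Suc M) * (\<Sum>i<Suc M. f (u + real i * h / real (Suc M))) - integral {u..u + h} f) < e"
  proof (intro exI[of _ M0] allI impI)
    fix M assume "M \<ge> M0"
    define n where "n = Suc M"
    define t where "t i = u + real i * h / real n" for i
    have n: "real n > h / d" "n > 0" using M0 \<open>M \<ge> M0\<close> by (auto simp: n_def)
    have mesh: "h / real n < d" using n d h by (simp add: field_simps)
    have step: "t (Suc i) = t i + h / real n" for i
      by (simp add: t_def algebra_simps add_divide_distrib)
    have hn: "h / real n > 0" using h n by simp
    have ends: "t 0 = u" "t n = u + h" using n by (auto simp: t_def)
    have range: "t i \<in> {u..u + h}" if "i \<le> n" for i
      using that h n by (auto simp: t_def field_simps intro: mult_left_mono)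
    have sub: "{t i..t (Suc i)} \<subseteq> {u..u + h}" if "i < n" for i
      using range[of i] range[of "Suc i"] that by auto
    have int: "f integrable_on {p..q}" if "{p..q} \<subseteq> {u..u + h}" for p q
      using that cont by (intro integrable_continuous_real) (rule continuous_on_subset)
    have comb: "(\<Sum>i<k. integral {t i..t (Suc i)} f) = integral {u..t k} f" if "k \<le> n" for k
      using that
    proof (induction k)
      case (Suc k)
      have "integral {u..t k} f + integral {t k..t (Suc k)} f = integral {u..t (Suc k)} f"
        using range[of k] range[of "Suc k"] Suc.prems step[of k] hn
        by (intro Henstock_Kurzweil_Integration.integral_combine int) auto
      then show ?case using Suc by simp
    qed (simp add: ends)
    have piece: "\<bar>h / real n * f (t i) - integral {t i..t (Suc i)} f\<bar> \<le> e / (2 * h) * (h / real n)" if i: "i < n" for i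
    proof -
      have "norm (integral {t i..t (Suc i)} (\<lambda>s. f (t i) - f s)) \<le> e / (2 * h) * (t (Suc i) - t i)"
      proof (rule integral_bound)
        show "t i \<le> t (Suc i)" using step hn by simp
        show "continuous_on {t i..t (Suc i)} (\<lambda>s. f (t i) - f s)"
          using cont sub[OF i] by (intro continuous_intros) (rule continuous_on_subset)
        show "norm (f (t i) - f s) \<le> e / (2 * h)" if s: "s \<in> {t i..t (Suc i)}" for s
        proof -
          have "\<bar>f (t i) - f s\<bar> < e / (2 * h)"
            using s sub[OF i] range[of i] i step[of i] mesh hn by (intro d(2)) auto
          then show ?thesis by simp
        qed
      qed
      moreover have "integral {t i..t (Suc i)} (\<lambda>s. f (t i) - f s) = integral {t i..t (Suc i)} (\<lambda>s. f (t i)) - integral {t i..t (Suc i)} f"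
        by (intro integral_diff int sub i integrable_const_ivl)
      moreover have "integral {t i..t (Suc i)} (\<lambda>s. f (t i)) = h / real n * f (t i)"
        using step[of i] hn by simp
      ultimately show ?thesis using step[of i] by simp
    qed
    have "h / real n * (\<Sum>i<n. f (t i)) - integral {u..u + h} f = (\<Sum>i<n. h / real n * f (t i) - integral {t i..t (Suc i)} f)"
      using comb[of n] ends by (simp only: sum_subtractf sum_distrib_left order_refl)
    also have "\<bar>\<dots>\<bar> \<le> (\<Sum>i<n. e / (2 * h) * (h / real n))"
      using piece by (intro order.trans[OF sum_abs] sum_mono) auto
    also have "\<dots> = e / 2" using n h by simp
    also have "\<dots> < e" using e by simp
    finally show "norm (h / real (Suc M) * (\<Sum>i<Suc M. f (u + real i * h / real (Suc M))) - integral {u..u + h} f) < e"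
      unfolding t_def n_def real_norm_def .
  qed
qed

text \<open>The increment from \<open>i\<close> to \<open>Suc i\<close> is counted once for every
  start at most \<open>i\<close>. After division by \<open>M\<close> the weights have modulus at
  most one, as \<open>weighted_increments\<close> requires.\<close>

lemma summation_by_parts_weights:
  fixes f :: "nat \<Rightarrow> real"
  shows "(\<Sum>i<M. f i - f M) = - (\<Sum>i<M. real (Suc i) * (f (Suc i) - f i))"
proof (induction M)
  case (Suc M)
  have "(\<Sum>i<Suc M. f i - f (Suc M)) = (\<Sum>i<M. f i - f M) + real (Suc M) * (f M - f (Suc M))"
    by (simp add: sum_subtractf algebra_simps)
  then show ?case using Suc by (simp add: algebra_simps)
qed simp

context fbm
begin

text \<open>\<open>G\<close> is a pathwise limit of Riemann sums \<open>W m\<close>. Summation by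
  parts turns each \<open>W m\<close> into \<open>h\<close> times a sum of consecutive increments
  with weights of modulus at most one, so its standard deviation is at most
  \<open>h * (real cnt * h) powr H\<close>, uniformly in \<open>m\<close>.\<close>

lemma block_sum_exp_square:
  fixes cnt :: nat
  assumes "h > 0" "u \<ge> 0" "u + real cnt * h \<le> T" "cnt \<ge> 1"
  defines "G \<equiv> \<lambda>\<omega>. \<Sum>n<cnt. integral {u + real n * h..u + real n * h + h} (\<lambda>s. B s \<omega> - B (u + real n * h + h) \<omega>)"
  shows "G \<in> borel_measurable M"
    "(\<integral>\<^sup>+\<omega>. ennreal (exp ((G \<omega>)\<^sup>2 / (4 * (h * (real cnt * h) powr H)\<^sup>2))) \<partial>M) \<le> 2"
proof -
  define W where "W m \<omega> = (\<Sum>n<cnt. h / real (Suc m) *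
      (\<Sum>i<Suc m. B (u + real n * h + real i * h / real (Suc m)) \<omega> - B (u + real n * h + h) \<omega>))" for m \<omega>
  define S where "S = (real cnt * h) powr H"
  have S: "S > 0" using assms(1,4) by (simp add: S_def)
  have blk: "u + real n * h + h \<le> T" "u + real n * h \<ge> 0" if "n < cnt" for n
  proof -
    have "real (Suc n) * h \<le> real cnt * h" using that assms(1) by (intro mult_right_mono) auto
    then show "u + real n * h + h \<le> T" using assms(3) by (simp add: algebra_simps)
    show "u + real n * h \<ge> 0" using assms(1,2) by simp
  qed
  have W_lim: "(\<lambda>m. W m \<omega>) \<longlonglongrightarrow> G \<omega>" if \<omega>: "\<omega> \<in> space M" for \<omega>
    unfolding W_def G_def
  proof (rule tendsto_sum)
    fix n assume "n \<in> {..<cnt}"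
    then have "continuous_on {u + real n * h..u + real n * h + h} (\<lambda>s. B s \<omega> - B (u + real n * h + h) \<omega>)"
      using blk[of n] by (intro continuous_intros continuous_on_subset[OF continuous_B[OF \<omega>]]) auto
    from riemann_left_sum[OF this assms(1)]
    show "(\<lambda>m. h / real (Suc m) * (\<Sum>i<Suc m. B (u + real n * h + real i * h / real (Suc m)) \<omega> - B (u + real n * h + h) \<omega>))
       \<longlonglongrightarrow> integral {u + real n * h..u + real n * h + h} (\<lambda>s. B s \<omega> - B (u + real n * h + h) \<omega>)" .
  qed
  \<comment> \<open>The pair of step \<open>n\<close> and subinterval \<open>i\<close> becomes the
    index \<open>k = n * Suc m + i\<close>, and \<open>k mod Suc m\<close> recovers
    \<open>i\<close>.\<close>
  have W_eq: "W m \<omega> = h * (\<Sum>k<cnt * Suc m. (- real (Suc (k mod Suc m)) / real (Suc m)) *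
      (B (u + real (Suc k) * h / real (Suc m)) \<omega> - B (u + real k * h / real (Suc m)) \<omega>))" for m \<omega>
  proof -
    define p where "p = Suc m"
    define b where "b k = B (u + real k * h / real p) \<omega>" for k
    define F where "F k = (- real (Suc (k mod p)) / real p) * (b (Suc k) - b k)" for k
    have p: "p > 0" by (simp add: p_def)
    have time: "u + real n * h + real i * h / real p = u + real (n * p + i) * h / real p" for n i
      using p by (simp add: field_simps)
    have time': "u + real n * h + h = u + real (n * p + p) * h / real p" for n
      using p by (simp add: field_simps)
    have "(\<Sum>i<p. b (n * p + i) - b (n * p + p)) = real p * (\<Sum>i<p. F (n * p + i))" for n
    proof -
      have "(\<Sum>i<p. b (n * p + i) - b (n * p + p)) = - (\<Sum>i<p. real (Suc i) * (b (Suc (n * p + i)) - b (n * p + i)))"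
        using summation_by_parts_weights[of "\<lambda>i. b (n * p + i)" p] by simp
      also have "\<dots> = real p * (\<Sum>i<p. F (n * p + i))"
        using p unfolding sum_distrib_left sum_negf[symmetric]
        by (intro sum.cong) (simp_all add: F_def del: of_nat_Suc)
      finally show ?thesis .
    qed
    then have "W m \<omega> = (\<Sum>n<cnt. h / real p * (real p * (\<Sum>i<p. F (n * p + i))))"
      unfolding W_def p_def[symmetric] time time' b_def by simp
    also have "\<dots> = h * (\<Sum>n<cnt. \<Sum>i<p. F (n * p + i))"
      using p by (simp add: sum_distrib_left)
    also have "(\<Sum>n<cnt. \<Sum>i<p. F (n * p + i)) = (\<Sum>n<cnt. sum F {n * p..<n * p + p})"
    proof (rule sum.cong[OF refl])
      show "(\<Sum>i<p. F (n * p + i)) = sum F {n * p..<n * p + p}" for n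
        by (subst sum.atLeastLessThan_shift_0) (simp add: atLeast0LessThan)
    qed
    also have "\<dots> = sum F {..<cnt * p}" by (rule sum.nat_group)
    finally show ?thesis unfolding F_def b_def p_def .
  qed
  have W_meas[measurable]: "W m \<in> borel_measurable M" for m
  proof -
    have "u + real n * h + real i * h / real (Suc m) \<in> {0..T}" if "n < cnt" "i < Suc m" for n i
    proof -
      have "real i * h / real (Suc m) \<le> h"
        using that assms(1) mult_right_mono[of "real i" "real (Suc m)" h]
        by (simp add: pos_divide_le_eq mult.commute)
      moreover have "0 \<le> real i * h / real (Suc m)" using assms(1) by simp
      ultimately show ?thesis using blk[OF that(1)] by auto
    qed
    moreover have "u + real n * h + h \<in> {0..T}" if "n < cnt" for n using blk[OF that] assms(1) by auto
    ultimately show ?thesis unfolding W_def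
      by (intro borel_measurable_sum borel_measurable_times borel_measurable_diff borel_measurable_const measurable_B) auto
  qed
  show G_meas: "G \<in> borel_measurable M"
    by (rule borel_measurable_LIMSEQ_real[OF W_lim W_meas])
  have W_mom: "(\<integral>\<^sup>+\<omega>. ennreal (exp ((W m \<omega>)\<^sup>2 / (4 * (h * S)\<^sup>2))) \<partial>M) \<le> 2" for m
  proof -
    define t where "t k = u + real k * h / real (Suc m)" for k
    define c where "c k = - real (Suc (k mod Suc m)) / real (Suc m)" for k
    have tn: "t (cnt * Suc m) = u + real cnt * h" "t 0 = u" by (auto simp: t_def field_simps)
    have "(\<integral>\<^sup>+\<omega>. ennreal (exp ((\<Sum>k<cnt * Suc m. c k * (B (t (Suc k)) \<omega> - B (t k) \<omega>))\<^sup>2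
        / (4 * ((t (cnt * Suc m) - t 0) powr H)\<^sup>2))) \<partial>M) \<le> 2"
    proof (rule weighted_increments_exp_square)
      fix k assume "k \<le> cnt * Suc m"
      then have "real k \<le> real (cnt * Suc m)" by (simp only: of_nat_le_iff)
      then have "real k * h / real (Suc m) \<le> real (cnt * Suc m) * h / real (Suc m)"
        using assms(1) by (intro divide_right_mono mult_right_mono) auto
      then have "t k \<le> t (cnt * Suc m)" unfolding t_def by simp
      moreover have "t k \<ge> 0" using assms(1,2) by (simp add: t_def)
      ultimately show "t k \<in> {0..T}" using tn assms(3) by simp
    next
      fix k
      show "t k \<le> t (Suc k)" unfolding t_def using assms(1)
        by (intro add_left_mono divide_right_mono mult_right_mono) auto
      have "Suc (k mod Suc m) \<le> Suc m" using mod_less_divisor[of "Suc m" k] by simp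
      then have "real (Suc (k mod Suc m)) \<le> real (Suc m)" by (simp only: of_nat_le_iff)
      then show "\<bar>c k\<bar> \<le> 1" unfolding c_def by (simp add: abs_minus_cancel)
    qed (use tn assms in auto)
    moreover have "(t (cnt * Suc m) - t 0) powr H = S" by (simp only: tn S_def add_diff_cancel_left')
    moreover have "(W m \<omega>)\<^sup>2 / (4 * (h * S)\<^sup>2) = (\<Sum>k<cnt * Suc m. c k * (B (t (Suc k)) \<omega> - B (t k) \<omega>))\<^sup>2
        / (4 * S\<^sup>2)" for \<omega>
    proof -
      have "W m \<omega> = h * (\<Sum>k<cnt * Suc m. c k * (B (t (Suc k)) \<omega> - B (t k) \<omega>))"
        unfolding W_eq t_def c_def ..
      then show ?thesis using assms(1) by (simp only: power_mult_distrib) simp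
    qed
    ultimately show ?thesis by (simp only:)
  qed
  \<comment> \<open>Fatou's lemma carries the exponential moment to the limit, so only the
    approximating sums have to be identified as Gaussian.\<close>
  have "(\<integral>\<^sup>+\<omega>. ennreal (exp ((G \<omega>)\<^sup>2 / (4 * (h * S)\<^sup>2))) \<partial>M)
      = (\<integral>\<^sup>+\<omega>. liminf (\<lambda>m. ennreal (exp ((W m \<omega>)\<^sup>2 / (4 * (h * S)\<^sup>2)))) \<partial>M)"
  proof (intro nn_integral_cong)
    fix \<omega> assume "\<omega> \<in> space M"
    then have "(\<lambda>m. ennreal (exp ((W m \<omega>)\<^sup>2 / (4 * (h * S)\<^sup>2)))) \<longlonglongrightarrow> ennreal (exp ((G \<omega>)\<^sup>2 / (4 * (h * S)\<^sup>2)))"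
      using assms(1) S by (intro tendsto_ennrealI tendsto_intros W_lim) auto
    then show "ennreal (exp ((G \<omega>)\<^sup>2 / (4 * (h * S)\<^sup>2))) = liminf (\<lambda>m. ennreal (exp ((W m \<omega>)\<^sup>2 / (4 * (h * S)\<^sup>2))))"
      by (metis lim_imp_Liminf sequentially_bot)
  qed
  also have "\<dots> \<le> liminf (\<lambda>m. \<integral>\<^sup>+\<omega>. ennreal (exp ((W m \<omega>)\<^sup>2 / (4 * (h * S)\<^sup>2))) \<partial>M)"
    by (intro nn_integral_liminf) measurable
  also have "\<dots> \<le> liminf (\<lambda>m. 2)"
    by (intro Liminf_mono always_eventually allI W_mom)
  also have "\<dots> = 2" by (simp add: Liminf_const)
  finally show "(\<integral>\<^sup>+\<omega>. ennreal (exp ((G \<omega>)\<^sup>2 / (4 * (h * (real cnt * h) powr H)\<^sup>2))) \<partial>M) \<le> 2"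
    unfolding S_def .
qed

text \<open>Levels are counted from the largest block: there are \<open>2 ^ i\<close> blocks of
  level \<open>m - i\<close>, so the family bound applies with \<open>c = 1\<close> and no logarithm
  of \<open>N\<close> appears. This is what permits the rate \<open>h\<close> on the grid.\<close>

lemma block_noise_family:
  assumes N: "N \<ge> 1" "h = T / real N" "N \<le> 2 ^ m"
  shows "\<exists>\<Theta>\<in>borel_measurable M. (\<forall>\<omega>. \<Theta> \<omega> \<ge> (1 :: real)) \<and> (\<integral>\<^sup>+\<omega>. ennreal (\<Theta> \<omega>) \<partial>M) \<le> 3 \<and>
    (AE \<omega> in M. \<forall>i\<le>m. \<forall>j<2 ^ i.
       \<bar>block_sum (\<lambda>t. B t \<omega>) h N (m - i) j\<bar>
       \<le> 2 * (h * (2 ^ (m - i) * h) powr H) * ((2 + ln (\<Theta> \<omega>)) * (2 * real i + 3)))"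
proof -
  have h: "h > 0" "real N * h = T" using N T_pos by auto
  define V where "V l j \<omega> = block_sum (\<lambda>t. B t \<omega>) h N l j"
    for l j :: nat and \<omega>
  have V: "V l j \<in> borel_measurable M \<and>
      (\<integral>\<^sup>+\<omega>. ennreal (exp ((V l j \<omega>)\<^sup>2 / (4 * (h * (2 ^ l * h) powr H)\<^sup>2))) \<partial>M) \<le> 2" for l j
  proof -
    define p where "p = j * 2 ^ l"
    \<comment> \<open>The number of actual steps in the block. Truncated subtraction gives 0 for
      blocks beyond \<open>N\<close>, and \<open>cnt \<le> 2 ^ l\<close> lets the scale of a full
      block serve for a cut one.\<close>
    define cnt where "cnt = min ((j + 1) * 2 ^ l) N - p"
    have V_eq: "V l j \<omega> = (\<Sum>n<cnt. integral {real p * h + real n * h..real p * h + real n * h + h}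
        (\<lambda>s. B s \<omega> - B (real p * h + real n * h + h) \<omega>))" for \<omega>
    proof -
      have "V l j \<omega> = (\<Sum>n\<in>{p..<min ((j + 1) * 2 ^ l) N}. block_noise (\<lambda>t. B t \<omega>) h n)"
        unfolding V_def p_def block_sum_def by (subst sum.inter_filter[symmetric]) (auto intro!: sum.cong)
      also have "\<dots> = (\<Sum>n<cnt. block_noise (\<lambda>t. B t \<omega>) h (p + n))"
        unfolding cnt_def by (subst sum.atLeastLessThan_shift_0) (simp add: atLeast0LessThan)
      finally show ?thesis unfolding block_noise_def by (simp add: distrib_right)
    qed
    show ?thesis
    proof (cases "cnt = 0")
      case True
      then have "V l j = (\<lambda>_. 0)" by (simp add: V_eq fun_eq_iff)
      then show ?thesis by (simp add: emeasure_space_1)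
    next
      case False
      then have "p + cnt \<le> N" "cnt \<le> 2 ^ l" "cnt \<ge> 1" unfolding cnt_def p_def by auto
      then have "real p * h + real cnt * h \<le> real N * h"
        using h mult_right_mono[of "real (p + cnt)" "real N" h] by (simp add: distrib_right)
      then have pc: "real p * h + real cnt * h \<le> T" using h by simp
      have p0: "real p * h \<ge> 0" using h by simp
      note bl = block_sum_exp_square[OF h(1) p0 pc \<open>cnt \<ge> 1\<close>, folded V_eq]
      have "V l j \<in> borel_measurable M" using bl(1) by (simp add: V_eq[abs_def])
      moreover have "(\<integral>\<^sup>+\<omega>. ennreal (exp ((V l j \<omega>)\<^sup>2 / (4 * (h * (2 ^ l * h) powr H)\<^sup>2))) \<partial>M)
        \<le> (\<integral>\<^sup>+\<omega>. ennreal (exp ((V l j \<omega>)\<^sup>2 / (4 * (h * (real cnt * h) powr H)\<^sup>2))) \<partial>M)"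
      proof (intro nn_integral_mono ennreal_leI exp_le_cancel_iff[THEN iffD2])
        fix \<omega>
        have "real cnt \<le> real (2 ^ l)" using \<open>cnt \<le> 2 ^ l\<close> by (simp only: of_nat_le_iff)
        then have "(h * (real cnt * h) powr H)\<^sup>2 \<le> (h * (2 ^ l * h) powr H)\<^sup>2"
          using h H by (intro power_mono mult_left_mono powr_mono2 mult_right_mono) auto
        then show "(V l j \<omega>)\<^sup>2 / (4 * (h * (2 ^ l * h) powr H)\<^sup>2) \<le> (V l j \<omega>)\<^sup>2 / (4 * (h * (real cnt * h) powr H)\<^sup>2)"
          using h \<open>cnt \<ge> 1\<close> by (intro divide_left_mono) auto
      qed
      ultimately show ?thesis using bl(2) order.trans unfolding V_eq by blast
    qed
  qed
  \<comment> \<open>The family bound ranges over all levels, so those above \<open>m\<close> are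
    filled with zero variables of scale one.\<close>
  define G where "G i j \<omega> = (if i \<le> m then V (m - i) j \<omega> else 0)" for i j \<omega>
  define s where "s i = (if i \<le> m then h * (2 ^ (m - i) * h) powr H else 1)" for i
  have "\<exists>\<Theta>\<in>borel_measurable M. (\<forall>\<omega>. \<Theta> \<omega> \<ge> (1 :: real)) \<and> (\<integral>\<^sup>+\<omega>. ennreal (\<Theta> \<omega>) \<partial>M) \<le> 3 \<and>
    (AE \<omega> in M. \<forall>i. \<forall>k<2 ^ i. \<bar>G i k \<omega>\<bar> \<le> 2 * s i * sqrt (ln (\<Theta> \<omega>) + ln 1 + real (i + 1) * ln 4))"
  proof (rule exp_square_family_bound)
    fix i k :: nat
    show "G i k \<in> borel_measurable M" unfolding G_def using V[of "m - i" k] by (cases "i \<le> m") auto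
    show "s i > 0" unfolding s_def using h by simp
    show "(\<integral>\<^sup>+\<omega>. ennreal (exp ((G i k \<omega>)\<^sup>2 / (4 * (s i)\<^sup>2))) \<partial>M) \<le> 2"
      unfolding G_def s_def using V[of "m - i" k] by (cases "i \<le> m") (auto simp: emeasure_space_1)
  qed auto
  then obtain \<Theta> where \<Theta>: "\<Theta> \<in> borel_measurable M" "\<And>\<omega>. \<Theta> \<omega> \<ge> (1 :: real)" "(\<integral>\<^sup>+\<omega>. ennreal (\<Theta> \<omega>) \<partial>M) \<le> 3"
    "AE \<omega> in M. \<forall>i. \<forall>k<2 ^ i. \<bar>G i k \<omega>\<bar> \<le> 2 * s i * sqrt (ln (\<Theta> \<omega>) + ln 1 + real (i + 1) * ln 4)" by blast
  have "AE \<omega> in M. \<forall>i\<le>m. \<forall>j<2 ^ i. \<bar>V (m - i) j \<omega>\<bar>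
       \<le> 2 * (h * (2 ^ (m - i) * h) powr H) * ((2 + ln (\<Theta> \<omega>)) * (2 * real i + 3))"
    using \<Theta>(4)
  proof eventually_elim
    case (elim \<omega>)
    show ?case
    proof (intro allI impI)
      fix i j :: nat assume ij: "i \<le> m" "j < 2 ^ i"
      then have "\<bar>G i j \<omega>\<bar> \<le> 2 * s i * sqrt (ln (\<Theta> \<omega>) + ln 1 + real (i + 1) * ln 4)"
        using elim by blast
      then have "\<bar>V (m - i) j \<omega>\<bar> \<le> 2 * (h * (2 ^ (m - i) * h) powr H) * sqrt (ln (\<Theta> \<omega>) + ln 1 + real (i + 1) * ln 4)"
        using ij(1) by (simp only: G_def s_def if_True)
      also have "\<dots> \<le> 2 * (h * (2 ^ (m - i) * h) powr H) * ((1 + sqrt (ln 1)) * ((2 + ln (\<Theta> \<omega>)) * (2 * real i + 3)))"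
        using \<Theta>(2)[of \<omega>] h by (intro mult_left_mono sqrt_log_bound) auto
      finally show "\<bar>V (m - i) j \<omega>\<bar> \<le> 2 * (h * (2 ^ (m - i) * h) powr H) * ((2 + ln (\<Theta> \<omega>)) * (2 * real i + 3))"
        by simp
    qed
  qed
  then show ?thesis using \<Theta>(1-3) unfolding V_def by (intro bexI[of _ \<Theta>] conjI) auto
qed

text \<open>A block of level \<open>l = m - i\<close> has length at most
  \<open>2 * T / 2 ^ i\<close>. Lowering the exponent from \<open>H\<close> to \<open>a\<close>
  therefore yields a factor geometric in \<open>i\<close>, which absorbs
  \<open>2 * real i + 3\<close>.\<close>

lemma block_noise_holder:
  assumes a: "1 / 2 < a" "a < H" and C0: "\<And>i. (2 * real i + 3) * (2 powr (- (H - a))) ^ i \<le> C0"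
    and N: "N \<ge> 1" "h = T / real N" "2 ^ m \<le> 2 * N" and R: "R \<ge> 0" and lj: "(j + 1) * 2 ^ l \<le> (2::nat) ^ m"
    and V: "\<And>i j. i \<le> m \<Longrightarrow> j < 2 ^ i \<Longrightarrow>
      \<bar>V (m - i) j\<bar> \<le> 2 * (h * (2 ^ (m - i) * h) powr H) * (R * (2 * real i + 3))"
  shows "\<bar>V l j\<bar> \<le> 2 * (2 * T) powr (H - a) * C0 * R * h * (2 ^ l * h) powr a"
proof -
  have h: "h > 0" "real N * h = T" using N T_pos by auto
  have C0_nonneg: "C0 \<ge> 0" using C0[of 0] by simp
  have "(2::nat) ^ l \<le> (j + 1) * 2 ^ l" by simp
  then have "(2::nat) ^ l \<le> 2 ^ m" using lj by linarith
  then have lm: "l \<le> m" by simp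
  define i where "i = m - l"
  have i: "i \<le> m" "m - i = l" using lm by (auto simp: i_def)
  have m: "(2::nat) ^ m = 2 ^ i * 2 ^ l" "(2::real) ^ m = 2 ^ i * 2 ^ l"
    using lm by (simp_all add: i_def flip: power_add)
  have "(j + 1) * 2 ^ l \<le> 2 ^ i * 2 ^ l" using lj m(1) by simp
  then have j: "j < 2 ^ i" using mult_le_cancel2[of "j + 1" "2 ^ l" "2 ^ i"] by simp
  have "real (2 ^ m) \<le> real (2 * N)" using N(3) by (simp only: of_nat_le_iff)
  then have "2 ^ m * h \<le> 2 * real N * h" using h by (intro mult_right_mono) auto
  moreover have "2 * real N * h = 2 * T" "2 ^ i * (2 ^ l * h) = 2 ^ m * h" using h(2) m(2) by simp_all
  ultimately have "2 ^ i * (2 ^ l * h) \<le> 2 * T" by linarith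
  then have "2 ^ l * h \<le> 2 * T * (1 / 2) ^ i" by (simp add: field_simps power_one_over)
  then have "(2 ^ l * h) powr (H - a) \<le> (2 * T * (1 / 2) ^ i) powr (H - a)"
    using a h by (intro powr_mono2) auto
  also have "\<dots> = (2 * T) powr (H - a) * (2 powr (- (H - a))) ^ i"
  proof -
    have "(2 powr (- d)) ^ i = ((1 / 2 :: real) ^ i) powr d" for d
      by (simp add: powr_minus_divide powr_divide flip: powr_power_swap)
    then show ?thesis by (simp only: powr_mult)
  qed
  finally have "(2 ^ l * h) powr (H - a) * (2 * real i + 3) \<le> (2 * T) powr (H - a) * (2 powr (- (H - a))) ^ i * (2 * real i + 3)"
    by (intro mult_right_mono) auto
  also have "\<dots> = (2 * T) powr (H - a) * ((2 * real i + 3) * (2 powr (- (H - a))) ^ i)" by simp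
  also have "\<dots> \<le> (2 * T) powr (H - a) * C0" by (intro mult_left_mono C0) auto
  finally have *: "(2 ^ l * h) powr (H - a) * (2 * real i + 3) \<le> (2 * T) powr (H - a) * C0" .
  have "(2 ^ l * h) powr H = (2 ^ l * h) powr a * (2 ^ l * h) powr (H - a)"
    by (simp flip: powr_add)
  then have "\<bar>V l j\<bar> \<le> 2 * h * R * (2 ^ l * h) powr a * ((2 ^ l * h) powr (H - a) * (2 * real i + 3))"
    using V[OF i(1) j] unfolding i(2) by (simp add: mult_ac)
  also have "\<dots> \<le> 2 * h * R * (2 ^ l * h) powr a * ((2 * T) powr (H - a) * C0)"
    using h R by (intro mult_left_mono *) auto
  finally show ?thesis by (simp add: mult_ac)
qed

end

text \<open>Since \<open>1 / 2 < a < 1\<close>, the exponent \<open>1 / (2 * a - 1)\<close> is at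
  least 1. The power from the lower bound thus dominates both \<open>K\<close> itself and the linear
  bound from \<open>X_upper\<close>.\<close>

lemma lamperti_path_bounds:
  fixes \<kappa> \<theta> \<sigma> x0 T a :: real
  shows "\<exists>C\<ge>1. \<forall>K b X. lamperti_path \<kappa> \<theta> \<sigma> x0 T a K b X \<longrightarrow>
    bounded_lamperti_path \<kappa> \<theta> \<sigma> x0 T a (C * K powr (1 / (2 * a - 1))) b X"
proof -
  define \<gamma> where "\<gamma> = 1 / (2 * a - 1)"
  define A where "A = 2 * exp (\<bar>\<kappa>\<bar> * T) * (1 + x0 + \<kappa> * \<theta> / 2 * T + \<sigma> / 2 * T powr a)"
  define m0 where "m0 = 1 / min (x0 / 2) (sqrt (\<bar>\<theta>\<bar> / 8))"
  define D where "D = \<sigma> / (2 * (\<kappa> * \<theta> / 8) powr a)"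
  define C where "C = 1 + \<bar>A\<bar> + \<bar>m0\<bar> + D powr \<gamma>"
  have C1: "C \<ge> 1" by (simp add: C_def)
  have "bounded_lamperti_path \<kappa> \<theta> \<sigma> x0 T a (C * K powr \<gamma>) b X" if "lamperti_path \<kappa> \<theta> \<sigma> x0 T a K b X" for K b X
  proof -
    interpret lamperti_path \<kappa> \<theta> \<sigma> x0 T a K b X by fact
    have \<gamma>: "\<gamma> \<ge> 1" unfolding \<gamma>_def using param by (simp add: field_simps)
    have K\<gamma>: "K \<le> K powr \<gamma>" using powr_mono[OF \<gamma>, of K] param by simp
    have K\<gamma>1: "1 \<le> K powr \<gamma>" using K\<gamma> param by linarith
    have KC: "K \<le> C * K powr \<gamma>" using mult_mono[OF C1 K\<gamma>] param C1 by simp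
    have up: "X t \<le> C * K powr \<gamma>" if t: "t \<in> {0..T}" for t
    proof -
      define S where "S = 1 + x0 + \<kappa> * \<theta> / 2 * T"
      have S: "S \<ge> 0" unfolding S_def using param by (intro add_nonneg_nonneg mult_nonneg_nonneg) auto
      have "S \<le> S * K" using S param mult_left_mono[of 1 K S] by simp
      then have "S + \<sigma> / 2 * K * T powr a \<le> (S + \<sigma> / 2 * T powr a) * K" by (simp add: algebra_simps)
      then have "2 * exp (\<bar>\<kappa>\<bar> * T) * (S + \<sigma> / 2 * K * T powr a) \<le> 2 * exp (\<bar>\<kappa>\<bar> * T) * ((S + \<sigma> / 2 * T powr a) * K)"
        by (intro mult_left_mono) auto
      then have "X t \<le> A * K" using X_upper[OF t] unfolding A_def S_def by (simp only: mult.assoc)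
      also have "\<dots> \<le> C * K powr \<gamma>"
      proof (rule mult_mono)
        show "A \<le> C" unfolding C_def using abs_ge_self[of A] abs_ge_zero[of m0] powr_ge_zero[of D \<gamma>] by linarith
      qed (use K\<gamma> param C1 in auto)
      finally show ?thesis .
    qed
    have low: "1 / X t \<le> C * K powr \<gamma>" if t: "t \<in> {0..T}" for t
    proof -
      have "\<sigma> * K / (2 * (\<kappa> * \<theta> / 8) powr a) = D * K" by (simp add: D_def)
      then have "1 / X t \<le> max m0 ((D * K) powr \<gamma>)" using X_lower[OF t] unfolding m0_def \<gamma>_def by simp
      also have "(D * K) powr \<gamma> = D powr \<gamma> * K powr \<gamma>" by (rule powr_mult)
      also have "max m0 (D powr \<gamma> * K powr \<gamma>) \<le> C * K powr \<gamma>"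
      proof (rule max.boundedI)
        have "m0 \<le> C" unfolding C_def using abs_ge_self[of m0] abs_ge_zero[of A] powr_ge_zero[of D \<gamma>] by linarith
        also have "\<dots> \<le> C * K powr \<gamma>" using K\<gamma>1 C1 mult_left_mono[of 1 "K powr \<gamma>" C] by simp
        finally show "m0 \<le> C * K powr \<gamma>" .
        show "D powr \<gamma> * K powr \<gamma> \<le> C * K powr \<gamma>" by (intro mult_right_mono) (auto simp: C_def)
      qed
      finally show ?thesis .
    qed
    show ?thesis
    proof unfold_locales
      show "1 \<le> C * K powr \<gamma>" using KC param by linarith
      show "\<bar>b t - b s\<bar> \<le> C * K powr \<gamma> * \<bar>t - s\<bar> powr a" if "s \<in> {0..T}" "t \<in> {0..T}" for s t
        using order.trans[OF holder[OF that] mult_right_mono[OF KC]] by simp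
    qed (use param contX posX eqX up low in auto)
  qed
  then show ?thesis using C1 unfolding \<gamma>_def by blast
qed

context bounded_lamperti_path
begin

definition grid_const :: "real \<Rightarrow> real" where
  "grid_const \<xi> = 2 * local_const * exp (T * max 0 (- \<kappa> / 2) / \<xi>)"

lemma grid_const_nonneg: "grid_const \<xi> \<ge> 0"
  using local_const_nonneg by (simp add: grid_const_def)

lemma square_error_at_grid:
  assumes N: "N \<ge> 1" "h = T / real N" "N \<le> 2 ^ m" "2 ^ m \<le> 2 * N" "h < 1"
    and V: "\<And>l j. (j + 1) * 2 ^ l \<le> 2 ^ m \<Longrightarrow>
       \<bar>block_sum b h N l j\<bar> \<le> K * h * (2 ^ l * h) powr a"
    and \<xi>: "0 < \<xi>" "h * max 0 (- \<kappa> / 2) < 1 - \<xi>" and n: "n \<le> N"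
  shows "\<bar>(X (real n * h))\<^sup>2 - (euler_iterate \<kappa> \<theta> \<sigma> x0 h b n)\<^sup>2\<bar> \<le> grid_const \<xi> * (2 + grid_const \<xi>) * K ^ 10 * h"
proof -
  define g where "g = grid_const \<xi>"
  have g: "g \<ge> 0" by (simp add: g_def grid_const_nonneg)
  have h: "h > 0" "real N * h = T" using N param by auto
  have t: "real n * h \<in> {0..T}" using n h mult_right_mono[of "real n" "real N" h] by auto
  have "\<bar>X (real n * h) - euler_iterate \<kappa> \<theta> \<sigma> x0 h b n\<bar> \<le> g * K ^ 5 * h"
    using euler_grid_error[OF N V \<xi> n] unfolding g_def grid_const_def .
  then have "\<bar>(X (real n * h))\<^sup>2 - (euler_iterate \<kappa> \<theta> \<sigma> x0 h b n)\<^sup>2\<bar> \<le> g * K ^ 5 * h * (2 * K + g * K ^ 5 * h)"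
    by (rule square_error[OF _ t])
  also have "\<dots> \<le> g * K ^ 5 * h * ((2 + g) * K ^ 5)"
  proof (rule mult_left_mono)
    have "K \<le> K ^ 5" using param power_increasing[of 1 5 K] by simp
    moreover have "g * K ^ 5 * h \<le> g * K ^ 5 * 1" using g param N(5) by (intro mult_left_mono) auto
    ultimately show "2 * K + g * K ^ 5 * h \<le> (2 + g) * K ^ 5" by (simp add: algebra_simps)
  qed (use g h param in auto)
  also have "\<dots> = g * (2 + g) * K ^ 10 * h" by (simp flip: power_add)
  finally show ?thesis unfolding g_def .
qed

definition path_const :: "real \<Rightarrow> real \<Rightarrow> real" where
  "path_const \<xi> c = (drift_const + \<sigma> * c + grid_const \<xi>) * (2 + (drift_const + \<sigma> + grid_const \<xi>))"

text \<open>The difference of squares is at most \<open>\<bar>X t - Z\<bar>\<close> times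
  \<open>2 * K + \<bar>X t - Z\<bar>\<close>. The rate \<open>\<eta>\<close> is used in the first
  factor only; the second is bounded by the Hoelder estimate, since \<open>\<eta>\<close> may exceed
  1.\<close>

lemma square_error_on_path:
  assumes N: "N \<ge> 1" "h = T / real N" "N \<le> 2 ^ m" "2 ^ m \<le> 2 * N" "h < 1"
    and V: "\<And>l j. (j + 1) * 2 ^ l \<le> 2 ^ m \<Longrightarrow>
       \<bar>block_sum b h N l j\<bar> \<le> K * h * (2 ^ l * h) powr a"
    and \<xi>: "0 < \<xi>" "h * max 0 (- \<kappa> / 2) < 1 - \<xi>"
    and w: "\<And>n t. n < N \<Longrightarrow> t \<in> {real n * h..real n * h + h} \<Longrightarrow> \<bar>b t - b (real n * h)\<bar> \<le> c * K * \<eta>"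
    and "h \<le> \<eta>" "c \<ge> 0" and t: "t \<in> {0..T}"
  shows "\<bar>(X t)\<^sup>2 - (euler_interpolant \<kappa> \<theta> \<sigma> x0 h b t)\<^sup>2\<bar> \<le> path_const \<xi> c * K ^ 10 * \<eta>"
proof -
  define g where "g = grid_const \<xi>"
  define Z where "Z = euler_interpolant \<kappa> \<theta> \<sigma> x0 h b t"
  have g: "g \<ge> 0" by (simp add: g_def grid_const_nonneg)
  have h: "h > 0" "real N * h = T" using N param by auto
  have \<eta>: "\<eta> > 0" using h assms(10) by simp
  have E: "\<bar>X (real n * h) - euler_iterate \<kappa> \<theta> \<sigma> x0 h b n\<bar> \<le> g * K ^ 5 * h" if "n \<le> N" for n
    using euler_grid_error[OF N V \<xi> that] unfolding g_def grid_const_def .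
  have K5: "K \<le> K ^ 5" "1 \<le> K ^ 5" using param power_increasing[of 1 5 K] by auto
  have e1: "\<bar>X t - Z\<bar> \<le> drift_const * K * h + \<sigma> * (c * K * \<eta>) + g * K ^ 5 * h"
    unfolding Z_def by (rule euler_interpolant_error[OF N(1,2) E w t])
  have e2: "\<bar>X t - Z\<bar> \<le> drift_const * K * h + \<sigma> * K + g * K ^ 5 * h"
    unfolding Z_def
  proof (rule euler_interpolant_error[OF N(1,2) E _ t])
    fix n s assume n: "n < N" and s: "s \<in> {real n * h..real n * h + h}"
    have "real (Suc n) * h \<le> real N * h" using n h by (intro mult_right_mono) auto
    then have "real n * h + h \<le> T" using h by (simp add: algebra_simps)
    moreover have "0 \<le> real n * h" using h by simp
    ultimately have "real n * h \<in> {0..T}" "s \<in> {0..T}"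
      using s h(1) order.trans[of 0 "real n * h" s] by auto
    then have "\<bar>b s - b (real n * h)\<bar> \<le> K * \<bar>s - real n * h\<bar> powr a" by (intro holder)
    also have "\<dots> \<le> K * 1" using s param N(5) by (intro mult_left_mono powr_le1) auto
    finally show "\<bar>b s - b (real n * h)\<bar> \<le> K" by simp
  qed
  have "\<bar>X t - Z\<bar> \<le> (drift_const + \<sigma> * c + g) * K ^ 5 * \<eta>"
  proof -
    have "drift_const * K * h \<le> drift_const * K ^ 5 * \<eta>"
      using K5 consts_nonneg param h assms(10) by (intro mult_mono) auto
    moreover have "\<sigma> * (c * K * \<eta>) \<le> \<sigma> * (c * K ^ 5 * \<eta>)"
      using K5 param \<eta> assms(11) by (intro mult_left_mono mult_right_mono) auto
    moreover have "g * K ^ 5 * h \<le> g * K ^ 5 * \<eta>"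
      using g param assms(10) by (intro mult_left_mono) auto
    ultimately show ?thesis using e1 by (simp add: algebra_simps)
  qed
  moreover have "2 * K + \<bar>X t - Z\<bar> \<le> (2 + (drift_const + \<sigma> + g)) * K ^ 5"
  proof -
    have "drift_const * K * h \<le> drift_const * K ^ 5 * 1"
      using K5 consts_nonneg param h N(5) by (intro mult_mono) auto
    moreover have "\<sigma> * K \<le> \<sigma> * K ^ 5" using K5 param by (intro mult_left_mono) auto
    moreover have "g * K ^ 5 * h \<le> g * K ^ 5 * 1" using g param N(5) by (intro mult_left_mono) auto
    ultimately show ?thesis using e2 K5 by (simp add: algebra_simps)
  qed
  moreover have "0 \<le> (drift_const + \<sigma> * c + g) * K ^ 5 * \<eta>"
    using g param \<eta> consts_nonneg assms(11) by (intro mult_nonneg_nonneg add_nonneg_nonneg) auto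
  moreover have "0 \<le> 2 * K + \<bar>X t - Z\<bar>" using param by simp
  ultimately have "\<bar>X t - Z\<bar> * (2 * K + \<bar>X t - Z\<bar>) \<le> ((drift_const + \<sigma> * c + g) * K ^ 5 * \<eta>) * ((2 + (drift_const + \<sigma> + g)) * K ^ 5)"
    by (intro mult_mono)
  also have "\<dots> = path_const \<xi> c * K ^ 10 * \<eta>" unfolding path_const_def g_def by (simp flip: power_add)
  finally show ?thesis using square_error[OF order_refl t, of Z] unfolding Z_def by linarith
qed

end

text \<open>The constants of the locale involve neither \<open>K\<close> nor the paths, so one
  \<open>C\<close> can be fixed before them. This is the source of uniformity in the randomness and
  in the step size.\<close>

lemma pathwise_error_constants:
  fixes \<kappa> \<theta> \<sigma> x0 T a \<xi> c :: real
  assumes "0 < \<xi>" "c \<ge> 0"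
  obtains C where "C \<ge> 0" "\<And>K b X N h m \<eta>. bounded_lamperti_path \<kappa> \<theta> \<sigma> x0 T a K b X \<Longrightarrow>
     N \<ge> 1 \<Longrightarrow> h = T / real N \<Longrightarrow> N \<le> 2 ^ m \<Longrightarrow> 2 ^ m \<le> 2 * N \<Longrightarrow> h < 1 \<Longrightarrow> h * max 0 (- \<kappa> / 2) < 1 - \<xi> \<Longrightarrow>
     (\<forall>l j. (j + 1) * 2 ^ l \<le> 2 ^ m \<longrightarrow>
       \<bar>block_sum b h N l j\<bar> \<le> K * h * (2 ^ l * h) powr a) \<Longrightarrow>
     (\<forall>n<N. \<forall>t\<in>{real n * h..real n * h + h}. \<bar>b t - b (real n * h)\<bar> \<le> c * K * \<eta>) \<Longrightarrow> h \<le> \<eta> \<Longrightarrow>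
     (\<forall>n\<le>N. \<bar>(X (real n * h))\<^sup>2 - (euler_iterate \<kappa> \<theta> \<sigma> x0 h b n)\<^sup>2\<bar> \<le> C * K ^ 10 * h) \<and>
     (\<forall>t\<in>{0..T}. \<bar>(X t)\<^sup>2 - (euler_interpolant \<kappa> \<theta> \<sigma> x0 h b t)\<^sup>2\<bar> \<le> C * K ^ 10 * \<eta>)"
proof -
  define g where "g = bounded_lamperti_path.grid_const \<kappa> \<theta> \<sigma> T a \<xi>"
  define p where "p = bounded_lamperti_path.path_const \<kappa> \<theta> \<sigma> T a \<xi> c"
  show thesis
  proof (rule that[of "\<bar>g * (2 + g)\<bar> + \<bar>p\<bar>"]; (intro conjI allI impI ballI)?)
    fix K b X N h m \<eta> n
    assume "bounded_lamperti_path \<kappa> \<theta> \<sigma> x0 T a K b X"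
    then interpret bounded_lamperti_path \<kappa> \<theta> \<sigma> x0 T a K b X .
    assume N: "N \<ge> 1" "h = T / real N" "N \<le> 2 ^ m" "2 ^ m \<le> 2 * N" "h < 1"
      and \<xi>: "h * max 0 (- \<kappa> / 2) < 1 - \<xi>" and n: "n \<le> N"
      and V: "\<forall>l j. (j + 1) * 2 ^ l \<le> 2 ^ m \<longrightarrow>
       \<bar>block_sum b h N l j\<bar> \<le> K * h * (2 ^ l * h) powr a"
    have h: "h > 0" using N param by auto
    have "\<bar>(X (real n * h))\<^sup>2 - (euler_iterate \<kappa> \<theta> \<sigma> x0 h b n)\<^sup>2\<bar> \<le> g * (2 + g) * K ^ 10 * h"
      unfolding g_def using V by (intro square_error_at_grid[OF N _ assms(1) \<xi> n]) blast
    also have "\<dots> \<le> (\<bar>g * (2 + g)\<bar> + \<bar>p\<bar>) * K ^ 10 * h"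
      using h param by (intro mult_right_mono) auto
    finally show "\<bar>(X (real n * h))\<^sup>2 - (euler_iterate \<kappa> \<theta> \<sigma> x0 h b n)\<^sup>2\<bar> \<le> (\<bar>g * (2 + g)\<bar> + \<bar>p\<bar>) * K ^ 10 * h" .
  next
    fix K b X N h m \<eta> t
    assume "bounded_lamperti_path \<kappa> \<theta> \<sigma> x0 T a K b X"
    then interpret bounded_lamperti_path \<kappa> \<theta> \<sigma> x0 T a K b X .
    assume N: "N \<ge> 1" "h = T / real N" "N \<le> 2 ^ m" "2 ^ m \<le> 2 * N" "h < 1"
      and \<xi>: "h * max 0 (- \<kappa> / 2) < 1 - \<xi>" and t: "t \<in> {0..T}" and \<eta>: "h \<le> \<eta>"
      and V: "\<forall>l j. (j + 1) * 2 ^ l \<le> 2 ^ m \<longrightarrow>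
       \<bar>block_sum b h N l j\<bar> \<le> K * h * (2 ^ l * h) powr a"
      and w: "\<forall>n<N. \<forall>t\<in>{real n * h..real n * h + h}. \<bar>b t - b (real n * h)\<bar> \<le> c * K * \<eta>"
    have h: "h > 0" using N param by auto
    have "\<bar>(X t)\<^sup>2 - (euler_interpolant \<kappa> \<theta> \<sigma> x0 h b t)\<^sup>2\<bar> \<le> p * K ^ 10 * \<eta>"
      unfolding p_def using V w by (intro square_error_on_path[OF N _ assms(1) \<xi> _ \<eta> assms(2) t]) blast+
    also have "\<dots> \<le> (\<bar>g * (2 + g)\<bar> + \<bar>p\<bar>) * K ^ 10 * \<eta>"
      using h \<eta> param by (intro mult_right_mono) auto
    finally show "\<bar>(X t)\<^sup>2 - (euler_interpolant \<kappa> \<theta> \<sigma> x0 h b t)\<^sup>2\<bar> \<le> (\<bar>g * (2 + g)\<bar> + \<bar>p\<bar>) * K ^ 10 * \<eta>" .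
  qed auto
qed

section \<open>Continuity and measurability of the approximation and of the suprema\<close>

lemma euler_interpolant_between:
  assumes h: "h > 0" and t: "t \<in> {real n * h..real (Suc n) * h}"
  shows "euler_interpolant \<kappa> \<theta> \<sigma> x0 h b t = euler_iterate \<kappa> \<theta> \<sigma> x0 h b n
    + (t - real n * h) / h * (euler_iterate \<kappa> \<theta> \<sigma> x0 h b (Suc n) - euler_iterate \<kappa> \<theta> \<sigma> x0 h b n)"
proof (cases "t = real n * h")
  case True
  show ?thesis
  proof (cases n)
    case 0
    then show ?thesis using True by (simp add: euler_interpolant_def)
  next
    case (Suc k)
    have "t / h = real n" using True h by simp
    \<comment> \<open>At a grid point the ceiling selects the step to the left,
      \<open>k = n - 1\<close>, whose interpolation weight is then 1.\<close>
    then have "nat (\<lceil>t / h\<rceil> - 1) = k" using Suc by (simp del: of_nat_Suc)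
    moreover have "(t - real k * h) / h = 1" using True Suc h by (simp add: field_simps)
    moreover have "\<not> t \<le> 0" using True Suc h by (simp add: not_le)
    ultimately show ?thesis using True Suc by (simp only: euler_interpolant_def Let_def if_False) simp
  qed
next
  case False
  then have "real n < t / h" "t / h \<le> real n + 1"
    using t h by (auto simp: field_simps)
  then have "\<lceil>t / h\<rceil> = int n + 1" by (intro ceiling_unique) auto
  then have "nat (\<lceil>t / h\<rceil> - 1) = n" by simp
  moreover have "\<not> t \<le> 0"
  proof -
    have "0 \<le> real n * h" using h by simp
    moreover have "real n * h < t" using False t by auto
    ultimately show ?thesis by linarith
  qed
  ultimately show ?thesis by (simp only: euler_interpolant_def Let_def if_False)
qed

lemma euler_interpolant_at_grid:
  "h > 0 \<Longrightarrow> euler_interpolant \<kappa> \<theta> \<sigma> x0 h b (real n * h) = euler_iterate \<kappa> \<theta> \<sigma> x0 h b n"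
  by (subst euler_interpolant_between[of _ _ n]) auto

lemma continuous_on_euler_interpolant:
  assumes h: "h > 0"
  shows "continuous_on {0..real N * h} (euler_interpolant \<kappa> \<theta> \<sigma> x0 h b)"
proof (induction N)
  case (Suc N)
  have "continuous_on {real N * h..real (Suc N) * h} (euler_interpolant \<kappa> \<theta> \<sigma> x0 h b)"
  proof (rule continuous_on_eq)
    show "continuous_on {real N * h..real (Suc N) * h} (\<lambda>t. euler_iterate \<kappa> \<theta> \<sigma> x0 h b N
      + (t - real N * h) / h * (euler_iterate \<kappa> \<theta> \<sigma> x0 h b (Suc N) - euler_iterate \<kappa> \<theta> \<sigma> x0 h b N))"
      using h by (intro continuous_intros) auto
  qed (rule euler_interpolant_between[OF h, symmetric])
  then have "continuous_on ({0..real N * h} \<union> {real N * h..real (Suc N) * h}) (euler_interpolant \<kappa> \<theta> \<sigma> x0 h b)"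
    using Suc by (intro continuous_on_closed_Un) auto
  moreover have "{0..real N * h} \<union> {real N * h..real (Suc N) * h} = {0..real (Suc N) * h}"
    using h by (intro ivl_disj_un_two_touch) (auto intro: mult_right_mono)
  ultimately show ?case by (simp only:)
qed simp

text \<open>By continuity the supremum may be taken over a countable dense set of times.\<close>

lemma borel_measurable_SUP_continuous:
  fixes F :: "real \<Rightarrow> 'a \<Rightarrow> real"
  assumes "T \<ge> 0" and meas: "\<And>t. t \<in> {0..T} \<Longrightarrow> F t \<in> borel_measurable M"
    and cont: "\<And>\<omega>. \<omega> \<in> space M \<Longrightarrow> continuous_on {0..T} (\<lambda>t. F t \<omega>)"
  shows "(\<lambda>\<omega>. SUP t\<in>{0..T}. F t \<omega>) \<in> borel_measurable M"
proof -
  obtain D where D: "countable D" "D \<subseteq> {0..T}" "{0..T} \<subseteq> closure D" using separable[of "{0..T}"] by metis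
  have ne: "D \<noteq> {}" using D(3) assms(1) by auto
  have clD: "closure D \<subseteq> {0..T}" using D(2) by (intro closure_minimal) auto
  have bdd: "bdd_above ((\<lambda>t. F t \<omega>) ` {0..T})" if "\<omega> \<in> space M" for \<omega>
    by (intro bounded_imp_bdd_above compact_imp_bounded compact_continuous_image cont that compact_Icc)
  have "(SUP t\<in>{0..T}. F t \<omega>) = (SUP t\<in>D. F t \<omega>)" if \<omega>: "\<omega> \<in> space M" for \<omega>
  proof (rule antisym)
    have bddD: "bdd_above ((\<lambda>t. F t \<omega>) ` D)" by (rule bdd_above_mono[OF bdd[OF \<omega>] image_mono[OF D(2)]])
    show "(SUP t\<in>{0..T}. F t \<omega>) \<le> (SUP t\<in>D. F t \<omega>)"
    proof (rule cSUP_least)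
      fix t assume "t \<in> {0..T}"
      show "F t \<omega> \<le> (SUP t\<in>D. F t \<omega>)"
      proof (rule continuous_le_on_closure[where f = "\<lambda>t. F t \<omega>" and S = D])
        show "continuous_on (closure D) (\<lambda>t. F t \<omega>)" using cont[OF \<omega>] clD by (rule continuous_on_subset)
        show "t \<in> closure D" using \<open>t \<in> {0..T}\<close> D(3) by auto
        show "F x \<omega> \<le> (SUP t\<in>D. F t \<omega>)" if "x \<in> D" for x using bddD that by (rule cSUP_upper2) simp
      qed
    qed (use assms(1) in auto)
    show "(SUP t\<in>D. F t \<omega>) \<le> (SUP t\<in>{0..T}. F t \<omega>)"
      by (rule cSUP_subset_mono[OF ne bdd[OF \<omega>] D(2)]) simp
  qed
  moreover have "(\<lambda>\<omega>. SUP t\<in>D. F t \<omega>) \<in> borel_measurable M"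
  proof (rule borel_measurable_cSUP[OF D(1)])
    show "F t \<in> borel_measurable M" if "t \<in> D" for t using meas that D(2) by blast
    show "bdd_above ((\<lambda>t. F t \<omega>) ` D)" if "\<omega> \<in> space M" for \<omega>
      by (rule bdd_above_mono[OF bdd[OF that] image_mono[OF D(2)]])
  qed
  ultimately show ?thesis by (subst measurable_cong) auto
qed

context fbm
begin

lemma measurable_euler_iterate:
  assumes "h > 0" "real N * h \<le> T" "n \<le> N"
  shows "(\<lambda>\<omega>. euler_iterate \<kappa> \<theta> \<sigma> x0 h (\<lambda>s. B s \<omega>) n) \<in> borel_measurable M"
  using assms(3)
proof (induction n)
  case (Suc n)
  have t: "real k * h \<in> {0..T}" if "k \<le> N" for k
    using that assms(1) order.trans[OF mult_right_mono[of "real k" "real N" h] assms(2)] by auto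
  have [measurable]: "B (real n * h) \<in> borel_measurable M" "B (real (Suc n) * h) \<in> borel_measurable M"
    using t[of n] t[of "Suc n"] Suc.prems by (intro measurable_B; simp)+
  have [measurable]: "(\<lambda>\<omega>. euler_iterate \<kappa> \<theta> \<sigma> x0 h (\<lambda>s. B s \<omega>) n) \<in> borel_measurable M"
    using Suc by simp
  show ?case unfolding euler_iterate.simps Let_def by measurable
qed simp

lemma measurable_cir_approx:
  assumes "h > 0" "real N * h = T" "t \<in> {0..T}"
  shows "cir_approx \<kappa> \<theta> \<sigma> r0 h B t \<in> borel_measurable M"
proof (cases "t \<le> 0")
  case True
  then show ?thesis by (simp add: cir_approx_def[abs_def] euler_interpolant_def)
next
  case False
  define n where "n = nat (\<lceil>t / h\<rceil> - 1)"
  have "0 < t / h" "t / h \<le> real N" using False assms by (simp_all add: pos_divide_le_eq)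
  then have "n < N" unfolding n_def by linarith
  then have [measurable]: "(\<lambda>\<omega>. euler_iterate \<kappa> \<theta> \<sigma> (sqrt r0) h (\<lambda>s. B s \<omega>) n) \<in> borel_measurable M"
    "(\<lambda>\<omega>. euler_iterate \<kappa> \<theta> \<sigma> (sqrt r0) h (\<lambda>s. B s \<omega>) (Suc n)) \<in> borel_measurable M"
    using assms by (intro measurable_euler_iterate[of h N]; simp)+
  show ?thesis
    unfolding cir_approx_def[abs_def] euler_interpolant_def Let_def n_def[symmetric] using False
    by (simp only: if_False) measurable
qed

end

section \<open>The error bounds\<close>

lemma lamperti_transform:
  fixes r b :: "real \<Rightarrow> real"
  assumes "T > 0" "r0 > 0" and cont: "continuous_on {0..T} r" and pos: "\<And>t. t \<in> {0..T} \<Longrightarrow> r t > 0"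
    and sol: "\<And>t. t \<in> {0..T} \<Longrightarrow> \<exists>I. has_rs_integral (\<lambda>s. \<sigma> * sqrt (r s)) b 0 t I \<and>
        r t = r0 + integral {0..t} (\<lambda>s. \<kappa> * (\<theta> - r s)) + I"
    and t: "t \<in> {0..T}"
  shows "sqrt (r t) = sqrt r0 + integral {0..t} (\<lambda>s. lamperti_drift \<kappa> \<theta> (sqrt (r s))) + \<sigma> / 2 * (b t - b 0)"
proof -
  obtain F where F: "\<And>t. t \<in> {0..T} \<Longrightarrow> has_rs_integral (\<lambda>s. \<sigma> * sqrt (r s)) b 0 t (F t)"
    "\<And>t. t \<in> {0..T} \<Longrightarrow> r t = r0 + integral {0..t} (\<lambda>s. \<kappa> * (\<theta> - r s)) + F t"
    using sol by metis
  \<comment> \<open>The initial condition is contained in the integral equation: at time 0 both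
    integrals vanish.\<close>
  have "F 0 = 0" using F(1)[of 0] assms(1) by (intro has_rs_integral_refl) auto
  then have "r 0 = r0" using F(2)[of 0] assms(1) by simp
  have "sqrt (r t) = sqrt (r 0) + integral {0..t} (\<lambda>s. \<kappa> * (\<theta> - r s) / (2 * sqrt (r s))) + \<sigma> / 2 * (b t - b 0)"
  proof (rule sqrt_chain_rule[OF _ _ _ F(1) _ t])
    show "continuous_on {0..T} (\<lambda>s. sqrt (r s))" by (intro continuous_intros cont)
    show "continuous_on {0..T} (\<lambda>s. \<kappa> * (\<theta> - r s))" by (intro continuous_intros cont)
    show "sqrt (r s) > 0" if "s \<in> {0..T}" for s using pos[OF that] by simp
    show "(sqrt (r s))\<^sup>2 = r0 + integral {0..s} (\<lambda>s. \<kappa> * (\<theta> - r s)) + F s" if "s \<in> {0..T}" for s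
      using pos[OF that] F(2)[OF that] by simp
  qed
  also have "integral {0..t} (\<lambda>s. \<kappa> * (\<theta> - r s) / (2 * sqrt (r s))) = integral {0..t} (\<lambda>s. lamperti_drift \<kappa> \<theta> (sqrt (r s)))"
  proof (rule integral_cong)
    fix s assume "s \<in> {0..t}"
    then have "r s > 0" using pos t by auto
    then have "r s = sqrt (r s) * sqrt (r s)" by simp
    then show "\<kappa> * (\<theta> - r s) / (2 * sqrt (r s)) = lamperti_drift \<kappa> \<theta> (sqrt (r s))"
      unfolding lamperti_drift_def using \<open>r s > 0\<close> by (simp add: field_simps)
  qed
  finally show ?thesis unfolding \<open>r 0 = r0\<close> .
qed

text \<open>A logarithm is dominated by any positive power, here \<open>x powr (1 / q)\<close>.
  Hence every moment of \<open>2 + ln (\<Theta> \<omega>)\<close> is controlled by the first moment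
  of \<open>\<Theta>\<close>.\<close>

lemma log_powr_le:
  assumes "q \<ge> 1" "x \<ge> (1 :: real)"
  shows "(2 + ln x) powr q \<le> (q + 2) powr q * x"
proof -
  have "ln x = q * ln (x powr (1 / q))" using assms by (simp add: ln_powr)
  also have "\<dots> \<le> q * (x powr (1 / q) - 1)" using assms by (intro mult_left_mono ln_le_minus_one) auto
  finally have "2 + ln x \<le> 2 * 1 + q * x powr (1 / q)" using assms by (simp add: algebra_simps)
  also have "\<dots> \<le> 2 * x powr (1 / q) + q * x powr (1 / q)"
    using assms by (intro add_right_mono mult_left_mono ge_one_powr_ge_zero) auto
  finally have "(2 + ln x) powr q \<le> ((q + 2) * x powr (1 / q)) powr q"
    using assms by (intro powr_mono2) (auto simp: algebra_simps)
  also have "\<dots> = (q + 2) powr q * x" using assms by (simp add: powr_mult powr_powr)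
  finally show ?thesis .
qed

lemma exists_dyadic_above:
  assumes "N \<ge> (1 :: nat)"
  shows "\<exists>m. N \<le> 2 ^ m \<and> 2 ^ m \<le> 2 * N"
  using assms
proof (induction N rule: dec_induct)
  case base
  show ?case by (intro exI[of _ 0]) simp
next
  case (step N)
  then obtain m where m: "N \<le> 2 ^ m" "2 ^ m \<le> 2 * N" by auto
  show ?case
  proof (cases "Suc N \<le> 2 ^ m")
    case True
    then show ?thesis using m by (intro exI[of _ m]) simp
  next
    case False
    then have "2 ^ m = N" using m by simp
    then show ?thesis using step(1) by (intro exI[of _ "Suc m"]) simp
  qed
qed

lemma (in prob_space) expectation_le_of_AE_le:
  assumes [measurable]: "Y \<in> borel_measurable M" "\<Theta> \<in> borel_measurable M"
    and "\<And>\<omega>. \<Theta> \<omega> \<ge> 0" "\<And>\<omega>. \<omega> \<in> space M \<Longrightarrow> Y \<omega> \<ge> 0" "(\<integral>\<^sup>+\<omega>. ennreal (\<Theta> \<omega>) \<partial>M) \<le> ennreal c" "c \<ge> 0" "D \<ge> 0"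
    and le: "AE \<omega> in M. Y \<omega> \<le> D * \<Theta> \<omega>"
  shows "integrable M Y" "0 \<le> expectation Y" "expectation Y \<le> D * c"
proof -
  have int: "integrable M \<Theta>"
    using assms(3) le_less_trans[OF assms(5) ennreal_less_top] by (intro integrableI_nonneg) auto
  show Y: "integrable M Y"
  proof (rule Bochner_Integration.integrable_bound)
    show "integrable M (\<lambda>\<omega>. D * \<Theta> \<omega>)" using int by simp
    show "AE \<omega> in M. norm (Y \<omega>) \<le> norm (D * \<Theta> \<omega>)"
      using le assms(3,4,7) by (auto intro: AE_mp simp: abs_mult)
  qed simp
  show "0 \<le> expectation Y" using assms(4) by (intro integral_nonneg_AE) auto
  have "expectation Y \<le> expectation (\<lambda>\<omega>. D * \<Theta> \<omega>)"
    using int le by (intro integral_mono_AE Y) auto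
  also have "\<dots> = D * expectation \<Theta>" by simp
  also have "expectation \<Theta> \<le> c"
    using assms(3,5,6) by (subst integral_eq_nn_integral) (auto intro!: enn2real_leI)
  finally show "expectation Y \<le> D * c" using assms(7) by (simp add: mult_left_mono)
qed

text \<open>The three conditions serve the Hoelder constant on \<open>{0..T}\<close>, the
  oscillation inside the steps, and the block sums for the Young estimate. Only the second carries
  the factor with \<open>ln (real N)\<close>.\<close>

definition (in fbm) noise_bounds :: "nat \<Rightarrow> real \<Rightarrow> nat \<Rightarrow> real \<Rightarrow> 'a \<Rightarrow> bool" where
  "noise_bounds N h m L \<omega> \<longleftrightarrow>
     (\<forall>i. \<forall>k<2 ^ i. \<bar>B (real (Suc k) * T / 2 ^ i) \<omega> - B (real k * T / 2 ^ i) \<omega>\<bar>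
         \<le> 2 * (T / 2 ^ i) powr H * (L * (2 * real i + 3))) \<and>
     (\<forall>i. \<forall>k<N * 2 ^ i. \<bar>B (real (Suc k) * h / 2 ^ i) \<omega> - B (real k * h / 2 ^ i) \<omega>\<bar>
         \<le> 2 * (h / 2 ^ i) powr H * ((1 + sqrt (ln (real N))) * L * (2 * real i + 3))) \<and>
     (\<forall>i\<le>m. \<forall>j<2 ^ i.
         \<bar>block_sum (\<lambda>t. B t \<omega>) h N (m - i) j\<bar>
         \<le> 2 * (h * (2 ^ (m - i) * h) powr H) * (L * (2 * real i + 3)))"

lemma (in fbm) noise_families:
  assumes N: "N \<ge> 1" "h = T / real N" "N \<le> 2 ^ m"
  shows "\<exists>\<Theta>\<in>borel_measurable M. (\<forall>\<omega>. \<Theta> \<omega> \<ge> (1 :: real)) \<and> (\<integral>\<^sup>+\<omega>. ennreal (\<Theta> \<omega>) \<partial>M) \<le> ennreal 9 \<and>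
    (AE \<omega> in M. noise_bounds N h m (2 + ln (\<Theta> \<omega>)) \<omega>)"
proof -
  have h: "h > 0" using N T_pos by auto
  have "T = T / real 1" by simp
  from dyadic_increments[OF order_refl this] obtain \<Theta>1 where \<Theta>1: "\<Theta>1 \<in> borel_measurable M" "\<And>\<omega>. \<Theta>1 \<omega> \<ge> (1 :: real)"
    "(\<integral>\<^sup>+\<omega>. ennreal (\<Theta>1 \<omega>) \<partial>M) \<le> 3"
    "AE \<omega> in M. \<forall>i. \<forall>k<1 * 2 ^ i. \<bar>B (real (Suc k) * T / 2 ^ i) \<omega> - B (real k * T / 2 ^ i) \<omega>\<bar>
       \<le> 2 * (T / 2 ^ i) powr H * ((1 + sqrt (ln (real 1))) * ((2 + ln (\<Theta>1 \<omega>)) * (2 * real i + 3)))" by blast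
  from dyadic_increments[OF N(1,2)] obtain \<Theta>2 where \<Theta>2: "\<Theta>2 \<in> borel_measurable M" "\<And>\<omega>. \<Theta>2 \<omega> \<ge> (1 :: real)"
    "(\<integral>\<^sup>+\<omega>. ennreal (\<Theta>2 \<omega>) \<partial>M) \<le> 3"
    "AE \<omega> in M. \<forall>i. \<forall>k<N * 2 ^ i. \<bar>B (real (Suc k) * h / 2 ^ i) \<omega> - B (real k * h / 2 ^ i) \<omega>\<bar>
       \<le> 2 * (h / 2 ^ i) powr H * ((1 + sqrt (ln (real N))) * ((2 + ln (\<Theta>2 \<omega>)) * (2 * real i + 3)))" by blast
  from block_noise_family[OF N] obtain \<Theta>3 where \<Theta>3: "\<Theta>3 \<in> borel_measurable M" "\<And>\<omega>. \<Theta>3 \<omega> \<ge> (1 :: real)"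
    "(\<integral>\<^sup>+\<omega>. ennreal (\<Theta>3 \<omega>) \<partial>M) \<le> 3"
    "AE \<omega> in M. \<forall>i\<le>m. \<forall>j<2 ^ i.
       \<bar>block_sum (\<lambda>t. B t \<omega>) h N (m - i) j\<bar>
       \<le> 2 * (h * (2 ^ (m - i) * h) powr H) * ((2 + ln (\<Theta>3 \<omega>)) * (2 * real i + 3))" by blast
  \<comment> \<open>The sum dominates each summand, so all three families share one logarithm; its
    expectation is at most \<open>3 + 3 + 3\<close>.\<close>
  define \<Theta> where "\<Theta> \<omega> = \<Theta>1 \<omega> + \<Theta>2 \<omega> + \<Theta>3 \<omega>" for \<omega>
  have le: "ln (\<Theta>1 \<omega>) \<le> ln (\<Theta> \<omega>)" "ln (\<Theta>2 \<omega>) \<le> ln (\<Theta> \<omega>)" "ln (\<Theta>3 \<omega>) \<le> ln (\<Theta> \<omega>)" "1 \<le> \<Theta> \<omega>" for \<omega>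
    using \<Theta>1(2)[of \<omega>] \<Theta>2(2)[of \<omega>] \<Theta>3(2)[of \<omega>] unfolding \<Theta>_def by simp_all
  have "(\<integral>\<^sup>+\<omega>. ennreal (\<Theta> \<omega>) \<partial>M) = (\<integral>\<^sup>+\<omega>. ennreal (\<Theta>1 \<omega>) + ennreal (\<Theta>2 \<omega>) + ennreal (\<Theta>3 \<omega>) \<partial>M)"
    unfolding \<Theta>_def using \<Theta>1(2) \<Theta>2(2) \<Theta>3(2)
    by (intro nn_integral_cong) (simp add: ennreal_plus order.trans[OF zero_le_one])
  also have "\<dots> = (\<integral>\<^sup>+\<omega>. ennreal (\<Theta>1 \<omega>) \<partial>M) + (\<integral>\<^sup>+\<omega>. ennreal (\<Theta>2 \<omega>) \<partial>M) + (\<integral>\<^sup>+\<omega>. ennreal (\<Theta>3 \<omega>) \<partial>M)"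
    using \<Theta>1(1) \<Theta>2(1) \<Theta>3(1) by (simp add: nn_integral_add)
  also have "\<dots> \<le> 3 + 3 + 3" using \<Theta>1(3) \<Theta>2(3) \<Theta>3(3) by (intro add_mono)
  also have "\<dots> = ennreal 9" by simp
  finally have int: "(\<integral>\<^sup>+\<omega>. ennreal (\<Theta> \<omega>) \<partial>M) \<le> ennreal 9" .
  have mono: "2 * x * (y * ((2 + ln z) * (2 * real i + 3))) \<le> 2 * x * (y * (2 + ln (\<Theta> \<omega>)) * (2 * real i + 3))"
    if "x \<ge> 0" "y \<ge> 0" "ln z \<le> ln (\<Theta> \<omega>)" for x y z \<omega> and i :: nat
    unfolding mult.assoc[of y] using that by (intro mult_left_mono mult_right_mono add_left_mono) auto
  have "AE \<omega> in M. noise_bounds N h m (2 + ln (\<Theta> \<omega>)) \<omega>"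
    using \<Theta>1(4) \<Theta>2(4) \<Theta>3(4)
  proof eventually_elim
    case (elim \<omega>)
    show ?case
      unfolding noise_bounds_def
    proof (intro conjI allI impI)
      fix i k :: nat assume "k < 2 ^ i"
      then show "\<bar>B (real (Suc k) * T / 2 ^ i) \<omega> - B (real k * T / 2 ^ i) \<omega>\<bar>
         \<le> 2 * (T / 2 ^ i) powr H * ((2 + ln (\<Theta> \<omega>)) * (2 * real i + 3))"
      proof -
        assume k: "k < 2 ^ i"
        then have "\<bar>B (real (Suc k) * T / 2 ^ i) \<omega> - B (real k * T / 2 ^ i) \<omega>\<bar>
           \<le> 2 * (T / 2 ^ i) powr H * (1 * ((2 + ln (\<Theta>1 \<omega>)) * (2 * real i + 3)))"
          using elim(1) by simp
        also have "\<dots> \<le> 2 * (T / 2 ^ i) powr H * (1 * (2 + ln (\<Theta> \<omega>)) * (2 * real i + 3))"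
          by (intro mono le(1)) auto
        finally show ?thesis by simp
      qed
    next
      fix i k :: nat assume "k < N * 2 ^ i"
      then show "\<bar>B (real (Suc k) * h / 2 ^ i) \<omega> - B (real k * h / 2 ^ i) \<omega>\<bar>
         \<le> 2 * (h / 2 ^ i) powr H * ((1 + sqrt (ln (real N))) * (2 + ln (\<Theta> \<omega>)) * (2 * real i + 3))"
        using N(1) by (intro order.trans[OF elim(2)[rule_format] mono[OF _ _ le(2)]]) auto
    next
      fix i j :: nat assume ij: "i \<le> m" "j < 2 ^ i"
      have "2 * (h * (2 ^ (m - i) * h) powr H) * (1 * ((2 + ln (\<Theta>3 \<omega>)) * (2 * real i + 3)))
        \<le> 2 * (h * (2 ^ (m - i) * h) powr H) * (1 * (2 + ln (\<Theta> \<omega>)) * (2 * real i + 3))"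
        using h by (intro mono le(3)) auto
      then show "\<bar>block_sum (\<lambda>t. B t \<omega>) h N (m - i) j\<bar>
         \<le> 2 * (h * (2 ^ (m - i) * h) powr H) * ((2 + ln (\<Theta> \<omega>)) * (2 * real i + 3))"
        using order.trans[OF elim(3)[rule_format, OF ij]] by simp
    qed
  qed
  moreover have "\<Theta> \<in> borel_measurable M" unfolding \<Theta>_def using \<Theta>1(1) \<Theta>2(1) \<Theta>3(1) by simp
  ultimately show ?thesis using int le(4) by blast
qed

text \<open>\<open>D\<close> is fixed before the probability space, the paths and the step size.
  What still depends on them is collected in \<open>\<Theta>\<close>, of which only a bounded
  expectation is required. The power \<open>p / 2\<close> is already taken here so that
  \<open>\<Theta>\<close> enters linearly.\<close>

lemma cir_pathwise_bounds:
  fixes T H \<kappa> \<theta> \<sigma> r0 \<xi> p :: real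
  assumes "T > 0" "1 / 2 < H" "H < 1" "\<kappa> * \<theta> > 0" "\<sigma> > 0" "r0 > 0" "0 < \<xi>" "p \<ge> 2"
  shows "\<exists>D\<ge>0. \<forall>(M :: 'w measure) B r (N :: nat) h.
      fractional_brownian_motion M T H B \<longrightarrow> cir_solution M T \<kappa> \<theta> \<sigma> r0 B r \<longrightarrow>
      N \<ge> 1 \<longrightarrow> h = T / real N \<longrightarrow> h < 1 \<longrightarrow> h * max 0 (- \<kappa> / 2) < 1 - \<xi> \<longrightarrow>
      (\<exists>\<Theta>\<in>borel_measurable M. (\<forall>\<omega>. \<Theta> \<omega> \<ge> (1 :: real)) \<and> (\<integral>\<^sup>+\<omega>. ennreal (\<Theta> \<omega>) \<partial>M) \<le> ennreal 9 \<and>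
        (AE \<omega> in M.
          (\<forall>n\<le>N. \<bar>r (real n * h) \<omega> - cir_approx \<kappa> \<theta> \<sigma> r0 h B (real n * h) \<omega>\<bar> powr (p / 2)
             \<le> D * h powr (p / 2) * \<Theta> \<omega>) \<and>
          (\<forall>t\<in>{0..T}. \<bar>r t \<omega> - cir_approx \<kappa> \<theta> \<sigma> r0 h B t \<omega>\<bar> powr (p / 2)
             \<le> D * (h powr H * (1 + sqrt (ln (real N)))) powr (p / 2) * \<Theta> \<omega>)))"
proof -
  \<comment> \<open>The midpoint of \<open>1 / 2\<close> and \<open>H\<close> leaves room on both
    sides, for \<open>2 * a > 1\<close> and for \<open>H - a > 0\<close>.\<close>
  define a where "a = (1 / 2 + H) / 2"
  have a: "1 / 2 < a" "a < H" "a < 1" using assms(2,3) by (auto simp: a_def)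
  have "0 < 2 powr (- (H - a))" "2 powr (- (H - a)) < (1 :: real)" "0 < 2 powr (- (H - H / 2))" "2 powr (- (H - H / 2)) < (1 :: real)"
    using a assms(2) powr_less_mono[of "- (H - a)" 0 "2 :: real"] powr_less_mono[of "- (H - H / 2)" 0 "2 :: real"] by auto
  then obtain C0 C0' where C0: "\<And>i :: nat. (2 * real i + 3) * (2 powr (- (H - a))) ^ i \<le> C0"
    and C0': "\<And>i :: nat. (2 * real i + 3) * (2 powr (- (H - H / 2))) ^ i \<le> C0'"
    using poly_geometric_bound by metis
  have C0_nonneg: "C0 \<ge> 0" "C0' \<ge> 0" using C0[of 0] C0'[of 0] by auto
  define CH where "CH = 8 * T powr (H - a) * C0 / (1 - 2 powr (- a))"
  define CV where "CV = 2 * (2 * T) powr (H - a) * C0"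
  define CM where "CM = 2 * C0' / (1 - 2 powr (- (H / 2)))"
  have q1: "2 powr (- a) < (1 :: real)" "2 powr (- (H / 2)) < (1 :: real)"
    using a assms(2) powr_less_mono[of "- a" 0 "2 :: real"] powr_less_mono[of "- (H / 2)" 0 "2 :: real"] by auto
  have nonneg: "CH \<ge> 0" "CV \<ge> 0" "CM \<ge> 0" using C0_nonneg q1 by (auto simp: CH_def CV_def CM_def)
  define CB where "CB = 1 + CH + CV"
  define \<gamma> where "\<gamma> = 1 / (2 * a - 1)"
  have \<gamma>: "\<gamma> \<ge> 1" unfolding \<gamma>_def using a by (simp add: field_simps)
  define x0 where "x0 = sqrt r0"
  obtain Cx where Cx: "Cx \<ge> 1" "\<And>K b X. lamperti_path \<kappa> \<theta> \<sigma> x0 T a K b X \<Longrightarrow>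
      bounded_lamperti_path \<kappa> \<theta> \<sigma> x0 T a (Cx * K powr \<gamma>) b X"
    using lamperti_path_bounds[of \<kappa> \<theta> \<sigma> x0 T a] unfolding \<gamma>_def by blast
  obtain C where C: "C \<ge> 0" "\<And>K b X N h m \<eta>. bounded_lamperti_path \<kappa> \<theta> \<sigma> x0 T a K b X \<Longrightarrow>
     N \<ge> 1 \<Longrightarrow> h = T / real N \<Longrightarrow> N \<le> 2 ^ m \<Longrightarrow> 2 ^ m \<le> 2 * N \<Longrightarrow> h < 1 \<Longrightarrow> h * max 0 (- \<kappa> / 2) < 1 - \<xi> \<Longrightarrow>
     (\<forall>l j. (j + 1) * 2 ^ l \<le> 2 ^ m \<longrightarrow>
       \<bar>block_sum b h N l j\<bar> \<le> K * h * (2 ^ l * h) powr a) \<Longrightarrow>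
     (\<forall>n<N. \<forall>t\<in>{real n * h..real n * h + h}. \<bar>b t - b (real n * h)\<bar> \<le> CM * K * \<eta>) \<Longrightarrow> h \<le> \<eta> \<Longrightarrow>
     (\<forall>n\<le>N. \<bar>(X (real n * h))\<^sup>2 - (euler_iterate \<kappa> \<theta> \<sigma> x0 h b n)\<^sup>2\<bar> \<le> C * K ^ 10 * h) \<and>
     (\<forall>t\<in>{0..T}. \<bar>(X t)\<^sup>2 - (euler_interpolant \<kappa> \<theta> \<sigma> x0 h b t)\<^sup>2\<bar> \<le> C * K ^ 10 * \<eta>)"
    by (fact pathwise_error_constants[OF assms(7) nonneg(3)])
  \<comment> \<open>The error carries \<open>K ^ 10\<close>; its power \<open>p / 2\<close> is
    \<open>K powr (5 * p)\<close>, and \<open>K\<close> is a multiple of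
    \<open>KB powr \<gamma>\<close>.\<close>
  define q where "q = 5 * \<gamma> * p"
  have q: "q \<ge> 1" unfolding q_def using \<gamma> assms(8) mult_mono[of 1 "5 * \<gamma>" 1 p] by simp
  define D where "D = C powr (p / 2) * (Cx powr (5 * p) * CB powr q * (q + 2) powr q)"
  show ?thesis
  proof (intro exI[of _ D] conjI allI impI)
    show "D \<ge> 0" by (simp add: D_def)
    fix M :: "'w measure" and B r :: "real \<Rightarrow> 'w \<Rightarrow> real" and N :: nat and h :: real
    assume fbm: "fractional_brownian_motion M T H B" and sol: "cir_solution M T \<kappa> \<theta> \<sigma> r0 B r"
      and N: "N \<ge> 1" "h = T / real N" and h1: "h < 1" and h\<xi>: "h * max 0 (- \<kappa> / 2) < 1 - \<xi>"
    have h: "h > 0" "real N * h = T" using N assms(1) by auto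
    interpret prob_space M using fbm by (simp add: fractional_brownian_motion_def)
    interpret fbm M T H B by unfold_locales (use fbm assms in auto)
    obtain m where m: "N \<le> 2 ^ m" "2 ^ m \<le> 2 * N" using exists_dyadic_above[OF N(1)] by blast
    from noise_families[OF N m(1)] obtain \<Theta> where \<Theta>: "\<Theta> \<in> borel_measurable M" "\<And>\<omega>. \<Theta> \<omega> \<ge> (1 :: real)"
      "(\<integral>\<^sup>+\<omega>. ennreal (\<Theta> \<omega>) \<partial>M) \<le> ennreal 9"
      and families: "AE \<omega> in M. noise_bounds N h m (2 + ln (\<Theta> \<omega>)) \<omega>" by blast
    define \<eta> where "\<eta> = h powr H * (1 + sqrt (ln (real N)))"
    have h\<eta>: "h \<le> \<eta>"
    proof -
      have "h powr 1 \<le> h powr H" using h h1 assms(3) by (intro powr_mono') auto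
      also have "\<dots> \<le> \<eta>" unfolding \<eta>_def using N(1) mult_left_mono[of 1 "1 + sqrt (ln (real N))" "h powr H"] by simp
      finally show ?thesis using h by simp
    qed
    have "AE \<omega> in M. \<forall>t\<in>{0..T}. \<exists>I. has_rs_integral (\<lambda>s. \<sigma> * sqrt (r s \<omega>)) (\<lambda>s. B s \<omega>) 0 t I \<and>
        r t \<omega> = r0 + integral {0..t} (\<lambda>s. \<kappa> * (\<theta> - r s \<omega>)) + I"
      using sol by (simp add: cir_solution_def)
    then have "AE \<omega> in M.
          (\<forall>n\<le>N. \<bar>r (real n * h) \<omega> - cir_approx \<kappa> \<theta> \<sigma> r0 h B (real n * h) \<omega>\<bar> powr (p / 2)
             \<le> D * h powr (p / 2) * \<Theta> \<omega>) \<and>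
          (\<forall>t\<in>{0..T}. \<bar>r t \<omega> - cir_approx \<kappa> \<theta> \<sigma> r0 h B t \<omega>\<bar> powr (p / 2) \<le> D * \<eta> powr (p / 2) * \<Theta> \<omega>)"
      using families AE_space
    proof eventually_elim
      case (elim \<omega>)
      define b where "b t = B t \<omega>" for t
      define X where "X t = sqrt (r t \<omega>)" for t
      define L where "L = 2 + ln (\<Theta> \<omega>)"
      define R where "R = (1 + sqrt (ln (real N))) * L"
      have L: "L \<ge> 2" unfolding L_def using \<Theta>(2)[of \<omega>] by simp
      have R: "R \<ge> 0" unfolding R_def using L N(1) by simp
      have rpos: "r t \<omega> > 0" if "t \<in> {0..T}" for t using sol elim(3) that by (simp add: cir_solution_def)
      have rcont: "continuous_on {0..T} (\<lambda>t. r t \<omega>)" using sol elim(3) by (simp add: cir_solution_def)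
      have b_holder: "\<bar>b t - b s\<bar> \<le> CH * L * \<bar>t - s\<bar> powr a" if st: "s \<in> {0..T}" "t \<in> {0..T}" for s t
        unfolding b_def CH_def
        by (rule path_holder[OF a(1,2) C0 elim(3) _ _ st(2,1)]) (use L elim(2) in \<open>auto simp: L_def noise_bounds_def\<close>)
      have V: "\<bar>block_sum b h N l j\<bar> \<le> CV * L * h * (2 ^ l * h) powr a"
        if "(j + 1) * 2 ^ l \<le> (2::nat) ^ m" for l j
        unfolding b_def CV_def
        by (rule block_noise_holder[OF a(1,2) C0 N(1,2) m(2) _ that,
              where V = "\<lambda>l j. block_sum (\<lambda>t. B t \<omega>) h N l j"])
          (use L elim(2) in \<open>auto simp: L_def noise_bounds_def\<close>)
      have w: "\<bar>b t - b (real n * h)\<bar> \<le> CM * R * h powr H" if "n < N" "t \<in> {real n * h..real n * h + h}" for n t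
        unfolding b_def CM_def
        by (rule path_modulus[OF N C0' elim(3) R _ that]) (use elim(2) in \<open>auto simp: L_def R_def noise_bounds_def\<close>)
      define KB where "KB = CB * L"
      have LKB: "L \<le> KB" "CH * L \<le> KB" "CV * L \<le> KB" "1 \<le> KB"
      proof -
        have "CH * L \<ge> 0" "CV * L \<ge> 0" using L nonneg by auto
        moreover have "KB = L + CH * L + CV * L" by (simp add: KB_def CB_def algebra_simps)
        ultimately show "L \<le> KB" "CH * L \<le> KB" "CV * L \<le> KB" "1 \<le> KB" using L by linarith+
      qed
      define K where "K = Cx * KB powr \<gamma>"
      have KBK: "KB \<le> K"
      proof -
        have "KB \<le> KB powr \<gamma>" using powr_mono[OF \<gamma>, of KB] LKB by simp
        also have "\<dots> \<le> K" unfolding K_def using Cx(1) mult_right_mono[of 1 Cx "KB powr \<gamma>"] by simp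
        finally show ?thesis .
      qed
      have "lamperti_path \<kappa> \<theta> \<sigma> x0 T a KB b X"
      proof unfold_locales
        show "continuous_on {0..T} X" unfolding X_def by (intro continuous_intros rcont)
        show "X t > 0" if "t \<in> {0..T}" for t unfolding X_def using rpos[OF that] by simp
        show "X t = x0 + integral {0..t} (\<lambda>s. lamperti_drift \<kappa> \<theta> (X s)) + \<sigma> / 2 * (b t - b 0)" if "t \<in> {0..T}" for t
          unfolding X_def x0_def b_def
          by (rule lamperti_transform[OF assms(1,6) rcont rpos _ that]) (use elim(1) in blast)+
        show "\<bar>b t - b s\<bar> \<le> KB * \<bar>t - s\<bar> powr a" if "s \<in> {0..T}" "t \<in> {0..T}" for s t
          using order.trans[OF b_holder[OF that] mult_right_mono[OF LKB(2)]] by simp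
      qed (use assms a LKB in \<open>auto simp: x0_def\<close>)
      then have blp: "bounded_lamperti_path \<kappa> \<theta> \<sigma> x0 T a K b X" unfolding K_def by (rule Cx(2))
      have V': "\<forall>l j. (j + 1) * 2 ^ l \<le> 2 ^ m \<longrightarrow>
         \<bar>block_sum b h N l j\<bar> \<le> K * h * (2 ^ l * h) powr a"
      proof (intro allI impI)
        fix l j assume "(j + 1) * 2 ^ l \<le> (2::nat) ^ m"
        note V[OF this]
        also have "CV * L * h * (2 ^ l * h) powr a \<le> K * h * (2 ^ l * h) powr a"
          using LKB KBK h by (intro mult_right_mono) auto
        finally show "\<bar>block_sum b h N l j\<bar> \<le> K * h * (2 ^ l * h) powr a" .
      qed
      have w': "\<forall>n<N. \<forall>t\<in>{real n * h..real n * h + h}. \<bar>b t - b (real n * h)\<bar> \<le> CM * K * \<eta>"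
      proof (intro allI impI ballI)
        fix n t assume "n < N" "t \<in> {real n * h..real n * h + h}"
        note w[OF this]
        \<comment> \<open>The logarithmic factor of \<open>R\<close> is moved into
          \<open>\<eta>\<close>, so that it is not raised to the powers that \<open>K\<close>
          undergoes.\<close>
        also have "CM * R * h powr H = CM * L * \<eta>" by (simp add: R_def \<eta>_def)
        also have "\<dots> \<le> CM * K * \<eta>"
          using LKB KBK nonneg h h\<eta> by (intro mult_right_mono mult_left_mono) auto
        finally show "\<bar>b t - b (real n * h)\<bar> \<le> CM * K * \<eta>" .
      qed
      note errs = C(2)[OF blp N m h1 h\<xi> V' w' h\<eta>]
      have powr_bound: "y powr (p / 2) \<le> D * z powr (p / 2) * \<Theta> \<omega>" if "0 \<le> y" "y \<le> C * K ^ 10 * z" "z \<ge> 0" for y z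
      proof -
        have K0: "K > 0" using LKB KBK by linarith
        have "y powr (p / 2) \<le> (C * K ^ 10 * z) powr (p / 2)" using that assms(8) by (intro powr_mono2) auto
        also have "\<dots> = C powr (p / 2) * K powr (5 * p) * z powr (p / 2)"
        proof -
          have "(K ^ 10) powr (p / 2) = (K powr 10) powr (p / 2)" using K0 by simp
          also have "\<dots> = K powr (5 * p)" unfolding powr_powr by simp
          finally show ?thesis unfolding powr_mult by (simp only:)
        qed
        also have "K powr (5 * p) = Cx powr (5 * p) * (CB powr q * L powr q)"
          unfolding K_def KB_def by (simp add: powr_mult powr_powr q_def mult_ac)
        also have "C powr (p / 2) * (Cx powr (5 * p) * (CB powr q * L powr q)) * z powr (p / 2)
          \<le> C powr (p / 2) * (Cx powr (5 * p) * (CB powr q * ((q + 2) powr q * \<Theta> \<omega>))) * z powr (p / 2)"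
          unfolding L_def by (intro mult_right_mono mult_left_mono log_powr_le q \<Theta>(2)) auto
        also have "\<dots> = D * z powr (p / 2) * \<Theta> \<omega>" unfolding D_def by simp
        finally show ?thesis .
      qed
      show ?case
      proof (intro conjI allI impI ballI)
        fix n assume n: "n \<le> N"
        have "real n * h \<in> {0..T}" using n h mult_right_mono[of "real n" "real N" h] by auto
        then have "r (real n * h) \<omega> = (X (real n * h))\<^sup>2" unfolding X_def using rpos[of "real n * h"] by simp
        moreover have "cir_approx \<kappa> \<theta> \<sigma> r0 h B (real n * h) \<omega> = (euler_iterate \<kappa> \<theta> \<sigma> x0 h b n)\<^sup>2"
          using h by (simp add: cir_approx_def euler_interpolant_at_grid x0_def b_def[abs_def])
        ultimately show "\<bar>r (real n * h) \<omega> - cir_approx \<kappa> \<theta> \<sigma> r0 h B (real n * h) \<omega>\<bar> powr (p / 2) \<le> D * h powr (p / 2) * \<Theta> \<omega>"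
          using errs n h by (intro powr_bound) auto
      next
        fix t assume t: "t \<in> {0..T}"
        have "r t \<omega> = (X t)\<^sup>2" unfolding X_def using rpos[OF t] by simp
        moreover have "cir_approx \<kappa> \<theta> \<sigma> r0 h B t \<omega> = (euler_interpolant \<kappa> \<theta> \<sigma> x0 h b t)\<^sup>2"
          by (simp add: cir_approx_def x0_def b_def[abs_def])
        ultimately show "\<bar>r t \<omega> - cir_approx \<kappa> \<theta> \<sigma> r0 h B t \<omega>\<bar> powr (p / 2) \<le> D * \<eta> powr (p / 2) * \<Theta> \<omega>"
          using errs t h h\<eta> by (intro powr_bound) auto
      qed
    qed
    then show "\<exists>\<Theta>\<in>borel_measurable M. (\<forall>\<omega>. \<Theta> \<omega> \<ge> (1 :: real)) \<and> (\<integral>\<^sup>+\<omega>. ennreal (\<Theta> \<omega>) \<partial>M) \<le> ennreal 9 \<and>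
        (AE \<omega> in M.
          (\<forall>n\<le>N. \<bar>r (real n * h) \<omega> - cir_approx \<kappa> \<theta> \<sigma> r0 h B (real n * h) \<omega>\<bar> powr (p / 2)
             \<le> D * h powr (p / 2) * \<Theta> \<omega>) \<and>
          (\<forall>t\<in>{0..T}. \<bar>r t \<omega> - cir_approx \<kappa> \<theta> \<sigma> r0 h B t \<omega>\<bar> powr (p / 2)
             \<le> D * (h powr H * (1 + sqrt (ln (real N)))) powr (p / 2) * \<Theta> \<omega>))"
      using \<Theta> unfolding \<eta>_def by blast
  qed
qed

text \<open>Integrability is claimed explicitly because the expectation of a non-integrable function
  is zero by convention, which would make the bounds void. As \<open>T / h = N\<close>, the
  right-hand side of the second estimate is zero for \<open>N = 1\<close>; hence the restriction to
  \<open>N \<ge> 2\<close>.\<close>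

theorem theorem4p3:
  fixes T H \<kappa> \<theta> \<sigma> r0 \<xi> p :: real
  assumes "T > 0" and "1 / 2 < H" and "H < 1"
    and "\<kappa> * \<theta> > 0" and "\<sigma> > 0" and "r0 > 0"
    and "0 < \<xi>" and "\<xi> < 1" and "p \<ge> 2"
    and "\<forall>s\<in>{0..T}. \<kappa> * \<theta> * exp (\<kappa> * s / 2) \<ge>
           (3 * p + 1) * integral {0..s} (\<lambda>\<tau>. \<sigma>\<^sup>2 / 2 * exp (\<kappa> * \<tau> / 2) * fbm_kernel H \<tau> s)"
  shows "\<exists>C1 C2 :: real. \<forall>(M :: 'w measure) B r (N :: nat) h.
      fractional_brownian_motion M T H B \<longrightarrow>
      cir_solution M T \<kappa> \<theta> \<sigma> r0 B r \<longrightarrow>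
      N \<ge> 1 \<longrightarrow> h = T / real N \<longrightarrow> h < 1 \<longrightarrow> h * max 0 (- \<kappa> / 2) < 1 - \<xi> \<longrightarrow>
      (let err = (\<lambda>t \<omega>. \<bar>r t \<omega> - cir_approx \<kappa> \<theta> \<sigma> r0 h B t \<omega>\<bar> powr (p / 2));
           grid_err = (\<lambda>\<omega>. SUP n\<in>{1..N}. err (real n * h) \<omega>);
           path_err = (\<lambda>\<omega>. SUP t\<in>{0..T}. err t \<omega>)
       in integrable M grid_err \<and>
          (prob_space.expectation M grid_err) powr (2 / p) \<le> C1 * h \<and>
          integrable M path_err \<and>
          (N \<ge> 2 \<longrightarrow>
             (prob_space.expectation M path_err) powr (2 / p)
               \<le> C2 * h powr H * sqrt (ln (T / h))))"
proof -
  obtain D where D0: "D \<ge> 0" and D: "\<And>(M :: 'w measure) B r (N :: nat) h.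
      fractional_brownian_motion M T H B \<Longrightarrow> cir_solution M T \<kappa> \<theta> \<sigma> r0 B r \<Longrightarrow>
      N \<ge> 1 \<Longrightarrow> h = T / real N \<Longrightarrow> h < 1 \<Longrightarrow> h * max 0 (- \<kappa> / 2) < 1 - \<xi> \<Longrightarrow>
      (\<exists>\<Theta>\<in>borel_measurable M. (\<forall>\<omega>. \<Theta> \<omega> \<ge> (1 :: real)) \<and> (\<integral>\<^sup>+\<omega>. ennreal (\<Theta> \<omega>) \<partial>M) \<le> ennreal 9 \<and>
        (AE \<omega> in M.
          (\<forall>n\<le>N. \<bar>r (real n * h) \<omega> - cir_approx \<kappa> \<theta> \<sigma> r0 h B (real n * h) \<omega>\<bar> powr (p / 2)
             \<le> D * h powr (p / 2) * \<Theta> \<omega>) \<and>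
          (\<forall>t\<in>{0..T}. \<bar>r t \<omega> - cir_approx \<kappa> \<theta> \<sigma> r0 h B t \<omega>\<bar> powr (p / 2)
             \<le> D * (h powr H * (1 + sqrt (ln (real N)))) powr (p / 2) * \<Theta> \<omega>)))"
    using cir_pathwise_bounds[OF assms(1-7) assms(9), where 'w = 'w] by (elim exE conjE) (rule that, assumption, simp)
  have root: "(D * z powr (p / 2) * 9) powr (2 / p) = (D * 9) powr (2 / p) * z" if "z \<ge> 0" for z
    using that D0 assms(9) by (simp add: powr_mult powr_powr)
  show ?thesis
  proof (rule exI[of _ "(D * 9) powr (2 / p)"], rule exI[of _ "(D * 9) powr (2 / p) * 3"], intro allI impI)
    fix M :: "'w measure" and B r :: "real \<Rightarrow> 'w \<Rightarrow> real" and N :: nat and h :: real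
    assume fbm: "fractional_brownian_motion M T H B" and sol: "cir_solution M T \<kappa> \<theta> \<sigma> r0 B r"
      and N: "N \<ge> 1" "h = T / real N" and h1: "h < 1" and h\<xi>: "h * max 0 (- \<kappa> / 2) < 1 - \<xi>"
    have h: "h > 0" "real N * h = T" using N assms(1) by auto
    interpret prob_space M using fbm by (simp add: fractional_brownian_motion_def)
    interpret fbm M T H B by unfold_locales (use fbm assms in auto)
    define \<eta> where "\<eta> = h powr H * (1 + sqrt (ln (real N)))"
    have \<eta>: "\<eta> \<ge> 0" using N(1) by (simp add: \<eta>_def)
    define err where "err t \<omega> = \<bar>r t \<omega> - cir_approx \<kappa> \<theta> \<sigma> r0 h B t \<omega>\<bar> powr (p / 2)" for t \<omega>
    define grid_err where "grid_err \<omega> = (SUP n\<in>{1..N}. err (real n * h) \<omega>)" for \<omega>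
    define path_err where "path_err \<omega> = (SUP t\<in>{0..T}. err t \<omega>)" for \<omega>
    obtain \<Theta> where \<Theta>: "\<Theta> \<in> borel_measurable M" "\<And>\<omega>. \<Theta> \<omega> \<ge> (1 :: real)" "(\<integral>\<^sup>+\<omega>. ennreal (\<Theta> \<omega>) \<partial>M) \<le> ennreal 9"
      and bounds: "AE \<omega> in M. (\<forall>n\<le>N. err (real n * h) \<omega> \<le> D * h powr (p / 2) * \<Theta> \<omega>) \<and>
          (\<forall>t\<in>{0..T}. err t \<omega> \<le> D * \<eta> powr (p / 2) * \<Theta> \<omega>)"
      using D[OF fbm sol N h1 h\<xi>] unfolding err_def \<eta>_def by blast
    have \<Theta>0: "\<Theta> \<omega> \<ge> 0" for \<omega> using \<Theta>(2)[of \<omega>] by simp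
    have err_nonneg: "err t \<omega> \<ge> 0" for t \<omega> by (simp add: err_def)
    have grid: "real n * h \<in> {0..T}" if "n \<le> N" for n
      using that h mult_right_mono[of "real n" "real N" h] by auto
    have err_meas: "err t \<in> borel_measurable M" if t: "t \<in> {0..T}" for t
    proof -
      have [measurable]: "r t \<in> borel_measurable M" using sol t by (simp add: cir_solution_def)
      have [measurable]: "cir_approx \<kappa> \<theta> \<sigma> r0 h B t \<in> borel_measurable M"
        using measurable_cir_approx[OF h t] .
      show ?thesis unfolding err_def[abs_def] by measurable
    qed
    have err_cont: "continuous_on {0..T} (\<lambda>t. err t \<omega>)" if "\<omega> \<in> space M" for \<omega>
    proof -
      have "continuous_on {0..T} (\<lambda>t. r t \<omega>)" using sol that by (simp add: cir_solution_def)
      moreover have "continuous_on {0..T} (\<lambda>t. cir_approx \<kappa> \<theta> \<sigma> r0 h B t \<omega>)"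
        unfolding cir_approx_def using continuous_on_euler_interpolant[OF h(1), where N = N] h(2)
        by (intro continuous_intros) auto
      ultimately show ?thesis unfolding err_def using assms(9)
        by (intro continuous_on_powr' continuous_intros) auto
    qed
    have grid_meas: "grid_err \<in> borel_measurable M"
      unfolding grid_err_def[abs_def] by (intro borel_measurable_cSUP err_meas grid) auto
    have path_meas: "path_err \<in> borel_measurable M"
      unfolding path_err_def[abs_def] using assms(1) by (intro borel_measurable_SUP_continuous err_meas err_cont) auto
    have grid_nonneg: "grid_err \<omega> \<ge> 0" for \<omega>
      unfolding grid_err_def using N(1) err_nonneg by (intro cSUP_upper2[where x = N]) auto
    have path_nonneg: "path_err \<omega> \<ge> 0" if "\<omega> \<in> space M" for \<omega>
      unfolding path_err_def using assms(1) err_nonneg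
      by (intro cSUP_upper2[where x = 0] bounded_imp_bdd_above compact_imp_bounded compact_continuous_image err_cont that) auto
    have grid_bound: "AE \<omega> in M. grid_err \<omega> \<le> D * h powr (p / 2) * \<Theta> \<omega>"
      using bounds by eventually_elim (use N(1) in \<open>auto simp: grid_err_def intro!: cSUP_least\<close>)
    have path_bound: "AE \<omega> in M. path_err \<omega> \<le> D * \<eta> powr (p / 2) * \<Theta> \<omega>"
      using bounds by eventually_elim (use assms(1) in \<open>auto simp: path_err_def intro!: cSUP_least\<close>)
    have Dz: "D * z powr (p / 2) \<ge> 0" for z using D0 by simp
    note E_grid = expectation_le_of_AE_le[OF grid_meas \<Theta>(1) \<Theta>0 grid_nonneg \<Theta>(3) _ Dz grid_bound]
    note E_path = expectation_le_of_AE_le[OF path_meas \<Theta>(1) \<Theta>0 path_nonneg \<Theta>(3) _ Dz path_bound]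
    have "expectation grid_err powr (2 / p) \<le> (D * h powr (p / 2) * 9) powr (2 / p)"
      using E_grid(2,3) assms(9) by (intro powr_mono2) auto
    also have "\<dots> = (D * 9) powr (2 / p) * h" using root h by simp
    finally have 1: "expectation grid_err powr (2 / p) \<le> (D * 9) powr (2 / p) * h" .
    have 2: "expectation path_err powr (2 / p) \<le> (D * 9) powr (2 / p) * 3 * h powr H * sqrt (ln (T / h))" if "N \<ge> 2"
    proof -
      have "expectation path_err powr (2 / p) \<le> (D * \<eta> powr (p / 2) * 9) powr (2 / p)"
        using E_path(2,3) assms(9) by (intro powr_mono2) auto
      also have "\<dots> = (D * 9) powr (2 / p) * \<eta>" using root \<eta> by simp
      also have "\<dots> \<le> (D * 9) powr (2 / p) * (h powr H * (3 * sqrt (ln (real N))))"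
      proof -
        \<comment> \<open>For \<open>N \<ge> 2\<close> the logarithm is at least
          \<open>1 / 4\<close>, so \<open>1 \<le> 2 * sqrt (ln (real N))\<close>; this gives the
          factor 3 in the second constant.\<close>
        have "1 / 4 \<le> ln (2 :: real)" using ln2_ge_two_thirds by simp
        also have "\<dots> \<le> ln (real N)" using that by simp
        finally have "sqrt (1 / 4) \<le> sqrt (ln (real N))" by (rule real_sqrt_le_mono)
        then have "1 + sqrt (ln (real N)) \<le> 3 * sqrt (ln (real N))" by (simp add: real_sqrt_divide)
        then show ?thesis unfolding \<eta>_def by (intro mult_left_mono) auto
      qed
      also have "real N = T / h" using h by (simp add: field_simps)
      finally show ?thesis by (simp add: mult_ac)
    qed
    show "let err = (\<lambda>t \<omega>. \<bar>r t \<omega> - cir_approx \<kappa> \<theta> \<sigma> r0 h B t \<omega>\<bar> powr (p / 2));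
           grid_err = (\<lambda>\<omega>. SUP n\<in>{1..N}. err (real n * h) \<omega>);
           path_err = (\<lambda>\<omega>. SUP t\<in>{0..T}. err t \<omega>)
       in integrable M grid_err \<and>
          (prob_space.expectation M grid_err) powr (2 / p) \<le> (D * 9) powr (2 / p) * h \<and>
          integrable M path_err \<and>
          (N \<ge> 2 \<longrightarrow>
             (prob_space.expectation M path_err) powr (2 / p)
               \<le> (D * 9) powr (2 / p) * 3 * h powr H * sqrt (ln (T / h)))"
      unfolding Let_def
      using E_grid(1) 1 E_path(1) 2 unfolding grid_err_def[abs_def] path_err_def[abs_def] err_def[abs_def] by simp
  qed
qed

end
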